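(* Let $G_1$ and $G_2$ be groups, let $\mathcal{H}_1$ be a collection of subgroups of $G_1$ and $\mathcal{H}_2$ a collection of subgroups of $G_2$, and let $C_1\leq G_1$ and $C_2\leq G_2$ be subgroups with $C_1\approx C_2$ (isomorphic) virtually cyclic groups, where virtually cyclic is used synonymously with two ended (i.e. infinite virtually cyclic). If $G_1$ is one ended relative to the collection $\mathcal{H}_1\cup\{C_1\}$, and $G_2$ is one ended relative to the collection $\mathcal{H}_2\cup\{C_2\}$, then any free product with amalgamation of the form $$G_1 *_{C_1=C_2} G_2$$ is one ended relative to $\mathcal{H}_1\cup\mathcal{H}_2$.
   Context: A $G$-tree is a simplicial tree with a simplicial left action of $G$ without inversions (if $ge=e$ for an edge $e$, then $g$ fixes $e$ pointwise). It is minimal if it contains no proper $G$-invariant subtree, and non-trivial if it is not a single point. A group $G$ is one ended relative to a collection $\mathcal{H}$ of subgroups if for any minimal non-trivial $G$-tree $T$ with finite edge stabilizers there exists a subgroup $H\in\mathcal{H}$ that acts on $T$ without a global fixed point. Equivalently, $G$ is many ended (that is, not one ended) relative to $\mathcal{H}$ if $G$ admits a non-trivial splitting as a graph of groups with finite edge groups in which the groups in $\mathcal{H}$ are conjugate into vertex groups. Subgroups of $G_1$ and $G_2$ are viewed as subgroups of the amalgam via the canonical embeddings.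
   Formalization: The amalgam is assumed to be non-degenerate: C_1 and C_2 are proper subgroups of G_1 and G_2. Without this the claim fails, e.g. for G_1 = G_2 = C_1 = C_2 = Z with both collections empty. *)

theory Defs
  imports "HOL-Algebra.Group_Action" "HOL-Algebra.Elementary_Groups"
begin

section \<open>Simplicial trees and group actions on them\<close>

text \<open>
  A one-dimensional simplicial complex is given by its vertices \<open>V\<close> and its edges \<open>E\<close>, where an
  edge is a two-element set of vertices. (The predicate \<open>tree\<close> of the AFP entry Graph_Theory is
  not suitable: it excludes only directed cycles.)
\<close>

definition walk :: "'v set set \<Rightarrow> 'v list \<Rightarrow> bool" where
  "walk E p \<longleftrightarrow> p \<noteq> [] \<and> successively (\<lambda>u v. {u, v} \<in> E) p"

definition circuit :: "'v set set \<Rightarrow> 'v list \<Rightarrow> bool" where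
  "circuit E p \<longleftrightarrow> walk E p \<and> distinct p \<and> length p \<ge> 3 \<and> {last p, hd p} \<in> E"

definition simplicial_tree :: "'v set \<Rightarrow> 'v set set \<Rightarrow> bool" where
  "simplicial_tree V E \<longleftrightarrow>
     V \<noteq> {} \<and> (\<forall>e\<in>E. e \<subseteq> V \<and> card e = 2) \<and>
     (\<forall>u\<in>V. \<forall>v\<in>V. \<exists>p. walk E p \<and> hd p = u \<and> last p = v) \<and>
     \<not> (\<exists>p. circuit E p)"

locale G_tree = group_action G V \<phi> for G (structure) and V :: "'v set" and \<phi> +
  fixes E :: "'v set set"
  assumes tree: "simplicial_tree V E"
    and simplicial: "\<lbrakk>g \<in> carrier G; e \<in> E\<rbrakk> \<Longrightarrow> \<phi> g ` e \<in> E"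
    and no_inversions: "\<lbrakk>g \<in> carrier G; e \<in> E; \<phi> g ` e = e; x \<in> e\<rbrakk> \<Longrightarrow> \<phi> g x = x"

definition invariant_subtree ::
    "('a, 'm) monoid_scheme \<Rightarrow> 'v set \<Rightarrow> ('a \<Rightarrow> 'v \<Rightarrow> 'v) \<Rightarrow> 'v set set \<Rightarrow> 'v set \<Rightarrow> 'v set set \<Rightarrow> bool"
  where
  "invariant_subtree G V \<phi> E V' E' \<longleftrightarrow>
     V' \<subseteq> V \<and> E' \<subseteq> E \<and> simplicial_tree V' E' \<and>
     (\<forall>g\<in>carrier G. \<phi> g ` V' \<subseteq> V' \<and> (\<forall>e\<in>E'. \<phi> g ` e \<in> E'))"

definition minimal_G_tree ::
    "('a, 'm) monoid_scheme \<Rightarrow> 'v set \<Rightarrow> ('a \<Rightarrow> 'v \<Rightarrow> 'v) \<Rightarrow> 'v set set \<Rightarrow> bool" where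
  "minimal_G_tree G V \<phi> E \<longleftrightarrow>
     G_tree G V \<phi> E \<and> (\<forall>V' E'. invariant_subtree G V \<phi> E V' E' \<longrightarrow> V' = V \<and> E' = E)"

definition finite_edge_stabilizers ::
    "('a, 'm) monoid_scheme \<Rightarrow> ('a \<Rightarrow> 'v \<Rightarrow> 'v) \<Rightarrow> 'v set set \<Rightarrow> bool" where
  "finite_edge_stabilizers G \<phi> E \<longleftrightarrow> (\<forall>e\<in>E. finite (stabilizer G (\<lambda>g. image (\<phi> g)) e))"

text \<open>
  As there are no inversions, a point fixed in the interior of an edge forces both endpoints to be
  fixed, so it is enough to look for fixed vertices.
\<close>

definition has_global_fixed_point :: "'v set \<Rightarrow> ('a \<Rightarrow> 'v \<Rightarrow> 'v) \<Rightarrow> 'a set \<Rightarrow> bool" where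
  "has_global_fixed_point V \<phi> H \<longleftrightarrow> (\<exists>v\<in>V. \<forall>h\<in>H. \<phi> h v = v)"


section \<open>Relative one-endedness\<close>

text \<open>
  A definition cannot quantify over types, so the vertices of the trees are taken from \<open>'a list\<close>,
  where \<open>'a\<close> is the type of the group elements. This is no restriction, as every minimal
  \<open>G\<close>-tree has an isomorphic copy there; see \<open>one_ended_relD\<close> below.
\<close>

definition one_ended_rel :: "('a, 'm) monoid_scheme \<Rightarrow> 'a set set \<Rightarrow> bool" where
  "one_ended_rel G \<H> \<longleftrightarrow>
     (\<forall>(V :: 'a list set) \<phi> E.
        minimal_G_tree G V \<phi> E \<longrightarrow> (\<nexists>v. V = {v}) \<longrightarrow> finite_edge_stabilizers G \<phi> E \<longrightarrow>
        (\<exists>H\<in>\<H>. \<not> has_global_fixed_point V \<phi> H))"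

definition two_ended :: "('a, 'm) monoid_scheme \<Rightarrow> bool" where
  "two_ended G \<longleftrightarrow>
     group G \<and> infinite (carrier G) \<and>
     (\<exists>Z. subgroup Z G \<and> cyclic_group (G\<lparr>carrier := Z\<rparr>) \<and> finite (rcosets\<^bsub>G\<^esub> Z))"


section \<open>Free products with amalgamation\<close>

text \<open>
  For \<open>C \<subseteq> carrier G1\<close> and \<open>f : C \<rightarrow> carrier G2\<close>, the amalgam is the group of words in
  the elements of \<open>G1\<close> and \<open>G2\<close> modulo the least congruence that contains the
  multiplication tables of the two groups and identifies each \<open>c \<in> C\<close> with \<open>f c\<close>.
\<close>

definition amalgam_words :: "('a, 'm) monoid_scheme \<Rightarrow> ('b, 'n) monoid_scheme \<Rightarrow> ('a + 'b) list set"
  where "amalgam_words G1 G2 = lists (carrier G1 <+> carrier G2)"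

inductive_set amalgam_rel ::
    "('a, 'm) monoid_scheme \<Rightarrow> ('b, 'n) monoid_scheme \<Rightarrow> 'a set \<Rightarrow> ('a \<Rightarrow> 'b) \<Rightarrow>
     (('a + 'b) list \<times> ('a + 'b) list) set"
  for G1 G2 C f where
  refl: "w \<in> amalgam_words G1 G2 \<Longrightarrow> (w, w) \<in> amalgam_rel G1 G2 C f"
| sym: "(u, w) \<in> amalgam_rel G1 G2 C f \<Longrightarrow> (w, u) \<in> amalgam_rel G1 G2 C f"
| trans: "(u, v) \<in> amalgam_rel G1 G2 C f \<Longrightarrow> (v, w) \<in> amalgam_rel G1 G2 C f \<Longrightarrow>
    (u, w) \<in> amalgam_rel G1 G2 C f"
| append: "(u, u') \<in> amalgam_rel G1 G2 C f \<Longrightarrow> (w, w') \<in> amalgam_rel G1 G2 C f \<Longrightarrow>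
    (u @ w, u' @ w') \<in> amalgam_rel G1 G2 C f"
| one_left: "([Inl \<one>\<^bsub>G1\<^esub>], []) \<in> amalgam_rel G1 G2 C f"
| one_right: "([Inr \<one>\<^bsub>G2\<^esub>], []) \<in> amalgam_rel G1 G2 C f"
| mult_left: "x \<in> carrier G1 \<Longrightarrow> y \<in> carrier G1 \<Longrightarrow>
    ([Inl x, Inl y], [Inl (x \<otimes>\<^bsub>G1\<^esub> y)]) \<in> amalgam_rel G1 G2 C f"
| mult_right: "x \<in> carrier G2 \<Longrightarrow> y \<in> carrier G2 \<Longrightarrow>
    ([Inr x, Inr y], [Inr (x \<otimes>\<^bsub>G2\<^esub> y)]) \<in> amalgam_rel G1 G2 C f"
| amalgamate: "c \<in> C \<Longrightarrow> ([Inl c], [Inr (f c)]) \<in> amalgam_rel G1 G2 C f"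

definition amalgam ::
    "('a, 'm) monoid_scheme \<Rightarrow> ('b, 'n) monoid_scheme \<Rightarrow> 'a set \<Rightarrow> ('a \<Rightarrow> 'b) \<Rightarrow>
     ('a + 'b) list set monoid" where
  "amalgam G1 G2 C f =
     \<lparr>carrier = amalgam_words G1 G2 // amalgam_rel G1 G2 C f,
      monoid.mult = (\<lambda>A B. \<Union>u\<in>A. \<Union>w\<in>B. amalgam_rel G1 G2 C f `` {u @ w}),
      one = amalgam_rel G1 G2 C f `` {[]}\<rparr>"

definition amalgam_left ::
    "('a, 'm) monoid_scheme \<Rightarrow> ('b, 'n) monoid_scheme \<Rightarrow> 'a set \<Rightarrow> ('a \<Rightarrow> 'b) \<Rightarrow>
     'a \<Rightarrow> ('a + 'b) list set" where
  "amalgam_left G1 G2 C f x = amalgam_rel G1 G2 C f `` {[Inl x]}"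

definition amalgam_right ::
    "('a, 'm) monoid_scheme \<Rightarrow> ('b, 'n) monoid_scheme \<Rightarrow> 'a set \<Rightarrow> ('a \<Rightarrow> 'b) \<Rightarrow>
     'b \<Rightarrow> ('a + 'b) list set" where
  "amalgam_right G1 G2 C f y = amalgam_rel G1 G2 C f `` {[Inr y]}"


subsection \<open>The amalgam is the pushout\<close>

locale amalgam_data =
  G1: group G1 + G2: group G2
  for G1 :: "('a, 'm) monoid_scheme" and G2 :: "('b, 'n) monoid_scheme" +
  fixes C :: "'a set" and f :: "'a \<Rightarrow> 'b"
  assumes C_sub: "C \<subseteq> carrier G1" and f_into: "c \<in> C \<Longrightarrow> f c \<in> carrier G2"
begin

abbreviation "R \<equiv> amalgam_rel G1 G2 C f"
abbreviation "W \<equiv> amalgam_words G1 G2"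

lemma append_words: "u \<in> W \<Longrightarrow> w \<in> W \<Longrightarrow> u @ w \<in> W"
  by (simp add: amalgam_words_def)

lemma rel_words: "(u, w) \<in> R \<Longrightarrow> u \<in> W \<and> w \<in> W"
  by (induction rule: amalgam_rel.induct)
     (use C_sub f_into in \<open>auto simp: amalgam_words_def\<close>)

lemma equiv_rel: "equiv W R"
proof (rule equivI)
  show "R \<subseteq> W \<times> W" using rel_words by auto
  show "refl_on W R" by (auto intro: refl_onI amalgam_rel.refl)
  show "Relation.sym R" by (auto intro: symI amalgam_rel.sym)
  show "Relation.trans R" by (auto intro: transI amalgam_rel.trans)
qed

lemma class_eq: "(u, w) \<in> R \<Longrightarrow> R `` {u} = R `` {w}"
  using equiv_class_eq[OF equiv_rel] .

lemma class_mult: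
  assumes "u \<in> W" "w \<in> W"
  shows "R `` {u} \<otimes>\<^bsub>amalgam G1 G2 C f\<^esub> R `` {w} = R `` {u @ w}"
proof -
  have "(\<Union>u'\<in>R `` {u}. \<Union>w'\<in>R `` {w}. R `` {u' @ w'}) =
        (\<Union>u'\<in>R `` {u}. \<Union>w'\<in>R `` {w}. R `` {u @ w})"
    by (intro SUP_cong HOL.refl class_eq[symmetric] amalgam_rel.append) (auto simp: assms)
  also have "\<dots> = R `` {u @ w}"
    using amalgam_rel.refl[OF assms(1), of C f] amalgam_rel.refl[OF assms(2), of C f]
    by (simp add: Image_singleton) blast
  finally show ?thesis by (simp add: amalgam_def)
qed

lemma amalgam_carrierE:
  assumes "A \<in> carrier (amalgam G1 G2 C f)"
  obtains w where "w \<in> W" "A = R `` {w}"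
  using assms by (auto simp: amalgam_def elim: quotientE)

lemma class_carrier: "w \<in> W \<Longrightarrow> R `` {w} \<in> carrier (amalgam G1 G2 C f)"
  by (simp add: amalgam_def quotientI)

lemma left_inverse_word:
  assumes "w \<in> W" shows "\<exists>w'\<in>W. (w' @ w, []) \<in> R"
  using assms
proof (induction w)
  case Nil then show ?case by (auto intro!: bexI[of _ "[]"] amalgam_rel.refl simp: amalgam_words_def)
next
  case (Cons s w)
  then have s: "s \<in> carrier G1 <+> carrier G2" and w: "w \<in> W"
    by (auto simp: amalgam_words_def)
  obtain w' where w': "w' \<in> W" "(w' @ w, []) \<in> R" using Cons.IH w by blast
  obtain t where t: "[t] \<in> W" "([t, s], []) \<in> R"
  proof (cases s)
    case (Inl x)
    then have x: "x \<in> carrier G1" using s by auto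
    have "([Inl (inv\<^bsub>G1\<^esub> x), Inl x], []) \<in> R"
      using amalgam_rel.mult_left[of "inv\<^bsub>G1\<^esub> x" G1 x] x amalgam_rel.one_left amalgam_rel.trans
      by fastforce
    then show ?thesis using that[of "Inl (inv\<^bsub>G1\<^esub> x)"] x Inl by (auto simp: amalgam_words_def)
  next
    case (Inr x)
    then have x: "x \<in> carrier G2" using s by auto
    have "([Inr (inv\<^bsub>G2\<^esub> x), Inr x], []) \<in> R"
      using amalgam_rel.mult_right[of "inv\<^bsub>G2\<^esub> x" G2 x] x amalgam_rel.one_right amalgam_rel.trans
      by fastforce
    then show ?thesis using that[of "Inr (inv\<^bsub>G2\<^esub> x)"] x Inr by (auto simp: amalgam_words_def)
  qed
  have "(w' @ [t, s] @ w, w' @ [] @ w) \<in> R"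
    using w w' t by (intro amalgam_rel.append amalgam_rel.refl) auto
  then have "((w' @ [t]) @ s # w, []) \<in> R" using w' amalgam_rel.trans by fastforce
  then show ?case using w' t append_words by blast
qed

lemma group_amalgam: "group (amalgam G1 G2 C f)" (is "group ?A")
proof (rule groupI)
  have one: "\<one>\<^bsub>?A\<^esub> = R `` {[]}" by (simp add: amalgam_def)
  have nil: "[] \<in> W" by (simp add: amalgam_words_def)
  show "\<one>\<^bsub>?A\<^esub> \<in> carrier ?A" using one class_carrier nil by simp
  fix x assume "x \<in> carrier ?A"
  then obtain u where u: "u \<in> W" "x = R `` {u}" by (rule amalgam_carrierE)
  show "\<one>\<^bsub>?A\<^esub> \<otimes>\<^bsub>?A\<^esub> x = x" using u nil one class_mult by simp
  show "\<exists>y\<in>carrier ?A. y \<otimes>\<^bsub>?A\<^esub> x = \<one>\<^bsub>?A\<^esub>"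
    using left_inverse_word[OF u(1)] u one class_mult class_carrier class_eq by metis
  fix y assume "y \<in> carrier ?A"
  then obtain v where v: "v \<in> W" "y = R `` {v}" by (rule amalgam_carrierE)
  show "x \<otimes>\<^bsub>?A\<^esub> y \<in> carrier ?A" using u v class_mult class_carrier append_words by simp
  fix z assume "z \<in> carrier ?A"
  then obtain w where w: "w \<in> W" "z = R `` {w}" by (rule amalgam_carrierE)
  show "x \<otimes>\<^bsub>?A\<^esub> y \<otimes>\<^bsub>?A\<^esub> z = x \<otimes>\<^bsub>?A\<^esub> (y \<otimes>\<^bsub>?A\<^esub> z)"
    using u v w by (simp add: class_mult append_words)
qed

lemma amalgam_left_hom: "amalgam_left G1 G2 C f \<in> hom G1 (amalgam G1 G2 C f)"
proof (rule homI)
  fix x assume x: "x \<in> carrier G1"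
  then have x': "[Inl x] \<in> W" by (auto simp: amalgam_words_def)
  then show "amalgam_left G1 G2 C f x \<in> carrier (amalgam G1 G2 C f)"
    by (simp add: amalgam_left_def class_carrier)
  fix y assume y: "y \<in> carrier G1"
  then have y': "[Inl y] \<in> W" by (auto simp: amalgam_words_def)
  show "amalgam_left G1 G2 C f (x \<otimes>\<^bsub>G1\<^esub> y) =
        amalgam_left G1 G2 C f x \<otimes>\<^bsub>amalgam G1 G2 C f\<^esub> amalgam_left G1 G2 C f y"
    using class_eq[OF amalgam_rel.mult_left[OF x y]] by (simp add: amalgam_left_def class_mult x' y')
qed

lemma amalgam_right_hom: "amalgam_right G1 G2 C f \<in> hom G2 (amalgam G1 G2 C f)"
proof (rule homI)
  fix x assume x: "x \<in> carrier G2"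
  then have x': "[Inr x] \<in> W" by (auto simp: amalgam_words_def)
  then show "amalgam_right G1 G2 C f x \<in> carrier (amalgam G1 G2 C f)"
    by (simp add: amalgam_right_def class_carrier)
  fix y assume y: "y \<in> carrier G2"
  then have y': "[Inr y] \<in> W" by (auto simp: amalgam_words_def)
  show "amalgam_right G1 G2 C f (x \<otimes>\<^bsub>G2\<^esub> y) =
        amalgam_right G1 G2 C f x \<otimes>\<^bsub>amalgam G1 G2 C f\<^esub> amalgam_right G1 G2 C f y"
    using class_eq[OF amalgam_rel.mult_right[OF x y]]
    by (simp add: amalgam_right_def class_mult x' y')
qed

lemma amalgam_left_right: "c \<in> C \<Longrightarrow> amalgam_left G1 G2 C f c = amalgam_right G1 G2 C f (f c)"
  by (simp add: amalgam_left_def amalgam_right_def class_eq amalgam_rel.amalgamate)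

lemma amalgam_universal:
  fixes K :: "('k, 'l) monoid_scheme"
  assumes "group K" and h1: "h1 \<in> hom G1 K" and h2: "h2 \<in> hom G2 K"
    and agree: "\<And>c. c \<in> C \<Longrightarrow> h1 c = h2 (f c)"
  shows "\<exists>h\<in>hom (amalgam G1 G2 C f) K.
           (\<forall>x\<in>carrier G1. h (amalgam_left G1 G2 C f x) = h1 x) \<and>
           (\<forall>y\<in>carrier G2. h (amalgam_right G1 G2 C f y) = h2 y)"
proof -
  interpret K: group K by fact
  interpret h1: group_hom G1 K h1 by unfold_locales (rule h1)
  interpret h2: group_hom G2 K h2 by unfold_locales (rule h2)
  define ev where "ev w = foldr (\<lambda>s z. case_sum h1 h2 s \<otimes>\<^bsub>K\<^esub> z) w \<one>\<^bsub>K\<^esub>" for w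
  have s: "case_sum h1 h2 s \<in> carrier K" if "s \<in> carrier G1 <+> carrier G2" for s
    using that by auto
  have ev_closed: "ev w \<in> carrier K" if "w \<in> W" for w
    using that s by (induction w) (auto simp: ev_def amalgam_words_def)
  have ev_append: "ev (u @ w) = ev u \<otimes>\<^bsub>K\<^esub> ev w" if "u \<in> W" "w \<in> W" for u w
    using that(1)
  proof (induction u)
    case Nil then show ?case using ev_closed[OF that(2)] by (simp add: ev_def)
  next
    case (Cons a u)
    then have "a \<in> carrier G1 <+> carrier G2" and u: "u \<in> W" by (auto simp: amalgam_words_def)
    moreover have "ev (b # v) = case_sum h1 h2 b \<otimes>\<^bsub>K\<^esub> ev v" for b v by (simp add: ev_def)
    ultimately show ?case
      using Cons.IH s ev_closed[OF u] ev_closed[OF that(2)] by (simp add: K.m_assoc)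
  qed
  have ev_rel: "ev u = ev w" if "(u, w) \<in> R" for u w
    using that
  proof (induction rule: amalgam_rel.induct)
    case (append u u' w w')
    then show ?case using ev_append rel_words by metis
  next
    case (amalgamate c)
    then show ?case using agree by (simp add: ev_def)
  qed (auto simp: ev_def)
  define h where "h A = ev (SOME w. w \<in> A)" for A
  have h_class: "h (R `` {w}) = ev w" if "w \<in> W" for w
  proof -
    have "w \<in> R `` {w}" using that by (auto intro: amalgam_rel.refl)
    then have "(SOME w'. w' \<in> R `` {w}) \<in> R `` {w}" by (rule someI)
    then show ?thesis using ev_rel by (simp add: h_def)
  qed
  show ?thesis
  proof (intro bexI[of _ h] conjI ballI)
    show "h \<in> hom (amalgam G1 G2 C f) K"
      by (rule homI)
         (auto elim!: amalgam_carrierE simp: h_class ev_closed class_mult append_words ev_append)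
    show "h (amalgam_left G1 G2 C f x) = h1 x" if "x \<in> carrier G1" for x
    proof -
      have "[Inl x] \<in> W" using that by (auto simp: amalgam_words_def)
      then show ?thesis using that by (simp add: amalgam_left_def h_class) (simp add: ev_def)
    qed
    show "h (amalgam_right G1 G2 C f y) = h2 y" if "y \<in> carrier G2" for y
    proof -
      have "[Inr y] \<in> W" using that by (auto simp: amalgam_words_def)
      then show ?thesis using that by (simp add: amalgam_right_def h_class) (simp add: ev_def)
    qed
  qed
qed

end


section \<open>The choice of the vertex type is no restriction\<close>

lemma walk_map:
  assumes "walk E p" shows "walk ((`) j ` E) (map j p)"
proof -
  have "{j u, j v} \<in> (`) j ` E" if "{u, v} \<in> E" for u v
    using imageI[OF that, of "image j"] by simp
  then show ?thesis
    using assms unfolding walk_def successively_map by (auto elim: successively_mono)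
qed

lemma circuit_map:
  assumes "circuit E p" "inj_on j (set p)" shows "circuit ((`) j ` E) (map j p)"
proof -
  have "{last (map j p), hd (map j p)} = j ` {last p, hd p}"
    using assms(1) by (simp add: circuit_def walk_def last_map hd_map)
  also have "\<dots> \<in> (`) j ` E" using assms(1) by (intro imageI) (simp add: circuit_def)
  finally show ?thesis
    using assms walk_map[of E p j] unfolding circuit_def by (simp add: distinct_map)
qed

lemma walk_subset:
  assumes "\<forall>e\<in>E. e \<subseteq> V" "walk E p" "length p \<ge> 2 \<or> hd p \<in> V" shows "set p \<subseteq> V"
proof -
  have *: "successively (\<lambda>u v. {u, v} \<in> E) q \<Longrightarrow> hd q \<in> V \<Longrightarrow> set q \<subseteq> V" for q
    using assms(1) by (induction q rule: induct_list012) (auto, blast)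
  have "hd p \<in> V"
    using assms unfolding walk_def by (cases p rule: remdups_adj.cases) auto
  then show ?thesis using * assms(2) by (simp add: walk_def)
qed

lemma image_image_inv:
  assumes "\<forall>e\<in>E. e \<subseteq> V" "\<And>x. x \<in> V \<Longrightarrow> i (j x) = x"
  shows "(`) i ` (`) j ` E = E"
proof -
  have "i ` j ` e = e" if "e \<in> E" for e
  proof -
    have "(\<lambda>x. i (j x)) ` e = id ` e" using assms that by (intro image_cong) auto
    then show ?thesis by (simp add: image_image)
  qed
  then show ?thesis by (simp add: image_image)
qed

lemma simplicial_tree_image:
  assumes t: "simplicial_tree V E" and j: "inj_on j V"
  shows "simplicial_tree (j ` V) ((`) j ` E)"
  unfolding simplicial_tree_def
proof (intro conjI ballI notI)
  have E: "\<forall>e\<in>E. e \<subseteq> V" using t by (simp add: simplicial_tree_def)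
  show False if "j ` V = {}" using that t by (auto simp: simplicial_tree_def)
  fix e assume "e \<in> (`) j ` E"
  then obtain d where d: "d \<in> E" "e = j ` d" by auto
  show "e \<subseteq> j ` V" using d E by auto
  show "card e = 2"
    using d t E inj_on_subset[OF j] by (metis card_image simplicial_tree_def)
next
  fix u v assume "u \<in> j ` V" "v \<in> j ` V"
  then obtain a b where ab: "a \<in> V" "b \<in> V" "u = j a" "v = j b" by auto
  then obtain p where "walk E p" "hd p = a" "last p = b"
    using t unfolding simplicial_tree_def by blast
  then show "\<exists>p. walk ((`) j ` E) p \<and> hd p = u \<and> last p = v"
    using ab walk_map[of E p j] by (auto intro!: exI[of _ "map j p"] simp: walk_def hd_map last_map)
next
  assume "\<exists>p. circuit ((`) j ` E) p"
  then obtain p where p: "circuit ((`) j ` E) p" ..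
  have E: "\<forall>e\<in>E. e \<subseteq> V" using t by (simp add: simplicial_tree_def)
  have "set p \<subseteq> j ` V"
    using walk_subset[of "(`) j ` E" "j ` V" p] p E by (auto simp: circuit_def)
  then have "inj_on (inv_into V j) (set p)" by (rule inj_on_inv_into)
  then have "circuit ((`) (inv_into V j) ` (`) j ` E) (map (inv_into V j) p)"
    using circuit_map p by blast
  moreover have "(`) (inv_into V j) ` (`) j ` E = E"
    by (rule image_image_inv[OF E]) (simp add: j)
  ultimately show False using t by (auto simp: simplicial_tree_def)
qed

context G_tree
begin

lemma edge_subset: "e \<in> E \<Longrightarrow> e \<subseteq> V"
  using tree by (simp add: simplicial_tree_def)

lemma act_comp: "g \<in> carrier G \<Longrightarrow> h \<in> carrier G \<Longrightarrow> x \<in> V \<Longrightarrow> \<phi> (g \<otimes> h) x = \<phi> g (\<phi> h x)"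
  using composition_rule by blast

lemma translate_walk: "walk E p \<Longrightarrow> g \<in> carrier G \<Longrightarrow> walk E (map (\<phi> g) p)"
proof -
  assume p: "walk E p" and g: "g \<in> carrier G"
  have "{\<phi> g u, \<phi> g v} \<in> E" if "{u, v} \<in> E" for u v
    using simplicial[OF g that] by simp
  then show "walk E (map (\<phi> g) p)"
    using p unfolding walk_def successively_map by (auto elim: successively_mono)
qed

text \<open>A minimal tree is the union of the translates of paths joining a base point to its orbit.\<close>

lemma minimal_surj:
  assumes min: "minimal_G_tree G V \<phi> E"
  shows "\<exists>F :: 'a \<times> 'a \<times> nat \<Rightarrow> 'v. V \<subseteq> range F"
proof -
  interpret G: group G using group_hom by (rule group_hom.axioms)
  note conn = tree[unfolded simplicial_tree_def]
  obtain v0 where v0: "v0 \<in> V" using conn by auto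
  have "\<exists>p. walk E p \<and> hd p = v0 \<and> last p = \<phi> g v0" if "g \<in> carrier G" for g
    using conn v0 element_image[OF that v0] by auto
  then obtain P where P: "\<And>g. g \<in> carrier G \<Longrightarrow> walk E (P g) \<and> hd (P g) = v0 \<and> last (P g) = \<phi> g v0"
    by metis
  define F where "F = (\<lambda>(h, g, n). \<phi> h (P g ! n))"
  define U where "U = (\<Union>h\<in>carrier G. \<Union>g\<in>carrier G. \<phi> h ` set (P g))"
  define D where "D = {e \<in> E. e \<subseteq> U}"
  have PV: "set (P g) \<subseteq> V" if "g \<in> carrier G" for g
    using walk_subset[of E V "P g"] P[OF that] edge_subset v0 by auto
  have UV: "U \<subseteq> V" using PV element_image by (fastforce simp: U_def)
  have inv: "\<phi> k ` U \<subseteq> U" if k: "k \<in> carrier G" for k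
  proof
    fix y assume "y \<in> \<phi> k ` U"
    then obtain h g x where x: "h \<in> carrier G" "g \<in> carrier G" "x \<in> set (P g)" "y = \<phi> k (\<phi> h x)"
      by (auto simp: U_def)
    then have "y = \<phi> (k \<otimes> h) x" using act_comp[OF k x(1)] PV[OF x(2)] by auto
    moreover have "k \<otimes> h \<in> carrier G" using k x(1) by simp
    ultimately show "y \<in> U" using x(2,3) unfolding U_def by blast
  qed
  have walkU: "walk D p" if "walk E p" "set p \<subseteq> U" for p
  proof -
    have "successively (\<lambda>u v. {u, v} \<in> E) p" using that(1) by (simp add: walk_def)
    then have "successively (\<lambda>u v. {u, v} \<in> D) p"
      by (rule successively_mono) (use that(2) in \<open>auto simp: D_def\<close>)
    then show ?thesis using that by (simp add: walk_def)
  qed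
  have Pnth: "walk E (map (\<phi> h) (take (Suc n) (P g)))"
    if "h \<in> carrier G" "g \<in> carrier G" for h g n
  proof (rule translate_walk)
    have "walk E (P g)" using P that by simp
    then show "walk E (take (Suc n) (P g))"
      unfolding walk_def
      by (metis append_take_drop_id successively_append_iff take_eq_Nil nat.distinct(1))
  qed (rule that)
  have "invariant_subtree G V \<phi> E U D"
    unfolding invariant_subtree_def simplicial_tree_def
  proof (intro conjI ballI)
    have rev: "\<exists>q. walk D q \<and> hd q = b \<and> last q = a" if "walk D p" "hd p = a" "last p = b" for p a b
      using that by (intro exI[of _ "rev p"])
        (auto simp: walk_def hd_rev last_rev successively_rev insert_commute)
    have comp: "\<exists>q. walk D q \<and> hd q = a \<and> last q = c"
      if p: "walk D p" "hd p = a" "last p = b" and q: "walk D q" "hd q = b" "last q = c" for p q a b c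
    proof (cases "tl q")
      case Nil
      then have "b = c" using q by (cases q) (auto simp: walk_def)
      then show ?thesis using p by auto
    next
      case (Cons y ys)
      then have qq: "q = b # y # ys" using q by (cases q) (auto simp: walk_def)
      then show ?thesis using p q
        by (intro exI[of _ "p @ y # ys"]) (auto simp: walk_def successively_append_iff)
    qed
    have toU: "\<exists>p. walk D p \<and> hd p = v0 \<and> last p = x" if x: "x \<in> U" for x
    proof -
      obtain h g y where hg: "h \<in> carrier G" "g \<in> carrier G" and y: "y \<in> set (P g)" "x = \<phi> h y"
        using x unfolding U_def by blast
      then obtain n where n: "n < length (P g)" "x = \<phi> h (P g ! n)"
        unfolding in_set_conv_nth by blast
      have ne: "P g \<noteq> []" using n by auto
      let ?q = "map (\<phi> h) (take (Suc n) (P g))"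
      have "walk D ?q"
        using hg by (intro walkU Pnth) (auto simp: U_def dest: in_set_takeD)
      moreover have "hd ?q = \<phi> h v0" using P[OF hg(2)] ne by (simp add: hd_map)
      moreover have "last ?q = x" using n ne by (simp add: last_map take_Suc_conv_app_nth)
      moreover have "walk D (P h)"
      proof (rule walkU)
        show "walk E (P h)" using P hg by simp
        have "\<phi> \<one> x = x" if "x \<in> set (P h)" for x
          using PV[OF hg(1)] that id_eq_one by (metis restrict_apply' subsetD)
        then have "set (P h) = \<phi> \<one> ` set (P h)" by simp
        then show "set (P h) \<subseteq> U" using hg(1) G.one_closed unfolding U_def by blast
      qed
      ultimately show ?thesis using comp[of "P h" v0 "\<phi> h v0" ?q x] P[OF hg(1)] by simp
    qed
    show "\<exists>p. walk D p \<and> hd p = u \<and> last p = w" if uw: "u \<in> U" "w \<in> U" for u w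
    proof -
      obtain p where p: "walk D p" "hd p = v0" "last p = u" using toU[OF uw(1)] by blast
      obtain q where q: "walk D q" "hd q = v0" "last q = w" using toU[OF uw(2)] by blast
      obtain p' where "walk D p'" "hd p' = u" "last p' = v0" using rev[OF p] by blast
      then show ?thesis using comp q by blast
    qed
    show "\<not> (\<exists>p. circuit D p)"
    proof
      assume "\<exists>p. circuit D p"
      then obtain p where "circuit D p" ..
      moreover from this have "walk E p" unfolding circuit_def walk_def
        by (metis (no_types, lifting) D_def mem_Collect_eq successively_mono)
      ultimately have "circuit E p" by (simp add: circuit_def D_def)
      then show False using conn by blast
    qed
    have "P \<one> \<noteq> []" using P[of \<one>] by (simp add: walk_def)
    then have "hd (P \<one>) \<in> set (P \<one>)" by simp
    then have "\<phi> \<one> (hd (P \<one>)) \<in> U"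
      unfolding U_def by (intro UN_I[of \<one>] imageI) auto
    then show "U \<noteq> {}" by auto
    show "U \<subseteq> V" by (rule UV)
    show "D \<subseteq> E" by (auto simp: D_def)
    show "e \<subseteq> U" "card e = 2" if "e \<in> D" for e using that conn by (auto simp: D_def)
    show "\<phi> g ` U \<subseteq> U" if "g \<in> carrier G" for g by (rule inv[OF that])
    show "\<phi> g ` e \<in> D" if "g \<in> carrier G" "e \<in> D" for g e
    proof -
      have "\<phi> g ` e \<subseteq> \<phi> g ` U" using that(2) by (auto simp: D_def)
      then show ?thesis using that simplicial inv[of g] by (auto simp: D_def)
    qed
  qed
  then have "U = V" using min by (simp add: minimal_G_tree_def)
  moreover have "U \<subseteq> range F"
  proof
    fix x assume "x \<in> U"
    then obtain h g y where "y \<in> set (P g)" "x = \<phi> h y" unfolding U_def by blast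
    then obtain n where "x = \<phi> h (P g ! n)" unfolding in_set_conv_nth by blast
    then have "x = F (h, g, n)" by (simp add: F_def)
    then show "x \<in> range F" by blast
  qed
  ultimately show ?thesis by blast
qed

end

theorem one_ended_relD:
  fixes G :: "('a, 'm) monoid_scheme" and V :: "'v set"
  assumes oe: "one_ended_rel G \<H>"
    and min: "minimal_G_tree G V \<phi> E" and nontriv: "\<nexists>v. V = {v}"
    and fin: "finite_edge_stabilizers G \<phi> E"
  shows "\<exists>H\<in>\<H>. \<not> has_global_fixed_point V \<phi> H"
proof -
  interpret G_tree G V \<phi> E using min by (simp add: minimal_G_tree_def)
  obtain F :: "'a \<times> 'a \<times> nat \<Rightarrow> 'v" where F: "V \<subseteq> range F" using minimal_surj[OF min] by blast
  define enc :: "'a \<times> 'a \<times> nat \<Rightarrow> 'a list" where "enc = (\<lambda>(h, g, n). h # g # replicate n h)"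
  have enc: "inj enc"
    by (auto simp: inj_def enc_def)
  define j where "j = enc \<circ> inv_into UNIV F"
  have j: "inj_on j V"
    unfolding j_def using F enc by (intro comp_inj_on inj_on_inv_into) (auto intro: inj_on_subset)
  define i where "i = inv_into V j"
  have ij: "i (j x) = x" if "x \<in> V" for x using that j by (simp add: i_def)
  have ji: "j (i y) = y" if "y \<in> j ` V" for y using that ij by auto
  have inj_i: "inj_on i (j ` V)" using ji by (rule inj_on_inverseI)
  have iV: "i ` j ` V = V" using ij by force
  define \<psi> where "\<psi> g = (\<lambda>y\<in>j ` V. j (\<phi> g (i y)))" for g
  have \<psi>_j: "\<psi> g (j x) = j (\<phi> g x)" if "x \<in> V" for g x using that ij by (simp add: \<psi>_def)
  have \<psi>_img: "\<psi> g ` j ` S = j ` \<phi> g ` S" if "S \<subseteq> V" for g S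
    unfolding image_image using that \<psi>_j by (intro image_cong) auto
  have ij_img: "i ` j ` S = S" if "S \<subseteq> V" for S
  proof -
    have "(\<lambda>x. i (j x)) ` S = id ` S" using that ij by (intro image_cong) auto
    then show ?thesis by (simp add: image_image)
  qed
  have ji_img: "j ` i ` S = S" if "S \<subseteq> j ` V" for S
  proof -
    have "(\<lambda>y. j (i y)) ` S = id ` S" using that ji by (intro image_cong) auto
    then show ?thesis by (simp add: image_image)
  qed
  have act_sub: "\<phi> g ` S \<subseteq> V" if "g \<in> carrier G" "S \<subseteq> V" for g S
    using that element_image by auto
  have Bij: "\<psi> g \<in> Bij (j ` V)" if g: "g \<in> carrier G" for g
  proof -
    have "inj_on (\<psi> g) (j ` V)"
    proof (rule inj_onI)
      fix a b assume "a \<in> j ` V" "b \<in> j ` V" and eq: "\<psi> g a = \<psi> g b"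
      then obtain x y where xy: "x \<in> V" "y \<in> V" "a = j x" "b = j y" by auto
      then have "\<phi> g x = \<phi> g y"
        using eq \<psi>_j element_image[OF g] by (auto dest: inj_onD[OF j])
      then show "a = b" using xy inj_onD[OF inj_prop[OF g]] by auto
    qed
    moreover have "\<psi> g ` j ` V = j ` V" using \<psi>_img[of V] surj_prop[OF g] by simp
    ultimately show ?thesis by (simp add: Bij_def bij_betw_def \<psi>_def)
  qed
  have "group_action G (j ` V) \<psi>"
    unfolding group_action_def group_hom_def group_hom_axioms_def
  proof (intro conjI homI)
    show "group (BijGroup (j ` V))" by (rule group_BijGroup)
    fix g assume g: "g \<in> carrier G"
    show "\<psi> g \<in> carrier (BijGroup (j ` V))" using Bij[OF g] by (simp add: BijGroup_def)
    fix h assume h: "h \<in> carrier G"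
    have "\<psi> (g \<otimes>\<^bsub>G\<^esub> h) = compose (j ` V) (\<psi> g) (\<psi> h)"
    proof (rule extensionalityI[where A = "j ` V"])
      fix y assume "y \<in> j ` V"
      then obtain x where x: "x \<in> V" "y = j x" by auto
      then show "\<psi> (g \<otimes>\<^bsub>G\<^esub> h) y = compose (j ` V) (\<psi> g) (\<psi> h) y"
        using \<psi>_j element_image[OF h x(1)] act_comp[OF g h] by (simp add: compose_def)
    qed (auto simp: \<psi>_def compose_def)
    then show "\<psi> (g \<otimes>\<^bsub>G\<^esub> h) = \<psi> g \<otimes>\<^bsub>BijGroup (j ` V)\<^esub> \<psi> h"
      using Bij[OF g] Bij[OF h] by (simp add: BijGroup_def)
  qed (use group_hom in \<open>rule group_hom.axioms\<close>)
  moreover have "G_tree_axioms G (j ` V) \<psi> ((`) j ` E)"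
  proof
    show "simplicial_tree (j ` V) ((`) j ` E)" by (rule simplicial_tree_image[OF tree j])
    fix g d assume g: "g \<in> carrier G" and "d \<in> (`) j ` E"
    then obtain e where e: "e \<in> E" "d = j ` e" by auto
    note eV = edge_subset[OF e(1)]
    show "\<psi> g ` d \<in> (`) j ` E" using \<psi>_img[OF eV] simplicial[OF g e(1)] e by auto
    fix y assume inv: "\<psi> g ` d = d" and "y \<in> d"
    then obtain x where x: "x \<in> e" "y = j x" using e by auto
    have "j ` \<phi> g ` e = j ` e" using inv \<psi>_img[OF eV] e by simp
    then have "\<phi> g ` e = e" using ij_img[OF eV] ij_img[OF act_sub[OF g eV]] by metis
    then have "\<phi> g x = x" using no_inversions[OF g e(1)] x by simp
    then show "\<psi> g y = y" using \<psi>_j x eV by auto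
  qed
  ultimately have T: "G_tree G (j ` V) \<psi> ((`) j ` E)" by (simp add: G_tree_def)
  have E_sub: "\<forall>e\<in>E. e \<subseteq> V" using edge_subset by blast
  have "minimal_G_tree G (j ` V) \<psi> ((`) j ` E)"
    unfolding minimal_G_tree_def
  proof (intro conjI[OF T] allI impI)
    fix V' E' assume "invariant_subtree G (j ` V) \<psi> ((`) j ` E) V' E'"
    then have V': "V' \<subseteq> j ` V" and E': "E' \<subseteq> (`) j ` E" and t': "simplicial_tree V' E'"
      and inv: "\<And>g. g \<in> carrier G \<Longrightarrow> \<psi> g ` V' \<subseteq> V'"
      "\<And>g e. g \<in> carrier G \<Longrightarrow> e \<in> E' \<Longrightarrow> \<psi> g ` e \<in> E'"
      by (auto simp: invariant_subtree_def)
    have i_act: "\<phi> g ` i ` S = i ` \<psi> g ` S" if "S \<subseteq> j ` V" "g \<in> carrier G" for g S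
    proof -
      have "i ` S \<subseteq> V" using that iV by auto
      then show ?thesis
        using \<psi>_img[of "i ` S" g] ji_img[OF that(1)] ij_img[OF act_sub[OF that(2)]] by metis
    qed
    have e_sub: "e \<subseteq> j ` V" if "e \<in> E'" for e
    proof -
      obtain d where "d \<in> E" "e = j ` d" using E' \<open>e \<in> E'\<close> by blast
      then show ?thesis using E_sub by blast
    qed
    have "invariant_subtree G V \<phi> E (i ` V') ((`) i ` E')"
      unfolding invariant_subtree_def
    proof (intro conjI ballI)
      show "i ` V' \<subseteq> V" using V' iV by auto
      show "(`) i ` E' \<subseteq> E"
        using image_mono[OF E', of "image i"] image_image_inv[of E V i j] E_sub ij by simp
      show "simplicial_tree (i ` V') ((`) i ` E')"
        using simplicial_tree_image[OF t'] inj_on_subset[OF inj_i V'] by blast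
      fix g assume g: "g \<in> carrier G"
      show "\<phi> g ` i ` V' \<subseteq> i ` V'" using i_act[OF V' g] inv(1)[OF g] by auto
      fix e assume "e \<in> (`) i ` E'"
      then show "\<phi> g ` e \<in> (`) i ` E'" using i_act[OF e_sub g] inv(2)[OF g] by auto
    qed
    then have "i ` V' = V" "(`) i ` E' = E" using min by (auto simp: minimal_G_tree_def)
    moreover have "(`) j ` (`) i ` E' = E'"
      using image_image_inv[of E' "j ` V" j i] e_sub ji by blast
    ultimately show "V' = j ` V \<and> E' = (`) j ` E" using ji_img[OF V'] by metis
  qed
  moreover have "\<nexists>v. j ` V = {v}"
  proof
    assume "\<exists>v. j ` V = {v}"
    then obtain v where "j ` V = {v}" ..
    then have "V = {i v}" using iV by auto
    then show False using nontriv by blast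
  qed
  moreover have "finite_edge_stabilizers G \<psi> ((`) j ` E)"
    unfolding finite_edge_stabilizers_def
  proof
    fix d assume "d \<in> (`) j ` E"
    then obtain e where e: "e \<in> E" "d = j ` e" by auto
    note eV = edge_subset[OF e(1)]
    have "stabilizer G (\<lambda>g. (`) (\<psi> g)) d \<subseteq> stabilizer G (\<lambda>g. (`) (\<phi> g)) e"
    proof
      fix g assume "g \<in> stabilizer G (\<lambda>g. (`) (\<psi> g)) d"
      then have g: "g \<in> carrier G" and "j ` \<phi> g ` e = j ` e"
        using \<psi>_img[OF eV] e by (auto simp: stabilizer_def)
      then have "\<phi> g ` e = e" using ij_img[OF eV] ij_img[OF act_sub[OF g eV]] by metis
      then show "g \<in> stabilizer G (\<lambda>g. (`) (\<phi> g)) e" using g by (simp add: stabilizer_def)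
    qed
    then show "finite (stabilizer G (\<lambda>g. (`) (\<psi> g)) d)"
      using fin e finite_subset by (auto simp: finite_edge_stabilizers_def)
  qed
  ultimately obtain H where H: "H \<in> \<H>" and nofix: "\<not> has_global_fixed_point (j ` V) \<psi> H"
    using oe unfolding one_ended_rel_def by blast
  have "\<not> has_global_fixed_point V \<phi> H"
    using nofix \<psi>_j unfolding has_global_fixed_point_def by (metis imageI)
  then show ?thesis using H by blast
qed

end

theory Submission
  imports Defs
begin

text \<open>
  Let the amalgam \<open>A\<close> act minimally on a tree \<open>T\<close> with finite edge stabilizers, so that the groups in
  \<open>\<H>1\<close> and \<open>\<H>2\<close> fix vertices, and let \<open>C\<close> be the amalgamated subgroup.

  Suppose that \<open>C\<close> fixes a vertex \<open>v\<close>. A relatively one ended group fixes every vertex of such a tree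
  that an infinite subset of it fixes (\<open>one_ended_fixes_vertex\<close>), provided that the subgroups in
  question are elliptic: otherwise the hull of the orbit of \<open>v\<close> is a non-trivial tree, and it is minimal
  because the infinite set cannot fix an edge. So both factors fix \<open>v\<close>, hence \<open>A\<close> does, and \<open>T\<close> is a
  point.

  Suppose that \<open>C\<close> fixes no vertex. As \<open>C\<close> is two ended, it has an axis, on which it acts with finitely
  many orbits of edges (\<open>axis_nonempty\<close>, \<open>axis_cofinite\<close>). Therefore an edge \<open>\<tau>\<close> of \<open>T\<close> lies on
  the translate \<open>a \<cdot> axis\<close> for finitely many cosets \<open>a C\<close> only. These cosets are edges of the
  Bass--Serre tree of the amalgam. If \<open>\<tau>\<close> is on the axis, the set of them is not empty, and as a
  finite forest it has a leaf: some vertex of the Bass--Serre tree is on exactly one of its edges. In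
  terms of the groups: after a translation of \<open>\<tau>\<close>, one of the factors \<open>G\<close> has the property that the
  axis contains no translates \<open>g \<tau>\<close> with \<open>g \<in> G - C\<close>. The leaf
  is found as an element of maximal syllable length (\<open>amalgam_syllable_length\<close>).

  But then \<open>G\<close> splits over a finite group relative to \<open>C\<close> and the given subgroups
  (\<open>private_axis_edge_imp_eq\<close>): cut \<open>T\<close> open along the edges \<open>g \<tau>\<close>, collapse the pieces that remain,
  and replace each translate of the axis, now a line that shares no edge with the others, by the cone
  over its vertices. The apex of the cone over the axis is fixed by \<open>C\<close>, and \<open>C\<close> acts on the line with
  finite vertex stabilizers, so the new edges have finite stabilizers. As \<open>G\<close> is one ended relative
  to \<open>C\<close> and the given subgroups, \<open>G\<close> fixes the apex; but the stabilizer of the apex is \<open>C \<noteq> G\<close>.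
\<close>

section \<open>Separation by edges in a simplicial tree\<close>

definition adj :: "'v set set \<Rightarrow> ('v \<times> 'v) set" where
  "adj E = {(u, v). {u, v} \<in> E}"

text \<open>
  Removing an edge from a tree leaves two sides, and the sides of different edges are nested. The
  geometry of trees enters the proof through this relation only: a hull is a union of separating
  edges, and an axis consists of the edges that separate an orbit into two infinite parts. Both are
  then visibly invariant under automorphisms.
\<close>

definition sep :: "'v set set \<Rightarrow> 'v set \<Rightarrow> 'v \<Rightarrow> 'v \<Rightarrow> bool" where
  "sep E e u v \<longleftrightarrow> (u, v) \<notin> (adj (E - {e}))\<^sup>*"

lemma adj_iff: "(u, v) \<in> adj E \<longleftrightarrow> {u, v} \<in> E"
  by (simp add: adj_def)

lemma rtrancl_adj_sym: "(u, v) \<in> (adj E)\<^sup>* \<longleftrightarrow> (v, u) \<in> (adj E)\<^sup>*"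
proof -
  have "sym (adj E)" by (auto simp: sym_def adj_def insert_commute)
  then show ?thesis by (meson sym_rtrancl symD)
qed

lemma rtrancl_adj_mono: "(u, v) \<in> (adj D)\<^sup>* \<Longrightarrow> D \<subseteq> E \<Longrightarrow> (u, v) \<in> (adj E)\<^sup>*"
  using rtrancl_mono[of "adj D" "adj E"] by (auto simp: adj_def)

lemma walk_rtrancl: "walk E p \<Longrightarrow> (hd p, last p) \<in> (adj E)\<^sup>*"
proof (induction p rule: induct_list012)
  case (3 x y zs)
  then have "{x, y} \<in> E" "walk E (y # zs)" by (auto simp: walk_def)
  then show ?case using 3 by (auto simp: adj_iff intro: converse_rtrancl_into_rtrancl)
qed (auto simp: walk_def)

lemma rtrancl_distinct_walk:
  "(u, v) \<in> (adj E)\<^sup>* \<Longrightarrow> \<exists>p. walk E p \<and> distinct p \<and> hd p = u \<and> last p = v"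
proof (induction rule: rtrancl_induct)
  case base show ?case by (rule exI[of _ "[u]"]) (simp add: walk_def)
next
  case (step v w)
  then obtain p where p: "walk E p" "distinct p" "hd p = u" "last p = v" by blast
  show ?case
  proof (cases "w \<in> set p")
    case True
    then obtain xs ys where xy: "p = (xs @ [w]) @ ys" by (metis split_list append.assoc append_Cons append_Nil)
    then show ?thesis using p unfolding walk_def
      by (intro exI[of _ "xs @ [w]"]) (auto simp: successively_append_iff hd_append)
  next
    case False
    then show ?thesis using p step(2) unfolding walk_def
      by (intro exI[of _ "p @ [w]"]) (auto simp: successively_append_iff adj_iff)
  qed
qed

text \<open>
  A circuit through \<open>e\<close> joins the endpoints of \<open>e\<close> in the complement of \<open>e\<close>, so a function \<open>s\<close> that
  changes along no other edge cannot change along \<open>e\<close> either. For a graph that is built from a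
  given tree such a function is easier to exhibit than the absence of circuits.
\<close>

lemma simplicial_treeI:
  assumes ne: "V \<noteq> {}" and E: "\<And>e. e \<in> E \<Longrightarrow> e \<subseteq> V \<and> card e = 2"
    and conn: "\<And>u v. u \<in> V \<Longrightarrow> v \<in> V \<Longrightarrow> (u, v) \<in> (adj E)\<^sup>*"
    and cut: "\<And>e. e \<in> E \<Longrightarrow> \<exists>s :: 'v \<Rightarrow> bool. \<forall>u v. {u, v} \<in> E \<longrightarrow> (s u \<noteq> s v \<longleftrightarrow> {u, v} = e)"
  shows "simplicial_tree V E"
  unfolding simplicial_tree_def
proof (intro conjI ballI notI)
  show "V = {} \<Longrightarrow> False" using ne by simp
  show "e \<subseteq> V" "card e = 2" if "e \<in> E" for e using E[OF that] by auto
  show "\<exists>p. walk E p \<and> hd p = u \<and> last p = v" if "u \<in> V" "v \<in> V" for u v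
    using rtrancl_distinct_walk[OF conn[OF that]] by blast
next
  assume "\<exists>p. circuit E p"
  then obtain p where p: "walk E p" "distinct p" "length p \<ge> 3" "{last p, hd p} \<in> E"
    by (auto simp: circuit_def)
  have ne: "p \<noteq> []" using p(3) by auto
  let ?e = "{last p, hd p}"
  obtain s :: "'v \<Rightarrow> bool" where s: "\<And>u v. {u, v} \<in> E \<Longrightarrow> (s u \<noteq> s v \<longleftrightarrow> {u, v} = ?e)"
    using cut[OF p(4)] by blast
  have same: "s (p ! i) = s (p ! 0)" if "i < length p" for i
    using that
  proof (induction i)
    case (Suc i)
    have "{p ! i, p ! Suc i} \<in> E"
      using p(1) Suc.prems unfolding walk_def by (auto simp: successively_conv_nth)
    moreover have "{p ! i, p ! Suc i} \<noteq> {last p, hd p}"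
    proof
      assume "{p ! i, p ! Suc i} = {last p, hd p}"
      then have "(p ! i = p ! 0 \<and> p ! Suc i = p ! (length p - 1)) \<or>
          (p ! i = p ! (length p - 1) \<and> p ! Suc i = p ! 0)"
        using ne by (simp add: doubleton_eq_iff hd_conv_nth last_conv_nth) blast
      then show False
        using p(2,3) Suc.prems ne by (auto simp: nth_eq_iff_index_eq)
    qed
    ultimately show ?case using s Suc by (metis Suc_lessD)
  qed simp
  have "s (last p) = s (hd p)"
    using same[of "length p - 1"] ne by (simp add: hd_conv_nth last_conv_nth)
  then show False using s[OF p(4)] by simp
qed

locale tree_graph =
  fixes V :: "'v set" and E :: "'v set set"
  assumes is_tree: "simplicial_tree V E"
begin

lemma edge_in_V: "{u, v} \<in> E \<Longrightarrow> u \<in> V" "{u, v} \<in> E \<Longrightarrow> v \<in> V"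
  using is_tree by (auto simp: simplicial_tree_def)

lemma edge_neq: "{u, v} \<in> E \<Longrightarrow> u \<noteq> v"
  using is_tree by (fastforce simp: simplicial_tree_def)

lemma edgeE:
  assumes "e \<in> E" obtains a b where "e = {a, b}" "a \<noteq> b" "a \<in> V" "b \<in> V"
proof -
  have "card e = 2" "e \<subseteq> V" using assms is_tree by (auto simp: simplicial_tree_def)
  then show ?thesis using that by (auto simp: card_2_iff)
qed

lemma other_end:
  assumes "e \<in> E" "x \<in> e" obtains y where "e = {x, y}" "x \<noteq> y" "x \<in> V" "y \<in> V"
  using assms by (elim edgeE) (auto simp: insert_commute)

lemma connected: "u \<in> V \<Longrightarrow> v \<in> V \<Longrightarrow> (u, v) \<in> (adj E)\<^sup>*"
  using is_tree walk_rtrancl unfolding simplicial_tree_def by metis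

lemma sep_refl [simp]: "\<not> sep E e u u"
  by (simp add: sep_def)

lemma sep_sym: "sep E e u v \<longleftrightarrow> sep E e v u"
  unfolding sep_def using rtrancl_adj_sym by metis

lemma sep_triangle: "sep E e u w \<Longrightarrow> sep E e u v \<or> sep E e v w"
  unfolding sep_def by (meson rtrancl_trans)

text \<open>
  A walk that joins the endpoints of an edge without using it would close up to a circuit.
\<close>

lemma sep_edge:
  assumes uv: "{u, v} \<in> E" shows "sep E e u v \<longleftrightarrow> e = {u, v}"
proof
  show "e = {u, v}" if "sep E e u v"
    using that uv by (auto simp: sep_def adj_iff)
  assume e: "e = {u, v}"
  show "sep E e u v"
    unfolding sep_def
  proof
    assume "(u, v) \<in> (adj (E - {e}))\<^sup>*"
    then have "\<exists>p. walk (E - {e}) p \<and> distinct p \<and> hd p = u \<and> last p = v"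
      by (rule rtrancl_distinct_walk)
    then obtain p where p: "walk (E - {e}) p" "distinct p" "hd p = u" "last p = v" by blast
    have ne: "p \<noteq> []" using p(1) by (simp add: walk_def)
    have "length p \<noteq> 1" using p(3,4) edge_neq[OF uv] by (auto simp: length_Suc_conv)
    moreover have "length p \<noteq> 2"
    proof
      assume "length p = 2"
      then obtain x y where xy: "p = [x, y]" by (auto simp: length_Suc_conv numeral_2_eq_2)
      then have "{x, y} \<noteq> e" "x = u" "y = v" using p by (auto simp: walk_def)
      then show False using e by simp
    qed
    moreover have "length p \<noteq> 0" using ne by simp
    ultimately have "length p \<ge> 3" by linarith
    moreover have "walk E p"
      using p(1) unfolding walk_def by (auto elim: successively_mono)
    ultimately have "circuit E p" using p uv by (simp add: circuit_def insert_commute)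
    then show False using is_tree by (auto simp: simplicial_tree_def)
  qed
qed

lemma sep_is_edge: "sep E e u v \<Longrightarrow> u \<in> V \<Longrightarrow> v \<in> V \<Longrightarrow> e \<in> E"
  using connected[of u v] by (cases "e \<in> E") (auto simp: sep_def)

lemma sep_ends:
  assumes e: "{a, b} \<in> E" and x: "x \<in> V"
  shows "sep E {a, b} a x \<longleftrightarrow> \<not> sep E {a, b} b x"
proof -
  have "\<not> sep E {a, b} a x \<or> \<not> sep E {a, b} b x"
    using connected[OF edge_in_V(1)[OF e] x]
  proof (induction rule: rtrancl_induct)
    case (step x y)
    then have "sep E {a, b} x y \<Longrightarrow> {a, b} = {x, y}" using sep_edge by (auto simp: adj_iff)
    then show ?case using step.IH sep_triangle[of "{a, b}"] sep_refl[of "{a, b}" y]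
      by (metis doubleton_eq_iff)
  qed simp
  then show ?thesis
    using sep_edge[OF e, of "{a, b}"] sep_triangle[of "{a, b}" a b x] sep_sym[of "{a, b}" b x] by metis
qed

lemma sep_two_sides:
  assumes "u \<in> V" "v \<in> V" "w \<in> V" "sep E e u v" "sep E e v w"
  shows "\<not> sep E e u w"
proof -
  have "e \<in> E" using sep_is_edge assms by blast
  then obtain a b where ab: "e = {a, b}" by (rule edgeE)
  have *: "sep E e a x \<longleftrightarrow> \<not> sep E e b x" if "x \<in> V" for x
    using sep_ends that \<open>e \<in> E\<close> ab by blast
  show ?thesis
    using *[of u] *[of v] *[of w] assms sep_triangle[of e] sep_sym[of e] by metis
qed

lemma sep_parity:
  assumes "a \<in> V" "u \<in> V" "w \<in> V"
  shows "(sep E e a u \<noteq> sep E e a w) \<longleftrightarrow> sep E e u w"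
  using sep_triangle[of e a u w] sep_triangle[of e a w u] sep_triangle[of e u w a]
    sep_sym[of e u w] sep_sym[of e a u] sep_two_sides[of u a w e] assms by metis

lemma sep_iff_same:
  assumes "\<not> sep E e u v" shows "sep E e u x \<longleftrightarrow> sep E e v x"
  using assms sep_triangle sep_sym by metis

text \<open>
  If \<open>f\<close> lies between \<open>u\<close> and \<open>v\<close> and the connection of \<open>u\<close> to \<open>v\<close> avoids \<open>e\<close>, then it passes
  through \<open>f\<close>, so \<open>f\<close> lies on the same side of \<open>e\<close> as \<open>u\<close>. All uses of the nesting of sides go
  back to this.
\<close>

lemma nested:
  assumes "\<not> sep E e u v" "sep E f u v" "f \<in> E" "e \<noteq> f" "x \<in> f"
  shows "\<not> sep E e u x"
proof -
  have "(u, v) \<in> (adj (E - {e}))\<^sup>*" using assms(1) by (simp add: sep_def)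
  then have "sep E f u v \<longrightarrow> (u, x) \<in> (adj (E - {e}))\<^sup>*"
  proof (induction rule: rtrancl_induct)
    case (step v w)
    have vw: "{v, w} \<in> E" using step(2) by (simp add: adj_iff)
    show ?case
    proof (intro impI)
      assume uw: "sep E f u w"
      show "(u, x) \<in> (adj (E - {e}))\<^sup>*"
      proof (cases "sep E f u v")
        case False
        then have "sep E f v w" using sep_triangle uw by blast
        then have "f = {v, w}" using sep_edge[OF vw] by simp
        then show ?thesis using assms(5) step(1,2) by (auto intro: rtrancl_into_rtrancl)
      qed (use step in blast)
    qed
  qed simp
  then show ?thesis using assms(2) by (simp add: sep_def)
qed

lemma finite_sep: "u \<in> V \<Longrightarrow> v \<in> V \<Longrightarrow> finite {e. sep E e u v}"
proof -
  assume "u \<in> V" "v \<in> V"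
  from connected[OF this] show ?thesis
  proof (induction rule: rtrancl_induct)
    case (step v w)
    have "{e. sep E e u w} \<subseteq> insert {v, w} {e. sep E e u v}"
    proof
      fix e assume "e \<in> {e. sep E e u w}"
      then have "sep E e u v \<or> sep E e v w" using sep_triangle by simp
      then show "e \<in> insert {v, w} {e. sep E e u v}"
        using step(2) sep_edge[of v w e] by (auto simp: adj_iff)
    qed
    then show ?case using step.IH by (auto intro: finite_subset)
  qed simp
qed

text \<open>
  The first edge on the way from a subtree to a vertex outside it: the subtree is given by its
  vertices \<open>S\<close>, any two of which are joined by edges inside \<open>S\<close>.
\<close>

definition gate :: "'v set \<Rightarrow> 'v \<Rightarrow> 'v \<Rightarrow> 'v \<Rightarrow> bool" where
  "gate S x y y' \<longleftrightarrow> y \<in> S \<and> y' \<notin> S \<and> {y, y'} \<in> E \<and> (\<forall>s\<in>S. sep E {y, y'} s x)"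

text \<open>
  On a walk from \<open>S\<close> to \<open>x\<close>, take the last step that leaves \<open>S\<close>: the rest of the walk avoids it, as
  do the connections inside \<open>S\<close>.
\<close>

lemma gate_exists:
  assumes S: "S \<noteq> {}" "S \<subseteq> V" and x: "x \<in> V" "x \<notin> S"
    and D: "D \<subseteq> E" "\<And>e. e \<in> D \<Longrightarrow> e \<subseteq> S"
    and conn: "\<And>s t. s \<in> S \<Longrightarrow> t \<in> S \<Longrightarrow> (s, t) \<in> (adj D)\<^sup>*"
  obtains y y' where "gate S x y y'"
proof -
  obtain s0 where s0: "s0 \<in> S" using S by blast
  have "(s0, x) \<in> (adj E)\<^sup>*" using connected s0 S x by blast
  then have "x \<notin> S \<longrightarrow> (\<exists>y\<in>S. \<exists>y'. y' \<notin> S \<and> {y, y'} \<in> E \<and> (y', x) \<in> (adj (E - {{y, y'}}))\<^sup>*)"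
  proof (induction rule: rtrancl_induct)
    case (step v w)
    show ?case
    proof (intro impI)
      assume w: "w \<notin> S"
      show "\<exists>y\<in>S. \<exists>y'. y' \<notin> S \<and> {y, y'} \<in> E \<and> (y', w) \<in> (adj (E - {{y, y'}}))\<^sup>*"
      proof (cases "v \<in> S")
        case True
        then show ?thesis using w step(2) by (auto simp: adj_iff)
      next
        case False
        then obtain y y' where y: "y \<in> S" "y' \<notin> S" "{y, y'} \<in> E" "(y', v) \<in> (adj (E - {{y, y'}}))\<^sup>*"
          using step.IH by blast
        moreover have "{v, w} \<noteq> {y, y'}" using y False w by (auto simp: doubleton_eq_iff)
        then have "(v, w) \<in> adj (E - {{y, y'}})" using step(2) by (simp add: adj_iff)
        ultimately show ?thesis by (meson rtrancl_into_rtrancl)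
      qed
    qed
  qed (use s0 in simp)
  then have "\<exists>y\<in>S. \<exists>y'. y' \<notin> S \<and> {y, y'} \<in> E \<and> \<not> sep E {y, y'} y' x"
    using x(2) unfolding sep_def by simp
  then obtain y y' where y: "y \<in> S" "y' \<notin> S" "{y, y'} \<in> E" "\<not> sep E {y, y'} y' x"
    by blast
  have "sep E {y, y'} s x" if "s \<in> S" for s
  proof -
    have "D \<subseteq> E - {{y, y'}}" using D y(2) by auto
    then have "\<not> sep E {y, y'} s y"
      using rtrancl_adj_mono[OF conn[OF that y(1)]] by (simp add: sep_def)
    then show ?thesis using y(4) sep_ends[OF y(3) x(1)] sep_iff_same[of "{y, y'}" s y x] by blast
  qed
  then show ?thesis using y that by (auto simp: gate_def)
qed

lemma gate_vertex:
  assumes "a \<in> V" "x \<in> V" "a \<noteq> x"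
  obtains b where "{a, b} \<in> E" "sep E {a, b} a x" "\<not> sep E {a, b} b x"
proof -
  obtain y y' where y: "gate {a} x y y'"
    by (rule gate_exists[of "{a}" x "{}"]) (use assms in auto)
  then have "{a, y'} \<in> E" "sep E {a, y'} a x" by (auto simp: gate_def)
  then show ?thesis using that sep_ends assms by blast
qed

text \<open>
  If there were two gates, the second would lie on the far side of the first, and so would its
  endpoint in \<open>S\<close>.
\<close>

lemma gate_unique:
  assumes g: "gate S x y y'" and h: "gate S x z z'" and S: "S \<subseteq> V" and x: "x \<in> V"
  shows "{y, y'} = {z, z'}"
proof (rule ccontr)
  assume ne: "{y, y'} \<noteq> {z, z'}"
  have e: "{y, y'} \<in> E" and f: "{z, z'} \<in> E" and yz: "y \<in> S" "z \<in> S"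
    and seps: "\<And>s. s \<in> S \<Longrightarrow> sep E {y, y'} s x" "\<And>s. s \<in> S \<Longrightarrow> sep E {z, z'} s x"
    using g h by (auto simp: gate_def)
  have "\<not> sep E {y, y'} y' x" using sep_ends[OF e x] seps yz by blast
  moreover have "sep E {z, z'} y' x"
  proof -
    have "\<not> sep E {z, z'} y y'" using sep_edge[OF e] ne by auto
    then show ?thesis using sep_iff_same seps yz by blast
  qed
  ultimately have "\<not> sep E {y, y'} y' z" using nested[of "{y, y'}" y' x "{z, z'}" z] f ne by blast
  moreover have "\<not> sep E {y, y'} y z"
    using sep_two_sides[of y x z] seps yz S x sep_sym by blast
  ultimately have "\<not> sep E {y, y'} y y'" using sep_triangle sep_sym by metis
  then show False using sep_edge[OF e] by simp
qed

end


section \<open>Groups acting on trees\<close>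

lemma group_actionI:
  assumes G: "group G"
    and ext: "\<And>g. g \<in> carrier G \<Longrightarrow> \<phi> g \<in> extensional V"
    and closed: "\<And>g x. g \<in> carrier G \<Longrightarrow> x \<in> V \<Longrightarrow> \<phi> g x \<in> V"
    and one: "\<And>x. x \<in> V \<Longrightarrow> \<phi> \<one>\<^bsub>G\<^esub> x = x"
    and mult: "\<And>g h x. g \<in> carrier G \<Longrightarrow> h \<in> carrier G \<Longrightarrow> x \<in> V \<Longrightarrow> \<phi> (g \<otimes>\<^bsub>G\<^esub> h) x = \<phi> g (\<phi> h x)"
  shows "group_action G V \<phi>"
proof -
  interpret group G by fact
  have inv: "\<phi> (inv\<^bsub>G\<^esub> g) (\<phi> g x) = x" "\<phi> g (\<phi> (inv\<^bsub>G\<^esub> g) x) = x"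
    if "g \<in> carrier G" "x \<in> V" for g x
    using mult[of "inv\<^bsub>G\<^esub> g" g x] mult[of g "inv\<^bsub>G\<^esub> g" x] one that by auto
  have "bij_betw (\<phi> g) V V" if "g \<in> carrier G" for g
    by (rule bij_betw_byWitness[where f' = "\<phi> (inv\<^bsub>G\<^esub> g)"])
       (use that inv closed in \<open>auto simp: image_subset_iff\<close>)
  then have Bij: "\<phi> g \<in> Bij V" if "g \<in> carrier G" for g using ext that by (simp add: Bij_def)
  have "\<phi> \<in> hom G (BijGroup V)"
  proof (rule homI)
    show "\<phi> g \<in> carrier (BijGroup V)" if "g \<in> carrier G" for g
      using Bij[OF that] by (simp add: BijGroup_def)
    fix g h assume gh: "g \<in> carrier G" "h \<in> carrier G"
    have "\<phi> (g \<otimes>\<^bsub>G\<^esub> h) = compose V (\<phi> g) (\<phi> h)"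
      by (rule extensionalityI[where A = V]) (use gh ext mult in \<open>auto simp: compose_def\<close>)
    then show "\<phi> (g \<otimes>\<^bsub>G\<^esub> h) = \<phi> g \<otimes>\<^bsub>BijGroup V\<^esub> \<phi> h" using gh Bij by (simp add: BijGroup_def)
  qed
  then show ?thesis
    by (simp add: group_action_def group_hom_def group_hom_axioms_def G group_BijGroup)
qed

sublocale G_tree \<subseteq> tree_graph V E
  by unfold_locales (rule tree)

context G_tree
begin

lemma is_group: "group G"
  using group_hom by (rule group_hom.axioms)

sublocale group G by (rule is_group)

lemma act_in: "g \<in> carrier G \<Longrightarrow> x \<in> V \<Longrightarrow> \<phi> g x \<in> V"
  using element_image by blast

lemma act_one: "x \<in> V \<Longrightarrow> \<phi> \<one> x = x"
  using id_eq_one by (metis restrict_apply')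

lemma act_inv: "g \<in> carrier G \<Longrightarrow> x \<in> V \<Longrightarrow> \<phi> (inv g) (\<phi> g x) = x"
  "g \<in> carrier G \<Longrightarrow> x \<in> V \<Longrightarrow> \<phi> g (\<phi> (inv g) x) = x"
  by (simp_all flip: act_comp add: act_one)

lemma act_img_comp:
  assumes "g \<in> carrier G" "h \<in> carrier G" "S \<subseteq> V" shows "\<phi> (g \<otimes> h) ` S = \<phi> g ` \<phi> h ` S"
  unfolding image_image using assms act_comp by (intro image_cong) auto

lemma act_img_one: "S \<subseteq> V \<Longrightarrow> \<phi> \<one> ` S = S"
  using act_one by (force simp: subset_iff)

lemma act_img_inv: "g \<in> carrier G \<Longrightarrow> S \<subseteq> V \<Longrightarrow> \<phi> (inv g) ` \<phi> g ` S = S"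
  "g \<in> carrier G \<Longrightarrow> S \<subseteq> V \<Longrightarrow> \<phi> g ` \<phi> (inv g) ` S = S"
  using act_img_comp[of "inv g" g S] act_img_comp[of g "inv g" S] by (simp_all add: act_img_one)

lemma act_img_in: "g \<in> carrier G \<Longrightarrow> S \<subseteq> V \<Longrightarrow> \<phi> g ` S \<subseteq> V"
  using act_in by auto

lemma act_img_eq_iff:
  "g \<in> carrier G \<Longrightarrow> S \<subseteq> V \<Longrightarrow> T \<subseteq> V \<Longrightarrow> \<phi> g ` S = \<phi> g ` T \<longleftrightarrow> S = T"
  using act_img_inv(1) by metis

lemma sep_act:
  assumes g: "g \<in> carrier G" and e: "e \<in> E" and uv: "u \<in> V" "v \<in> V"
  shows "sep E (\<phi> g ` e) (\<phi> g u) (\<phi> g v) \<longleftrightarrow> sep E e u v"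
proof -
  have imp: "(\<phi> h u, \<phi> h v) \<in> (adj (E - {\<phi> h ` d}))\<^sup>*"
    if h: "h \<in> carrier G" and d: "d \<in> E" and uv: "(u, v) \<in> (adj (E - {d}))\<^sup>*" for h d u v
    using uv
  proof (induction rule: rtrancl_induct)
    case (step v w)
    then have vw: "{v, w} \<in> E" "{v, w} \<noteq> d" by (auto simp: adj_iff)
    have "\<phi> h ` {v, w} \<noteq> \<phi> h ` d"
      using vw act_img_eq_iff[OF h edge_subset edge_subset] d by blast
    then have "(\<phi> h v, \<phi> h w) \<in> adj (E - {\<phi> h ` d})"
      using simplicial[OF h vw(1)] by (simp add: adj_iff)
    then show ?case using step.IH by (rule rtrancl_into_rtrancl[rotated])
  qed simp
  have "sep E (\<phi> g ` e) (\<phi> g u) (\<phi> g v) \<Longrightarrow> sep E e u v"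
    using imp[OF g e] unfolding sep_def by blast
  moreover have "sep E e u v \<Longrightarrow> sep E (\<phi> g ` e) (\<phi> g u) (\<phi> g v)"
    using imp[of "inv g" "\<phi> g ` e" "\<phi> g u" "\<phi> g v"] g simplicial[OF g e] uv
      act_img_inv(1)[OF g edge_subset[OF e]] by (auto simp: sep_def act_inv)
  ultimately show ?thesis by blast
qed

lemma stabilizer_edge: "stabilizer G (\<lambda>g. image (\<phi> g)) e = {g \<in> carrier G. \<phi> g ` e = e}"
  by (simp add: stabilizer_def)

text \<open>
  The first edge from an invariant subtree to a fixed vertex is canonical, hence fixed.
\<close>

lemma gate_fixed:
  assumes g: "g \<in> carrier G" and S: "S \<subseteq> V" "\<phi> g ` S = S" and x: "x \<in> V" "\<phi> g x = x"
    and gate: "gate S x y y'"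
  shows "\<phi> g ` {y, y'} = {y, y'}" "\<phi> g y = y"
proof -
  have y: "y \<in> S" "y' \<notin> S" "{y, y'} \<in> E" "\<And>s. s \<in> S \<Longrightarrow> sep E {y, y'} s x"
    using gate by (auto simp: gate_def)
  have yV: "y \<in> V" "y' \<in> V" using edge_in_V[OF y(3)] by auto
  have "gate S x (\<phi> g y) (\<phi> g y')"
    unfolding gate_def
  proof (intro conjI ballI)
    show "\<phi> g y \<in> S" using S y by auto
    show "\<phi> g y' \<notin> S"
    proof
      assume "\<phi> g y' \<in> S"
      then obtain s where s: "s \<in> S" "\<phi> g s = \<phi> g y'" using S(2) by (metis imageE)
      then have "s \<in> V" using S(1) by blast
      then have "s = y'" using inj_onD[OF inj_prop[OF g] s(2)] yV by blast
      then show False using s y by simp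
    qed
    show "{\<phi> g y, \<phi> g y'} \<in> E" using simplicial[OF g y(3)] by simp
    fix s assume "s \<in> S"
    then obtain t where t: "t \<in> S" "s = \<phi> g t" using S(2) by blast
    have "sep E (\<phi> g ` {y, y'}) (\<phi> g t) (\<phi> g x)"
      using sep_act[OF g y(3) subsetD[OF S(1) t(1)] x(1)] y(4)[OF t(1)] by simp
    then show "sep E {\<phi> g y, \<phi> g y'} s x" using t x by simp
  qed
  then have "{\<phi> g y, \<phi> g y'} = {y, y'}" using gate_unique[OF gate _ S(1) x(1)] by simp
  then show inv: "\<phi> g ` {y, y'} = {y, y'}" by simp
  show "\<phi> g y = y" by (rule no_inversions[OF g y(3) inv]) simp
qed

lemma G_tree_invariant_subtree:
  assumes inv: "invariant_subtree G V \<phi> E U D"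
  shows "G_tree G U (\<lambda>g. restrict (\<phi> g) U) D"
proof -
  have U: "U \<subseteq> V" "D \<subseteq> E" "simplicial_tree U D" "\<And>g. g \<in> carrier G \<Longrightarrow> \<phi> g ` U \<subseteq> U"
    "\<And>g e. g \<in> carrier G \<Longrightarrow> e \<in> D \<Longrightarrow> \<phi> g ` e \<in> D"
    using inv by (auto simp: invariant_subtree_def)
  have DU: "e \<subseteq> U" if "e \<in> D" for e using U(3) that by (auto simp: simplicial_tree_def)
  have img: "restrict (\<phi> g) U ` e = \<phi> g ` e" if "e \<in> D" for g e
    using DU[OF that] by (intro image_cong) auto
  interpret U: group_action G U "\<lambda>g. restrict (\<phi> g) U"
  proof (rule group_actionI[OF is_group])
    have UV: "x \<in> V" if "x \<in> U" for x using that U(1) by blast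
    have closed: "\<phi> g x \<in> U" if "g \<in> carrier G" "x \<in> U" for g x using U(4) that by blast
    show "restrict (\<phi> g) U x \<in> U" if "g \<in> carrier G" "x \<in> U" for g x
      using closed that by simp
    show "restrict (\<phi> \<one>) U x = x" if "x \<in> U" for x using that UV act_one by simp
    show "restrict (\<phi> (g \<otimes> h)) U x = restrict (\<phi> g) U (restrict (\<phi> h) U x)"
      if "g \<in> carrier G" "h \<in> carrier G" "x \<in> U" for g h x
      using that closed act_comp UV by simp
  qed simp
  show ?thesis
  proof unfold_locales
    show "simplicial_tree U D" by (rule U)
    show "restrict (\<phi> g) U ` e \<in> D" if "g \<in> carrier G" "e \<in> D" for g e
      using U(5) img that by simp
    show "restrict (\<phi> g) U x = x" if "g \<in> carrier G" "e \<in> D" "restrict (\<phi> g) U ` e = e" "x \<in> e" for g e x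
      using no_inversions[of g e x] that img DU[of e] U(2) by auto
  qed
qed

end

lemma G_tree_pullback:
  assumes T: "G_tree A V \<phi> E" and G: "group G" and h: "h \<in> hom G A"
  shows "G_tree G V (\<lambda>g. \<phi> (h g)) E"
proof -
  interpret G_tree A V \<phi> E by fact
  interpret h: group_hom G A h by (simp add: group_hom_def group_hom_axioms_def G h is_group)
  have hom: "(\<lambda>g. \<phi> (h g)) \<in> hom G (BijGroup V)"
    using h group_hom.homh[OF group_hom] by (auto simp: hom_def Pi_iff)
  interpret G: group_action G V "\<lambda>g. \<phi> (h g)"
    by (simp add: group_action_def group_hom_def group_hom_axioms_def G group_BijGroup hom)
  show ?thesis
  proof unfold_locales
    show "simplicial_tree V E" by (rule tree)
    show "\<phi> (h g) ` e \<in> E" if "g \<in> carrier G" "e \<in> E" for g e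
      using simplicial[OF h.hom_closed] that by blast
    show "\<phi> (h g) x = x" if "g \<in> carrier G" "e \<in> E" "\<phi> (h g) ` e = e" "x \<in> e" for g e x
      by (rule no_inversions[OF h.hom_closed[OF that(1)] that(2-)])
  qed
qed

lemma finite_edge_stabilizers_pullback:
  assumes fin: "finite_edge_stabilizers A \<phi> E" and h: "h \<in> hom G A" "inj_on h (carrier G)"
  shows "finite_edge_stabilizers G (\<lambda>g. \<phi> (h g)) E"
  unfolding finite_edge_stabilizers_def
proof
  fix e assume e: "e \<in> E"
  let ?S = "stabilizer G (\<lambda>g. image (\<phi> (h g))) e"
  have "h ` ?S \<subseteq> stabilizer A (\<lambda>g. image (\<phi> g)) e"
    using h(1) by (auto simp: stabilizer_def hom_def)
  then have "finite (h ` ?S)" using fin e finite_subset unfolding finite_edge_stabilizers_def by blast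
  moreover have "inj_on h ?S" using h(2) by (rule inj_on_subset) (auto simp: stabilizer_def)
  ultimately show "finite ?S" using finite_imageD by blast
qed


section \<open>Vertices fixed by an infinite subgroup of a relatively one ended group\<close>

context G_tree
begin

text \<open>
  Otherwise the hull of the orbit of \<open>v\<close> is a non-trivial tree, whose edges are those that separate
  two points of the orbit. It is minimal: an invariant subtree that misses \<open>v\<close> has a first edge
  towards \<open>v\<close>, and this edge is fixed by the infinite set \<open>C\<close>. Elliptic subgroups remain elliptic,
  for the same reason: if the fixed vertex is outside the hull, then the gate to it is fixed.
\<close>

lemma one_ended_fixes_vertex:
  assumes oe: "one_ended_rel G \<H>" and \<H>: "\<And>H. H \<in> \<H> \<Longrightarrow> H \<subseteq> carrier G"
    and fin: "finite_edge_stabilizers G \<phi> E"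
    and ell: "\<And>H. H \<in> \<H> \<Longrightarrow> has_global_fixed_point V \<phi> H"
    and C: "C \<subseteq> carrier G" "infinite C" and v: "v \<in> V" "\<And>c. c \<in> C \<Longrightarrow> \<phi> c v = v"
    and g: "g \<in> carrier G"
  shows "\<phi> g v = v"
proof (rule ccontr)
  assume moved: "\<phi> g v \<noteq> v"
  \<comment> \<open>The orbit of \<open>v\<close>, and the edges \<open>D\<close> and vertices \<open>U\<close> of its hull.\<close>
  define Orb where "Orb = {\<phi> h v |h. h \<in> carrier G}"
  define D where "D = {e. \<exists>a\<in>Orb. \<exists>b\<in>Orb. sep E e a b}"
  define U where "U = \<Union>D"
  have OrbV: "Orb \<subseteq> V" using act_in v by (auto simp: Orb_def)
  have DE: "D \<subseteq> E" using sep_is_edge OrbV by (auto simp: D_def)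
  have UV: "U \<subseteq> V" using DE edge_subset by (auto simp: U_def)
  have vO: "v \<in> Orb" using act_one[OF v(1)] by (force simp: Orb_def)
  have gO: "\<phi> g v \<in> Orb" using g by (auto simp: Orb_def)
  have Orb_inv: "\<phi> h a \<in> Orb" if "h \<in> carrier G" "a \<in> Orb" for h a
  proof -
    obtain k where k: "k \<in> carrier G" "a = \<phi> k v" using \<open>a \<in> Orb\<close> by (auto simp: Orb_def)
    then have "\<phi> h a = \<phi> (h \<otimes> k) v" using act_comp[OF that(1)] v by simp
    then show ?thesis using k that by (auto simp: Orb_def)
  qed
  have OrbU: "a \<in> U" if a: "a \<in> Orb" for a
  proof -
    obtain b where b: "b \<in> Orb" "a \<noteq> b" using vO gO moved by metis
    then obtain c where "{a, c} \<in> E" "sep E {a, c} a b"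
      using gate_vertex[of a b] a OrbV by auto
    then have "{a, c} \<in> D" using a b by (auto simp: D_def)
    then show ?thesis by (auto simp: U_def)
  qed
  \<comment> \<open>The hull is connected: an edge that leaves the component \<open>S\<close> of \<open>v\<close> separates no two points of
    the orbit. Hence \<open>S\<close> contains the orbit and, by nesting, every edge between two of its points.\<close>
  define S where "S = {y. (v, y) \<in> (adj D)\<^sup>*}"
  have S_step: "y' \<in> S" if "y \<in> S" "{y, y'} \<in> D" for y y'
    using that unfolding S_def by (auto simp: adj_iff intro: rtrancl_into_rtrancl)
  have SV: "S \<subseteq> V"
  proof
    fix y assume "y \<in> S"
    then have "(v, y) \<in> (adj E)\<^sup>*" using rtrancl_adj_mono[OF _ DE] by (simp add: S_def)
    then show "y \<in> V" by (induction rule: rtrancl_induct) (use v edge_in_V in \<open>auto simp: adj_iff\<close>)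
  qed
  have S_conn: "(s, t) \<in> (adj D)\<^sup>*" if "s \<in> S" "t \<in> S" for s t
    using that rtrancl_adj_sym[of v s D] unfolding S_def by (auto intro: rtrancl_trans)
  have S_gate: "\<exists>y y'. gate S x y y' \<and> {y, y'} \<notin> D" if x: "x \<in> V" "x \<notin> S" for x
  proof -
    have "S \<noteq> {}" by (auto simp: S_def)
    moreover have "(s, t) \<in> (adj {e \<in> D. e \<subseteq> S})\<^sup>*" if "s \<in> S" "t \<in> S" for s t
    proof -
      have "(s, t) \<in> (adj D)\<^sup>*" using S_conn that by blast
      then have "(s, t) \<in> (adj {e \<in> D. e \<subseteq> S})\<^sup>* \<and> t \<in> S"
      proof (induction rule: rtrancl_induct)
        case base then show ?case using \<open>s \<in> S\<close> by simp
      next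
        case (step t u)
        then have "(t, u) \<in> adj {e \<in> D. e \<subseteq> S}" using S_step by (auto simp: adj_iff)
        then show ?case using step S_step by (auto simp: adj_iff intro: rtrancl_into_rtrancl)
      qed
      then show ?thesis ..
    qed
    ultimately obtain y y' where y: "gate S x y y'"
      using gate_exists[of S x "{e \<in> D. e \<subseteq> S}"] SV x DE by blast
    then show ?thesis using S_step unfolding gate_def by blast
  qed
  have OrbS: "Orb \<subseteq> S"
  proof
    fix b assume b: "b \<in> Orb"
    show "b \<in> S"
    proof (rule ccontr)
      assume "b \<notin> S"
      then obtain y y' where y: "gate S b y y'" "{y, y'} \<notin> D" using S_gate b OrbV by blast
      have "v \<in> S" by (simp add: S_def)
      then have "sep E {y, y'} v b" using y(1) by (simp add: gate_def)
      then show False using y(2) vO b by (auto simp: D_def)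
    qed
  qed
  have US: "x \<in> S" if x: "x \<in> U" for x
  proof (rule ccontr)
    assume xS: "x \<notin> S"
    then obtain y y' where y: "gate S x y y'" "{y, y'} \<notin> D" using S_gate x UV by blast
    obtain e where e0: "e \<in> D" "x \<in> e" using x by (auto simp: U_def)
    then obtain a b where e: "e \<in> D" "x \<in> e" "a \<in> Orb" "b \<in> Orb" "sep E e a b"
      unfolding D_def by blast
    have "\<not> sep E {y, y'} a b" using y(2) e by (auto simp: D_def)
    then have "\<not> sep E {y, y'} a x"
      using nested[of "{y, y'}" a b e x] e DE y(2) by blast
    moreover have "a \<in> S" using e OrbS by blast
    ultimately show False using y(1) by (auto simp: gate_def)
  qed
  have D_inv: "\<phi> h ` e \<in> D" if "h \<in> carrier G" "e \<in> D" for h e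
  proof -
    obtain a b where ab: "a \<in> Orb" "b \<in> Orb" "sep E e a b" using \<open>e \<in> D\<close> by (auto simp: D_def)
    then have "sep E (\<phi> h ` e) (\<phi> h a) (\<phi> h b)" using sep_act that DE OrbV by blast
    then show ?thesis using Orb_inv ab that by (auto simp: D_def)
  qed
  have U_inv: "\<phi> h ` U \<subseteq> U" if "h \<in> carrier G" for h
    using D_inv[OF that] by (auto simp: U_def)
  have inv: "invariant_subtree G V \<phi> E U D"
    unfolding invariant_subtree_def
  proof (intro conjI ballI)
    show "simplicial_tree U D"
    proof (rule simplicial_treeI)
      show "U \<noteq> {}" using OrbU vO by auto
      show "e \<subseteq> U \<and> card e = 2" if "e \<in> D" for e
        using that DE tree by (auto simp: U_def simplicial_tree_def)
      show "(u, w) \<in> (adj D)\<^sup>*" if "u \<in> U" "w \<in> U" for u w using S_conn US that by blast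
      show "\<exists>s :: _ \<Rightarrow> bool. \<forall>u w. {u, w} \<in> D \<longrightarrow> (s u \<noteq> s w \<longleftrightarrow> {u, w} = e)" if e: "e \<in> D" for e
      proof -
        have eE: "e \<in> E" using e DE by blast
        obtain a b where ab: "e = {a, b}" "a \<in> V" using eE by (rule edgeE)
        have "(sep E e a u \<noteq> sep E e a w) = ({u, w} = e)" if "{u, w} \<in> D" for u w
        proof -
          have uw: "{u, w} \<in> E" using that DE by blast
          have "(sep E e a u \<noteq> sep E e a w) = sep E e u w"
            by (rule sep_parity[OF ab(2) edge_in_V[OF uw]])
          then show ?thesis using sep_edge[OF uw] by auto
        qed
        then show ?thesis by blast
      qed
    qed
  qed (use UV DE U_inv D_inv in auto)
  let ?\<psi> = "\<lambda>h. restrict (\<phi> h) U"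
  interpret U: G_tree G U ?\<psi> D by (rule G_tree_invariant_subtree[OF inv])
  have img: "?\<psi> h ` e = \<phi> h ` e" if "e \<subseteq> U" for h e
    using that by (intro image_cong) auto
  have "minimal_G_tree G U ?\<psi> D"
    unfolding minimal_G_tree_def
  proof (intro conjI allI impI)
    show "G_tree G U ?\<psi> D" by (rule U.G_tree_axioms)
    fix V' E' assume inv': "invariant_subtree G U ?\<psi> D V' E'"
    then have V': "V' \<subseteq> U" "E' \<subseteq> D" and tree': "simplicial_tree V' E'"
      and V'_inv': "\<And>h. h \<in> carrier G \<Longrightarrow> ?\<psi> h ` V' \<subseteq> V'"
      by (simp_all add: invariant_subtree_def)
    have V'_inv: "\<phi> h ` V' \<subseteq> V'" if "h \<in> carrier G" for h
      using V'_inv'[OF that] unfolding img[OF V'(1)] .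
    interpret T': tree_graph V' E' by unfold_locales (rule tree')
    have V'_V: "V' \<subseteq> V" using V' UV by blast
    have V'_eq: "\<phi> h ` V' = V'" if h: "h \<in> carrier G" for h
    proof
      show "\<phi> h ` V' \<subseteq> V'" by (rule V'_inv[OF h])
      have "\<phi> h ` \<phi> (inv h) ` V' \<subseteq> \<phi> h ` V'" by (intro image_mono V'_inv inv_closed h)
      then show "V' \<subseteq> \<phi> h ` V'" using act_img_inv(2)[OF h V'_V] by simp
    qed
    have vV': "v \<in> V'"
      \<comment> \<open>otherwise \<open>C\<close> fixes the gate from the subtree to \<open>v\<close>\<close>
    proof (rule ccontr)
      assume "v \<notin> V'"
      moreover have "e \<subseteq> V'" if "e \<in> E'" for e using T'.edgeE[OF that] by blast
      moreover have "V' \<noteq> {}" using tree' by (simp add: simplicial_tree_def)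
      ultimately obtain y y' where y: "gate V' v y y'"
        using gate_exists[of V' v E'] V' DE V'_V v(1) T'.connected by blast
      have "C \<subseteq> stabilizer G (\<lambda>g. image (\<phi> g)) {y, y'}"
        using gate_fixed(1)[OF _ V'_V V'_eq v(1) v(2) y] C(1) unfolding stabilizer_edge by blast
      moreover have "{y, y'} \<in> E" using y by (simp add: gate_def)
      ultimately show False
        using fin C(2) finite_subset unfolding finite_edge_stabilizers_def by blast
    qed
    have OrbV': "Orb \<subseteq> V'" using V'_inv vV' by (auto simp: Orb_def)
    have "D \<subseteq> E'"
    proof
      fix e assume "e \<in> D"
      then obtain a b where ab: "a \<in> Orb" "b \<in> Orb" "sep E e a b" by (auto simp: D_def)
      then have "(a, b) \<in> (adj E')\<^sup>*" using T'.connected OrbV' by blast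
      then show "e \<in> E'" using ab(3) rtrancl_adj_mono[of a b E' "E - {e}"] V'(2) DE
        unfolding sep_def by blast
    qed
    then have "E' = D" using V'(2) by blast
    moreover have "U \<subseteq> V'" using T'.edgeE \<open>D \<subseteq> E'\<close> unfolding U_def by blast
    ultimately show "V' = U" "E' = D" using V'(1) by auto
  qed
  moreover have "\<nexists>x. U = {x}" using OrbU[OF vO] OrbU[OF gO] moved by auto
  moreover have "finite_edge_stabilizers G ?\<psi> D"
    unfolding finite_edge_stabilizers_def
  proof
    fix e assume e: "e \<in> D"
    then have "e \<subseteq> U" by (auto simp: U_def)
    then have "stabilizer G (\<lambda>g. image (?\<psi> g)) e = stabilizer G (\<lambda>g. image (\<phi> g)) e"
      by (simp only: stabilizer_def img)
    then show "finite (stabilizer G (\<lambda>g. image (?\<psi> g)) e)"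
      using fin e DE unfolding finite_edge_stabilizers_def by auto
  qed
  ultimately obtain H where H: "H \<in> \<H>" "\<not> has_global_fixed_point U ?\<psi> H"
    using one_ended_relD[OF oe] by blast
  obtain w where w: "w \<in> V" "\<And>h. h \<in> H \<Longrightarrow> \<phi> h w = w"
    using ell[OF H(1)] by (auto simp: has_global_fixed_point_def)
  have "\<exists>y\<in>U. \<forall>h\<in>H. \<phi> h y = y"
  proof (cases "w \<in> U")
    case False
    have "e \<subseteq> U" if "e \<in> D" for e using that by (auto simp: U_def)
    then obtain y y' where y: "gate U w y y'"
      using gate_exists[of U w D] OrbU vO UV DE w(1) False S_conn US by blast
    have U_eq: "\<phi> h ` U = U" if h: "h \<in> carrier G" for h
    proof
      show "\<phi> h ` U \<subseteq> U" by (rule U_inv[OF h])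
      have "\<phi> h ` \<phi> (inv h) ` U \<subseteq> \<phi> h ` U" by (intro image_mono U_inv inv_closed h)
      then show "U \<subseteq> \<phi> h ` U" using act_img_inv(2)[OF h UV] by simp
    qed
    have "\<phi> h y = y" if "h \<in> H" for h
      using gate_fixed(2)[OF _ UV U_eq w(1) w(2)[OF that] y] \<H>[OF H(1)] that by blast
    then show ?thesis using y by (auto simp: gate_def)
  qed (use w in blast)
  then show False using H(2) by (auto simp: has_global_fixed_point_def)
qed

end


section \<open>Two ended groups\<close>

lemma two_ended_powers:
  assumes K: "two_ended K"
  obtains z F where "z \<in> carrier K" "finite F" "F \<subseteq> carrier K"
    "\<And>c. c \<in> carrier K \<Longrightarrow> \<exists>k::int. \<exists>x\<in>F. c = z [^]\<^bsub>K\<^esub> k \<otimes>\<^bsub>K\<^esub> x"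
proof -
  interpret group K using K by (simp add: two_ended_def)
  obtain Z where Z: "subgroup Z K" "cyclic_group (K\<lparr>carrier := Z\<rparr>)" "finite (rcosets\<^bsub>K\<^esub> Z)"
    using K by (auto simp: two_ended_def)
  interpret Z: subgroup Z K by fact
  interpret ZK: group "K\<lparr>carrier := Z\<rparr>" by (rule subgroup_imp_group[OF Z(1)])
  obtain z where z: "z \<in> Z" "Z = range (\<lambda>n::int. z [^]\<^bsub>K\<lparr>carrier := Z\<rparr>\<^esub> n)"
    using Z(2) ZK.cyclic_group by auto
  define rep where "rep R = (SOME x. x \<in> carrier K \<and> R = Z #>\<^bsub>K\<^esub> x)" for R
  have rep: "rep R \<in> carrier K \<and> R = Z #>\<^bsub>K\<^esub> rep R" if "R \<in> rcosets\<^bsub>K\<^esub> Z" for R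
    unfolding rep_def by (rule someI_ex) (use that in \<open>auto simp: RCOSETS_def\<close>)
  show ?thesis
  proof (rule that[of z "rep ` (rcosets\<^bsub>K\<^esub> Z)"])
    show "z \<in> carrier K" "finite (rep ` (rcosets\<^bsub>K\<^esub> Z))" "rep ` (rcosets\<^bsub>K\<^esub> Z) \<subseteq> carrier K"
      using z Z rep by auto
    fix c assume c: "c \<in> carrier K"
    let ?x = "rep (Z #>\<^bsub>K\<^esub> c)"
    have cosets: "Z #>\<^bsub>K\<^esub> c \<in> rcosets\<^bsub>K\<^esub> Z" using c by (auto simp: RCOSETS_def)
    have "c \<in> Z #>\<^bsub>K\<^esub> c" using c Z.one_closed by (force simp: r_coset_def)
    then have "c \<in> Z #>\<^bsub>K\<^esub> ?x" using rep[OF cosets] by simp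
    then obtain h where "h \<in> Z" "c = h \<otimes>\<^bsub>K\<^esub> ?x" by (auto simp: r_coset_def)
    moreover from this obtain k :: int where "h = z [^]\<^bsub>K\<^esub> k"
      using z(2) int_pow_consistent[OF Z(1) z(1)] by (metis imageE)
    ultimately show "\<exists>k::int. \<exists>x\<in>rep ` (rcosets\<^bsub>K\<^esub> Z). c = z [^]\<^bsub>K\<^esub> k \<otimes>\<^bsub>K\<^esub> x"
      using cosets by blast
  qed
qed

text \<open>
  An infinite subgroup contains a non-trivial power of \<open>z\<close>, by the pigeonhole principle, and
  therefore has finite index.
\<close>

lemma two_ended_infinite_subgroup:
  assumes K: "two_ended K" and D: "subgroup D K" "infinite D"
  obtains F where "finite F" "F \<subseteq> carrier K"
    "\<And>c. c \<in> carrier K \<Longrightarrow> \<exists>d\<in>D. \<exists>x\<in>F. c = d \<otimes>\<^bsub>K\<^esub> x"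
proof -
  interpret group K using K by (simp add: two_ended_def)
  interpret D: subgroup D K by fact
  obtain z F where z: "z \<in> carrier K" and F: "finite F" "F \<subseteq> carrier K"
    and zF: "\<And>c. c \<in> carrier K \<Longrightarrow> \<exists>k::int. \<exists>x\<in>F. c = z [^]\<^bsub>K\<^esub> k \<otimes>\<^bsub>K\<^esub> x"
    by (rule two_ended_powers[OF K]) blast
  have "\<exists>k::int. \<exists>x. x \<in> F \<and> d = z [^]\<^bsub>K\<^esub> k \<otimes>\<^bsub>K\<^esub> x" if "d \<in> D" for d
    using zF that by (meson D.mem_carrier)
  then obtain e :: "'a \<Rightarrow> int" and x where ex: "\<And>d. d \<in> D \<Longrightarrow> x d \<in> F \<and> d = z [^]\<^bsub>K\<^esub> e d \<otimes>\<^bsub>K\<^esub> x d"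
    by metis
  have "x ` D \<subseteq> F" using ex by auto
  then have "\<not> inj_on x D" using D(2) F(1) inj_on_finite by blast
  then obtain d d' where d: "d \<in> D" "d' \<in> D" "d \<noteq> d'" "x d = x d'" by (auto simp: inj_on_def)
  define m where "m = e d - e d'"
  have xd: "x d' \<in> carrier K" using ex d F by blast
  have m0: "m \<noteq> 0" using ex[OF d(1)] ex[OF d(2)] d(3,4) by (auto simp: m_def)
  have "d \<otimes>\<^bsub>K\<^esub> inv\<^bsub>K\<^esub> d' = (z [^]\<^bsub>K\<^esub> e d \<otimes>\<^bsub>K\<^esub> x d') \<otimes>\<^bsub>K\<^esub> inv\<^bsub>K\<^esub> (z [^]\<^bsub>K\<^esub> e d' \<otimes>\<^bsub>K\<^esub> x d')"
    using ex[OF d(1)] ex[OF d(2)] d(4) by metis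
  also have "\<dots> = z [^]\<^bsub>K\<^esub> e d \<otimes>\<^bsub>K\<^esub> inv\<^bsub>K\<^esub> (z [^]\<^bsub>K\<^esub> e d')"
    using xd z by (simp add: inv_mult_group m_assoc) (simp flip: m_assoc)
  also have "\<dots> = z [^]\<^bsub>K\<^esub> m" using z by (simp add: m_def int_pow_diff)
  finally have zm: "z [^]\<^bsub>K\<^esub> m \<in> D" using d by (metis D.m_closed D.m_inv_closed)
  show ?thesis
  proof (rule that[of "(\<lambda>(r, y). z [^]\<^bsub>K\<^esub> (r :: int) \<otimes>\<^bsub>K\<^esub> y) ` ({- \<bar>m\<bar>..\<bar>m\<bar>} \<times> F)"])
    fix c assume "c \<in> carrier K"
    then obtain k :: int and y where k: "y \<in> F" "c = z [^]\<^bsub>K\<^esub> k \<otimes>\<^bsub>K\<^esub> y" using zF by blast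
    have y: "y \<in> carrier K" using k F by blast
    have "z [^]\<^bsub>K\<^esub> k = z [^]\<^bsub>K\<^esub> (m * (k div m)) \<otimes>\<^bsub>K\<^esub> z [^]\<^bsub>K\<^esub> (k mod m)"
      using z by (simp flip: int_pow_mult)
    also have "z [^]\<^bsub>K\<^esub> (m * (k div m)) = (z [^]\<^bsub>K\<^esub> m) [^]\<^bsub>K\<^esub> (k div m)"
      using z by (simp add: int_pow_pow)
    finally have "c = (z [^]\<^bsub>K\<^esub> m) [^]\<^bsub>K\<^esub> (k div m) \<otimes>\<^bsub>K\<^esub> (z [^]\<^bsub>K\<^esub> (k mod m) \<otimes>\<^bsub>K\<^esub> y)"
      using k y z by (simp add: m_assoc)
    moreover have "(z [^]\<^bsub>K\<^esub> m) [^]\<^bsub>K\<^esub> (k div m) \<in> D"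
      by (rule subgroup_int_pow_closed[OF D(1) zm])
    moreover have "k mod m \<in> {- \<bar>m\<bar>..\<bar>m\<bar>}" using abs_mod_less[OF m0, of k] by auto
    ultimately show "\<exists>d\<in>D. \<exists>x\<in>(\<lambda>(r, y). z [^]\<^bsub>K\<^esub> r \<otimes>\<^bsub>K\<^esub> y) ` ({- \<bar>m\<bar>..\<bar>m\<bar>} \<times> F). c = d \<otimes>\<^bsub>K\<^esub> x"
      using k(1) by (intro bexI) auto
  qed (use F z in auto)
qed


section \<open>The axis of a two ended subgroup\<close>

context G_tree
begin

text \<open>
  If \<open>C\<close> is two ended and fixes no vertex, these are the edges of the line on which \<open>C\<close> acts with
  finitely many orbits. The description by infinite parts of the orbit makes \<open>C\<close>-invariance and
  convexity evident, and it depends on the points \<open>c v\<close> only, so that it is the same for the two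
  copies of an amalgamated subgroup.
\<close>

definition axis :: "'a set \<Rightarrow> 'v \<Rightarrow> 'v set set" where
  "axis C v = {e \<in> E. \<forall>x\<in>e. infinite {c \<in> C. sep E e x (\<phi> c v)}}"

lemma axis_invariant:
  assumes C: "subgroup C G" and v: "v \<in> V" and c: "c \<in> C" and e: "e \<in> axis C v"
  shows "\<phi> c ` e \<in> axis C v"
proof -
  interpret C: subgroup C G by fact
  have eE: "e \<in> E" using e by (simp add: axis_def)
  have cG: "c \<in> carrier G" using c by simp
  have "infinite {b \<in> C. sep E (\<phi> c ` e) (\<phi> c x) (\<phi> b v)}" if x: "x \<in> e" for x
  proof -
    have "(\<lambda>b. c \<otimes> b) ` {b \<in> C. sep E e x (\<phi> b v)} \<subseteq> {b \<in> C. sep E (\<phi> c ` e) (\<phi> c x) (\<phi> b v)}"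
    proof clarify
      fix b assume b: "b \<in> C" "sep E e x (\<phi> b v)"
      have "sep E (\<phi> c ` e) (\<phi> c x) (\<phi> c (\<phi> b v))"
        using sep_act[OF cG eE _ act_in[OF _ v]] b edge_subset[OF eE] x by auto
      then show "c \<otimes> b \<in> C \<and> sep E (\<phi> c ` e) (\<phi> c x) (\<phi> (c \<otimes> b) v)"
        using b c cG v by (simp add: act_comp)
    qed
    moreover have "inj_on (\<lambda>b. c \<otimes> b) {b \<in> C. sep E e x (\<phi> b v)}"
      using cG by (auto simp: inj_on_def)
    moreover have "infinite {b \<in> C. sep E e x (\<phi> b v)}" using e x by (auto simp: axis_def)
    ultimately show ?thesis by (meson inj_on_finite)
  qed
  then show ?thesis using simplicial[OF cG eE] by (auto simp: axis_def)
qed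

text \<open>
  An edge \<open>d\<close> between two edges of the axis has, beyond each of them, infinitely many points of the
  orbit; these lie on different sides of \<open>d\<close>.
\<close>

lemma axis_convex:
  assumes C: "C \<subseteq> carrier G" and v: "v \<in> V" and l: "l1 \<in> axis C v" "l2 \<in> axis C v"
    and u: "u \<in> l1" and w: "w \<in> l2" and d: "sep E d u w"
  shows "d \<in> axis C v"
proof (cases "d = l1 \<or> d = l2")
  case True
  then show ?thesis using l by auto
next
  case False
  have lE: "l1 \<in> E" "l2 \<in> E" using l by (auto simp: axis_def)
  have uw: "u \<in> V" "w \<in> V" using lE edge_subset u w by auto
  have dE: "d \<in> E" using sep_is_edge[OF d uw] .
  have key: "infinite {c \<in> C. sep E d x (\<phi> c v)}"
    if l: "l \<in> axis C v" "l \<noteq> d" and w: "w \<in> l" and x: "x \<in> d" "sep E d x w" for l w x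
  proof -
    have lE: "l \<in> E" using l by (simp add: axis_def)
    have xV: "x \<in> V" using x edge_subset dE by blast
    obtain w' where w': "l = {w, w'}" "w \<noteq> w'" "w \<in> V" "w' \<in> V" using lE w by (rule other_end)
    obtain y where y: "y \<in> l" "\<not> sep E l y x"
      using sep_ends[of w w' x] lE w'(1) xV by auto
    obtain y2 where y2: "l = {y, y2}" "y \<noteq> y2" "y \<in> V" "y2 \<in> V" using lE y(1) by (rule other_end)
    have "\<not> sep E d y w" if "y \<noteq> w"
    proof -
      have "l = {y, w}" using that w y(1) w'(1) by auto
      then show ?thesis using sep_edge[of y w d] lE l(2) by blast
    qed
    moreover have "\<not> sep E d y y2" using sep_edge[of y y2 d] y2(1) lE l(2) by blast
    ultimately have same: "\<not> sep E d y w" "\<not> sep E d y2 y" using sep_sym[of d y2 y] by (cases "y = w", auto)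
    have "{c \<in> C. sep E l y (\<phi> c v)} \<subseteq> {c \<in> C. sep E d x (\<phi> c v)}"
    proof clarify
      fix c assume c: "c \<in> C" "sep E l y (\<phi> c v)"
      have cv: "\<phi> c v \<in> V" using act_in c C v by blast
      show "sep E d x (\<phi> c v)"
      proof (rule ccontr)
        assume "\<not> sep E d x (\<phi> c v)"
        then have "sep E d (\<phi> c v) w" using x(2) sep_iff_same by blast
        then have 1: "sep E d y2 (\<phi> c v)"
          using same sep_iff_same sep_sym by metis
        have "\<not> sep E l y2 (\<phi> c v)" using sep_ends[of y y2 "\<phi> c v"] c(2) y2 lE cv by auto
        then have "\<not> sep E l y2 x" using nested[of l y2 "\<phi> c v" d x] 1 dE l(2) x(1) by blast
        then show False using y(2) sep_ends[of y y2 x] y2 lE xV by auto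
      qed
    qed
    moreover have "infinite {c \<in> C. sep E l y (\<phi> c v)}" using l y by (auto simp: axis_def)
    ultimately show ?thesis using finite_subset by blast
  qed
  have "infinite {c \<in> C. sep E d x (\<phi> c v)}" if x: "x \<in> d" for x
  proof (cases "sep E d x w")
    case True
    then show ?thesis using key[OF l(2) _ w x] False by auto
  next
    case f: False
    then have "sep E d x u" using d sep_iff_same sep_sym by metis
    then show ?thesis using key[OF l(1) _ u x] False by auto
  qed
  then show ?thesis using dE by (simp add: axis_def)
qed

text \<open>
  The reason is that \<open>C\<close> is finitely generated: if \<open>P\<close> contains the edges between \<open>v\<close> and its images
  under a finite generating set, then any two points of the orbit are joined through translates of
  edges in \<open>P\<close>. The elements \<open>c\<close> for which this holds for \<open>v\<close> and \<open>c v\<close> form a subgroup.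
\<close>

lemma two_ended_orbit_edges:
  assumes C: "subgroup C G" "two_ended (G\<lparr>carrier := C\<rparr>)" and v: "v \<in> V"
  obtains P where "finite P" "P \<subseteq> E"
    "\<And>e b c. b \<in> C \<Longrightarrow> c \<in> C \<Longrightarrow> sep E e (\<phi> b v) (\<phi> c v) \<Longrightarrow> \<exists>a\<in>C. \<exists>p\<in>P. e = \<phi> a ` p"
proof -
  interpret C: subgroup C G by fact
  obtain z F where z: "z \<in> C" and F: "finite F" "F \<subseteq> C"
    and zF: "\<And>c. c \<in> C \<Longrightarrow> \<exists>k::int. \<exists>x\<in>F. c = z [^] k \<otimes> x"
  proof (rule two_ended_powers[OF C(2)])
    fix z F assume z: "z \<in> carrier (G\<lparr>carrier := C\<rparr>)"
      and F: "finite F" "F \<subseteq> carrier (G\<lparr>carrier := C\<rparr>)"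
      and zF: "\<And>c. c \<in> carrier (G\<lparr>carrier := C\<rparr>) \<Longrightarrow>
        \<exists>k::int. \<exists>x\<in>F. c = z [^]\<^bsub>G\<lparr>carrier := C\<rparr>\<^esub> k \<otimes>\<^bsub>G\<lparr>carrier := C\<rparr>\<^esub> x"
    have pow: "z [^]\<^bsub>G\<lparr>carrier := C\<rparr>\<^esub> (k::int) = z [^] k" for k
      using int_pow_consistent[OF C(1), of z k] z by simp
    show ?thesis using that[of z F] z F zF by (simp add: pow)
  qed
  define P where "P = (\<Union>s\<in>insert z F. {e. sep E e v (\<phi> s v)})"
  have CV: "\<phi> c v \<in> V" if "c \<in> C" for c using act_in v that by auto
  have P: "finite P" "P \<subseteq> E"
    unfolding P_def using F z CV v finite_sep sep_is_edge by (auto dest!: subsetD[OF F(2)])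
  define CP where "CP e \<longleftrightarrow> (\<exists>a\<in>C. \<exists>p\<in>P. e = \<phi> a ` p)" for e
  have CP_act: "CP e" if c: "c \<in> C" and e: "e \<subseteq> V" and CP: "CP (\<phi> (inv c) ` e)" for c e
  proof -
    obtain a p where a: "a \<in> C" "p \<in> P" "\<phi> (inv c) ` e = \<phi> a ` p"
      using CP unfolding CP_def by blast
    have "e = \<phi> c ` \<phi> a ` p" using a(3) act_img_inv(2)[of c e] c e by simp
    moreover have "p \<subseteq> V" using a P edge_subset by blast
    ultimately have "e = \<phi> (c \<otimes> a) ` p" using act_img_comp[of c a p] c a by simp
    then show ?thesis unfolding CP_def using c a by blast
  qed
  have shift: "sep E (\<phi> (inv c) ` e) x y" if "c \<in> C" "e \<in> E" "x \<in> V" "y \<in> V" "sep E e (\<phi> c x) (\<phi> c y)" for c e x y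
    using sep_act[of "inv c" e "\<phi> c x" "\<phi> c y"] that by (simp add: act_in act_inv)
  have rel: "CP e" if "b \<in> C" "c \<in> C" "\<And>e. sep E e v (\<phi> c v) \<Longrightarrow> CP e" "sep E e (\<phi> b v) (\<phi> b (\<phi> c v))" for b c e
  proof -
    have "e \<in> E" using sep_is_edge that CV act_in by (meson C.mem_carrier)
    then have "sep E (\<phi> (inv b) ` e) v (\<phi> c v)" using shift that CV v by blast
    then show ?thesis using CP_act[OF that(1)] that(3) edge_subset[OF \<open>e \<in> E\<close>] by blast
  qed
  define Q where "Q = {c \<in> C. \<forall>e. sep E e v (\<phi> c v) \<longrightarrow> CP e}"
  have mult: "b \<otimes> c \<in> Q" if "b \<in> Q" "c \<in> Q" for b c
  proof -
    have bc: "b \<in> C" "c \<in> C" using that by (auto simp: Q_def)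
    have "CP e" if "sep E e v (\<phi> (b \<otimes> c) v)" for e
    proof -
      have "sep E e v (\<phi> b (\<phi> c v))" using that bc v act_comp by simp
      then have "sep E e v (\<phi> b v) \<or> sep E e (\<phi> b v) (\<phi> b (\<phi> c v))" by (rule sep_triangle)
      then show ?thesis using rel[OF bc] \<open>b \<in> Q\<close> \<open>c \<in> Q\<close> unfolding Q_def by blast
    qed
    then show ?thesis using bc by (simp add: Q_def)
  qed
  have "subgroup Q G"
  proof (rule subgroupI)
    show "Q \<subseteq> carrier G" by (auto simp: Q_def)
    show "Q \<noteq> {}" using act_one[OF v] by (auto simp: Q_def intro!: exI[of _ \<one>])
    show "b \<otimes> c \<in> Q" if "b \<in> Q" "c \<in> Q" for b c by (rule mult[OF that])
    show "inv c \<in> Q" if "c \<in> Q" for c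
    proof -
      have c: "c \<in> C" using that by (simp add: Q_def)
      have "CP e" if "sep E e v (\<phi> (inv c) v)" for e
      proof -
        have e: "e \<in> E" using sep_is_edge that v CV c by blast
        have "sep E (\<phi> c ` e) (\<phi> c v) v"
          using sep_act[of c e v "\<phi> (inv c) v"] that c e v CV by (simp add: act_inv)
        then have "CP (\<phi> c ` e)" using \<open>c \<in> Q\<close> sep_sym unfolding Q_def by blast
        then show ?thesis using CP_act[of "inv c" e] c edge_subset[OF e] by simp
      qed
      then show ?thesis using c by (simp add: Q_def)
    qed
  qed
  moreover have gens: "insert z F \<subseteq> Q"
  proof
    fix s assume s: "s \<in> insert z F"
    then have sC: "s \<in> C" using z F by auto
    have "CP e" if "sep E e v (\<phi> s v)" for e
    proof -
      have "e \<in> P" using that s by (auto simp: P_def)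
      moreover have "e = \<phi> \<one> ` e" using act_img_one edge_subset P \<open>e \<in> P\<close> by blast
      ultimately show ?thesis unfolding CP_def using C.one_closed by blast
    qed
    then show "s \<in> Q" using sC by (simp add: Q_def)
  qed
  ultimately have zk: "z [^] (k::int) \<in> Q" for k using subgroup_int_pow_closed by blast
  have CQ: "c \<in> Q" if "c \<in> C" for c
    using zF[OF that] mult[OF zk] gens by blast
  show ?thesis
  proof (rule that[OF P])
    fix e b c assume bc: "b \<in> C" "c \<in> C" "sep E e (\<phi> b v) (\<phi> c v)"
    have "\<phi> c v = \<phi> b (\<phi> (inv b \<otimes> c) v)"
      using bc v act_in by (simp add: act_comp act_inv)
    then have "CP e" using rel[of b "inv b \<otimes> c" e] CQ[of "inv b \<otimes> c"] bc unfolding Q_def by auto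
    then show "\<exists>a\<in>C. \<exists>p\<in>P. e = \<phi> a ` p" by (simp add: CP_def)
  qed
qed

lemma axis_cofinite:
  assumes C: "subgroup C G" "two_ended (G\<lparr>carrier := C\<rparr>)" and v: "v \<in> V"
  obtains P where "finite P" "P \<subseteq> E" "\<And>e. e \<in> axis C v \<Longrightarrow> \<exists>c\<in>C. \<exists>p\<in>P. e = \<phi> c ` p"
proof -
  interpret C: subgroup C G by fact
  obtain P where P: "finite P" "P \<subseteq> E"
    "\<And>e b c. b \<in> C \<Longrightarrow> c \<in> C \<Longrightarrow> sep E e (\<phi> b v) (\<phi> c v) \<Longrightarrow> \<exists>a\<in>C. \<exists>p\<in>P. e = \<phi> a ` p"
    by (rule two_ended_orbit_edges[OF assms]) blast
  have "\<exists>c\<in>C. \<exists>p\<in>P. e = \<phi> c ` p" if e: "e \<in> axis C v" for e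
  proof -
    have eE: "e \<in> E" using e by (simp add: axis_def)
    then obtain x y where xy: "e = {x, y}" "x \<in> V" "y \<in> V" by (rule edgeE)
    have "infinite {c \<in> C. sep E e x (\<phi> c v)}" "infinite {c \<in> C. sep E e y (\<phi> c v)}"
      using e xy by (auto simp: axis_def)
    then have "{c \<in> C. sep E e x (\<phi> c v)} \<noteq> {}" "{c \<in> C. sep E e y (\<phi> c v)} \<noteq> {}"
      by (metis finite.emptyI)+
    then obtain b c where bc: "b \<in> C" "sep E e x (\<phi> b v)" "c \<in> C" "sep E e y (\<phi> c v)" by blast
    have "\<phi> c v \<in> V" using bc v act_in by auto
    then have "\<not> sep E e x (\<phi> c v)" using sep_ends[of x y "\<phi> c v"] bc(4) xy eE by auto
    then have "sep E e (\<phi> c v) (\<phi> b v)" using bc(2) sep_iff_same by blast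
    then show ?thesis using P(3) bc by blast
  qed
  then show ?thesis using that P by blast
qed

text \<open>
  If the axis is empty, then each edge has almost all of the orbit of \<open>v\<close> on one of its sides. Only
  finitely many edges have \<open>v\<close> on the other, meagre side; their number decreases when \<open>v\<close> is moved
  across the first of them. A vertex on the massive side of every edge is unique, hence fixed by \<open>C\<close>.
\<close>

lemma axis_nonempty:
  assumes C: "subgroup C G" "two_ended (G\<lparr>carrier := C\<rparr>)" and v: "v \<in> V"
    and no_fix: "\<not> has_global_fixed_point V \<phi> C"
  shows "axis C v \<noteq> {}"
proof
  assume empty: "axis C v = {}"
  interpret C: subgroup C G by fact
  have infC: "infinite C" using C(2) by (simp add: two_ended_def)
  have CV: "\<phi> c x \<in> V" if "c \<in> C" "x \<in> V" for c x using act_in that by auto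
  \<comment> \<open>The edges that have \<open>x\<close> on their meagre side, and an endpoint \<open>l e\<close> of \<open>e\<close> on its massive side.\<close>
  define B where "B x = {e \<in> E. infinite {c \<in> C. sep E e x (\<phi> c v)}}" for x
  obtain P where P: "finite P" "P \<subseteq> E"
    "\<And>e b c. b \<in> C \<Longrightarrow> c \<in> C \<Longrightarrow> sep E e (\<phi> b v) (\<phi> c v) \<Longrightarrow> \<exists>a\<in>C. \<exists>p\<in>P. e = \<phi> a ` p"
    by (rule two_ended_orbit_edges[OF C v]) blast
  have light: "\<exists>x\<in>e. finite {c \<in> C. sep E e x (\<phi> c v)}" if "e \<in> E" for e
    using empty that by (auto simp: axis_def)
  then obtain l where l: "\<And>e. e \<in> E \<Longrightarrow> l e \<in> e \<and> finite {c \<in> C. sep E e (l e) (\<phi> c v)}" by metis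
  have B_act: "\<phi> c ` e \<in> B (\<phi> c x) \<Longrightarrow> e \<in> B x" if c: "c \<in> C" and e: "e \<in> E" and x: "x \<in> V" for c e x
  proof -
    assume "\<phi> c ` e \<in> B (\<phi> c x)"
    then have inf: "infinite {b \<in> C. sep E (\<phi> c ` e) (\<phi> c x) (\<phi> b v)}" by (simp add: B_def)
    have "(\<lambda>b. inv c \<otimes> b) ` {b \<in> C. sep E (\<phi> c ` e) (\<phi> c x) (\<phi> b v)} \<subseteq> {b \<in> C. sep E e x (\<phi> b v)}"
    proof clarify
      fix b assume b: "b \<in> C" "sep E (\<phi> c ` e) (\<phi> c x) (\<phi> b v)"
      have "\<phi> b v = \<phi> c (\<phi> (inv c \<otimes> b) v)" using b c v CV by (simp add: act_comp act_inv)
      then have "sep E e x (\<phi> (inv c \<otimes> b) v)"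
        using b sep_act[of c e x "\<phi> (inv c \<otimes> b) v"] c e x CV[of "inv c \<otimes> b" v] v by auto
      then show "inv c \<otimes> b \<in> C \<and> sep E e x (\<phi> (inv c \<otimes> b) v)" using b c by simp
    qed
    moreover have "inj_on (\<lambda>b. inv c \<otimes> b) {b \<in> C. sep E (\<phi> c ` e) (\<phi> c x) (\<phi> b v)}"
      using c by (auto simp: inj_on_def)
    ultimately have "infinite {b \<in> C. sep E e x (\<phi> b v)}" using inf by (meson inj_on_finite)
    then show "e \<in> B x" using e by (simp add: B_def)
  qed
  have "finite (B v)"
  proof (rule finite_subset)
    show "B v \<subseteq> (\<Union>p\<in>P. (\<lambda>c. \<phi> (inv c) ` p) ` {c \<in> C. sep E p (l p) (\<phi> c v)})"
    proof
      fix e assume e: "e \<in> B v"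
      then have "infinite {c \<in> C. sep E e v (\<phi> c v)}" by (simp add: B_def)
      then have "{c \<in> C. sep E e v (\<phi> c v)} \<noteq> {}" by (metis finite.emptyI)
      then obtain c where c: "c \<in> C" "sep E e (\<phi> \<one> v) (\<phi> c v)" using act_one[OF v] by auto
      obtain a p where a: "a \<in> C" "p \<in> P" "e = \<phi> a ` p" using P(3)[OF C.one_closed c] by blast
      have pE: "p \<in> E" using a P by blast
      have "v = \<phi> a (\<phi> (inv a) v)" using a v by (simp add: act_inv)
      then have "p \<in> B (\<phi> (inv a) v)" using B_act[of a p "\<phi> (inv a) v"] e a pE v CV by auto
      then have inf: "infinite {c \<in> C. sep E p (\<phi> (inv a) v) (\<phi> c v)}" by (simp add: B_def)
      have "sep E p (l p) (\<phi> (inv a) v)"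
      proof (rule ccontr)
        assume "\<not> sep E p (l p) (\<phi> (inv a) v)"
        then have "{c \<in> C. sep E p (\<phi> (inv a) v) (\<phi> c v)} = {c \<in> C. sep E p (l p) (\<phi> c v)}"
          using sep_iff_same by blast
        then show False using inf l[OF pE] by simp
      qed
      then have "inv a \<in> {c \<in> C. sep E p (l p) (\<phi> c v)}" using a by simp
      moreover have "e = \<phi> (inv (inv a)) ` p" using a by simp
      ultimately show "e \<in> (\<Union>p\<in>P. (\<lambda>c. \<phi> (inv c) ` p) ` {c \<in> C. sep E p (l p) (\<phi> c v)})"
        using a(2) by blast
    qed
    show "finite (\<Union>p\<in>P. (\<lambda>c. \<phi> (inv c) ` p) ` {c \<in> C. sep E p (l p) (\<phi> c v)})"
      using P(1,2) l by auto
  qed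
  then have "\<exists>y\<in>V. B y = {}" using v
  proof (induction "card (B v)" arbitrary: v rule: less_induct)
    case (less x)
    show ?case
    proof (cases "B x = {}")
      case False
      then obtain e where e: "e \<in> B x" by blast
      then have eE: "e \<in> E" by (simp add: B_def)
      have xV: "x \<in> V" by fact
      obtain a b where ab: "e = {a, b}" "a \<in> V" "b \<in> V" using eE by (rule edgeE)
      obtain t where t: "t \<in> e" "sep E e x t" "t \<in> V"
        using sep_ends[of a b x] ab eE xV sep_sym[of e x] by blast
      have "x \<noteq> t" using t(2) by auto
      then obtain x1 where x1: "{x, x1} \<in> E" "sep E {x, x1} x t" "\<not> sep E {x, x1} x1 t"
        using gate_vertex xV t(3) by blast
      \<comment> \<open>The first edge from \<open>x\<close> towards \<open>e\<close> separates \<open>x\<close> from everything beyond \<open>e\<close>.\<close>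
      let ?f = "{x, x1}"
      have sub: "sep E ?f x (\<phi> c v)" if "c \<in> C" "sep E e x (\<phi> c v)" for c
      proof (cases "?f = e")
        case True
        then show ?thesis using that by simp
      next
        case False
        have cv: "\<phi> c v \<in> V" using CV that v by blast
        have 1: "\<not> sep E e t (\<phi> c v)"
          using sep_two_sides[of t x "\<phi> c v" e] t that xV cv sep_sym by blast
        show ?thesis
        proof (rule ccontr)
          assume "\<not> sep E ?f x (\<phi> c v)"
          then have "sep E ?f t (\<phi> c v)" using x1(2) sep_iff_same sep_sym by metis
          then have "\<not> sep E e t x" using nested[OF 1 _ x1(1)] False by auto
          then show False using t(2) sep_sym by blast
        qed
      qed
      have "{c \<in> C. sep E e x (\<phi> c v)} \<subseteq> {c \<in> C. sep E ?f x (\<phi> c v)}" using sub by blast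
      then have f: "?f \<in> B x" using e x1(1) finite_subset unfolding B_def by blast
      have x1V: "x1 \<in> V" using edge_in_V[OF x1(1)] by simp
      have "?f \<notin> B x1" using f light[OF x1(1)] unfolding B_def by auto
      moreover have "B x1 \<subseteq> B x"
      proof
        fix d assume d: "d \<in> B x1"
        then have "d \<noteq> ?f" using calculation by blast
        then have "\<not> sep E d x1 x" using sep_edge[OF x1(1), of d] sep_sym[of d x] by blast
        then show "d \<in> B x" using d sep_iff_same[of d x1 x] unfolding B_def by simp
      qed
      ultimately have lt: "B x1 \<subset> B x" using f by blast
      then have "card (B x1) < card (B x)" using less.prems(1) psubset_card_mono by blast
      then show ?thesis using less.hyps[of x1] x1V lt less.prems(1) finite_subset by blast
    qed (use less.prems in blast)
  qed
  then obtain y where y: "y \<in> V" "B y = {}" by blast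
  have "\<phi> c y = y" if c: "c \<in> C" for c
  proof (rule ccontr)
    assume ne: "\<phi> c y \<noteq> y"
    have cy: "\<phi> c y \<in> V" using CV c y by blast
    obtain z where z: "{y, z} \<in> E" "sep E {y, z} y (\<phi> c y)"
      using gate_vertex[OF y(1) cy] ne by auto
    let ?e = "{y, z}"
    have "?e \<notin> B (\<phi> c y)"
    proof
      assume "?e \<in> B (\<phi> c y)"
      then have "\<phi> (inv c) ` ?e \<in> B y"
        using B_act[OF c _ y(1), of "\<phi> (inv c) ` ?e"] act_img_inv(2)[OF _ edge_subset[OF z(1)]]
          simplicial[OF _ z(1)] c by (metis C.m_inv_closed C.mem_carrier)
      then show False using y by simp
    qed
    then have "finite {b \<in> C. sep E ?e (\<phi> c y) (\<phi> b v)}" "finite {b \<in> C. sep E ?e y (\<phi> b v)}"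
      using z(1) y(2) unfolding B_def by auto
    moreover have "C \<subseteq> {b \<in> C. sep E ?e (\<phi> c y) (\<phi> b v)} \<union> {b \<in> C. sep E ?e y (\<phi> b v)}"
    proof
      fix b assume "b \<in> C"
      moreover have "sep E ?e y (\<phi> b v) \<or> sep E ?e (\<phi> c y) (\<phi> b v)"
        using sep_triangle[OF z(2), of "\<phi> b v"] sep_sym[of ?e "\<phi> b v"] by blast
      ultimately show "b \<in> {b \<in> C. sep E ?e (\<phi> c y) (\<phi> b v)} \<union> {b \<in> C. sep E ?e y (\<phi> b v)}" by blast
    qed
    ultimately show False using infC finite_subset by blast
  qed
  then show False using no_fix y by (auto simp: has_global_fixed_point_def)
qed

end


section \<open>Cleaving a tree along lines\<close>

context tree_graph
begin

text \<open>
  Let \<open>\<L>\<close> be a set of sets of edges, such as the axes of the conjugates of a subgroup, each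
  restricted to one orbit of edges. Cutting the tree open along \<open>\<Union>\<L>\<close> leaves pieces. The cleaved tree
  has the pieces and the members of \<open>\<L>\<close> as vertices, and an edge whenever a piece contains an endpoint
  of an edge in the member. In other words, after the pieces are collapsed to points, each line is
  replaced by the cone over its vertices.
\<close>

definition piece :: "'v set set set \<Rightarrow> 'v \<Rightarrow> 'v set" where
  "piece \<L> u = {w \<in> V. \<forall>d\<in>\<Union>\<L>. \<not> sep E d u w}"

definition cleaved_V :: "'v set set set \<Rightarrow> ('v set + 'v set set) set" where
  "cleaved_V \<L> = Inl ` piece \<L> ` V \<union> Inr ` \<L>"

definition cleaved_E :: "'v set set set \<Rightarrow> ('v set + 'v set set) set set" where
  "cleaved_E \<L> = {{Inl (piece \<L> u), Inr \<Lambda>} |u \<Lambda>. \<Lambda> \<in> \<L> \<and> u \<in> \<Union>\<Lambda>}"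

text \<open>
  The second condition is convexity within \<open>\<Union>\<L>\<close>. It makes the members of \<open>\<L>\<close> disjoint, because an edge
  separates its own endpoints.
\<close>

definition lines :: "'v set set set \<Rightarrow> bool" where
  "lines \<L> \<longleftrightarrow> (\<forall>\<Lambda>\<in>\<L>. \<Lambda> \<subseteq> E \<and> \<Lambda> \<noteq> {}) \<and>
     (\<forall>\<Lambda>\<in>\<L>. \<forall>M\<in>\<L>. \<forall>u\<in>\<Union>\<Lambda>. \<forall>w\<in>\<Union>\<Lambda>. \<forall>d\<in>M. sep E d u w \<longrightarrow> M = \<Lambda>)"

lemma piece_eq_iff:
  assumes "u \<in> V" "w \<in> V"
  shows "piece \<L> u = piece \<L> w \<longleftrightarrow> (\<forall>d\<in>\<Union>\<L>. \<not> sep E d u w)"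
proof
  assume "piece \<L> u = piece \<L> w"
  moreover have "w \<in> piece \<L> w" using assms by (simp add: piece_def)
  ultimately have "w \<in> piece \<L> u" by simp
  then show "\<forall>d\<in>\<Union>\<L>. \<not> sep E d u w" by (simp add: piece_def)
next
  assume same: "\<forall>d\<in>\<Union>\<L>. \<not> sep E d u w"
  have "sep E d u x \<longleftrightarrow> sep E d w x" if "d \<in> \<Union>\<L>" for d x
    by (rule sep_iff_same) (use same that in blast)
  then show "piece \<L> u = piece \<L> w" unfolding piece_def by simp
qed

lemma cleaved_E_cases:
  assumes "{a, b} \<in> cleaved_E \<L>"
  obtains u \<Lambda> where "\<Lambda> \<in> \<L>" "u \<in> \<Union>\<Lambda>" "{a, b} = {Inl (piece \<L> u), Inr \<Lambda>}"
  using assms unfolding cleaved_E_def by blast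

text \<open>
  To see that the edge between the piece of \<open>k0\<close> and the line \<open>\<Lambda>0\<close> is a bridge, put on its one side
  everything that no edge of \<open>\<Lambda>0\<close> separates from \<open>k0\<close>. By convexity no edge of \<open>\<Lambda>0\<close> separates the
  pieces along another line, and different pieces along \<open>\<Lambda>0\<close> are separated by an edge of \<open>\<Lambda>0\<close>.
\<close>

lemma cleaved_tree:
  assumes lines: "lines \<L>"
  shows "simplicial_tree (cleaved_V \<L>) (cleaved_E \<L>)"
proof -
  have \<L>: "\<Lambda> \<subseteq> E \<and> \<Lambda> \<noteq> {}" if "\<Lambda> \<in> \<L>" for \<Lambda> using lines that by (simp add: lines_def)
  have convex: "M = \<Lambda>" if "\<Lambda> \<in> \<L>" "M \<in> \<L>" "u \<in> \<Union>\<Lambda>" "w \<in> \<Union>\<Lambda>" "d \<in> M" "sep E d u w" for \<Lambda> M u w d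
    by (rule lines[unfolded lines_def, THEN conjunct2, rule_format, OF that])
  have UV: "u \<in> V" if \<Lambda>: "\<Lambda> \<in> \<L>" and u: "u \<in> \<Union>\<Lambda>" for u \<Lambda>
  proof -
    obtain d where "d \<in> E" "u \<in> d" using \<L>[OF \<Lambda>] u by blast
    then show ?thesis by (elim edgeE) auto
  qed
  have edge: "(Inl (piece \<L> u), Inr \<Lambda>) \<in> adj (cleaved_E \<L>)" if "\<Lambda> \<in> \<L>" "u \<in> \<Union>\<Lambda>" for u \<Lambda>
    using that unfolding cleaved_E_def adj_iff by blast
  have edge': "(Inr \<Lambda>, Inl (piece \<L> u)) \<in> adj (cleaved_E \<L>)" if "\<Lambda> \<in> \<L>" "u \<in> \<Union>\<Lambda>" for u \<Lambda>
    using edge[OF that] by (simp add: adj_iff insert_commute)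
  have pieces: "(Inl (piece \<L> u), Inl (piece \<L> w)) \<in> (adj (cleaved_E \<L>))\<^sup>*" if uw: "u \<in> V" "w \<in> V" for u w
    using connected[OF uw]
  proof (induction rule: rtrancl_induct)
    case (step x y)
    have xy: "{x, y} \<in> E" using step(2) by (simp add: adj_iff)
    show ?case
    proof (cases "{x, y} \<in> \<Union>\<L>")
      case True
      then obtain \<Lambda> where \<Lambda>: "\<Lambda> \<in> \<L>" "{x, y} \<in> \<Lambda>" by blast
      then have "x \<in> \<Union>\<Lambda>" "y \<in> \<Union>\<Lambda>" by blast+
      then show ?thesis using edge[OF \<Lambda>(1)] edge'[OF \<Lambda>(1)] step.IH
        by (meson rtrancl_into_rtrancl)
    next
      case False
      then have "\<forall>d\<in>\<Union>\<L>. \<not> sep E d x y" using sep_edge[OF xy] by metis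
      then have "piece \<L> x = piece \<L> y" by (simp only: piece_eq_iff[OF edge_in_V[OF xy]])
      then show ?thesis using step.IH by simp
    qed
  qed simp
  have to_piece: "\<exists>u\<in>V. (a, Inl (piece \<L> u)) \<in> (adj (cleaved_E \<L>))\<^sup>*" if a: "a \<in> cleaved_V \<L>" for a
  proof -
    consider u where "u \<in> V" "a = Inl (piece \<L> u)" | \<Lambda> where "\<Lambda> \<in> \<L>" "a = Inr \<Lambda>"
      using a unfolding cleaved_V_def by blast
    then show ?thesis
    proof cases
      case 2
      then obtain d where d: "d \<in> \<Lambda>" "d \<in> E" using \<L> by blast
      obtain u where "u \<in> d" using d(2) by (rule edgeE) blast
      then have "u \<in> \<Union>\<Lambda>" using d by blast
      then show ?thesis using edge'[OF 2(1)] UV 2 by blast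
    qed blast
  qed
  show ?thesis
  proof (rule simplicial_treeI)
    show "cleaved_V \<L> \<noteq> {}" using is_tree by (auto simp: cleaved_V_def simplicial_tree_def)
    show "e \<subseteq> cleaved_V \<L> \<and> card e = 2" if e: "e \<in> cleaved_E \<L>" for e
    proof -
      obtain u \<Lambda> where "\<Lambda> \<in> \<L>" "u \<in> \<Union>\<Lambda>" "e = {Inl (piece \<L> u), Inr \<Lambda>}"
        using e unfolding cleaved_E_def by blast
      then show ?thesis using UV by (simp add: cleaved_V_def)
    qed
    fix a b assume ab: "a \<in> cleaved_V \<L>" "b \<in> cleaved_V \<L>"
    obtain u where u: "u \<in> V" "(a, Inl (piece \<L> u)) \<in> (adj (cleaved_E \<L>))\<^sup>*"
      using to_piece[OF ab(1)] by blast
    obtain w where w: "w \<in> V" "(b, Inl (piece \<L> w)) \<in> (adj (cleaved_E \<L>))\<^sup>*"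
      using to_piece[OF ab(2)] by blast
    have "(Inl (piece \<L> w), b) \<in> (adj (cleaved_E \<L>))\<^sup>*" using w(2) by (rule rtrancl_adj_sym[THEN iffD1])
    then show "(a, b) \<in> (adj (cleaved_E \<L>))\<^sup>*"
      using u(2) pieces[OF u(1) w(1)] by (meson rtrancl_trans)
  next
    fix e assume "e \<in> cleaved_E \<L>"
    then obtain k0 \<Lambda>0 where e: "\<Lambda>0 \<in> \<L>" "k0 \<in> \<Union>\<Lambda>0" "e = {Inl (piece \<L> k0), Inr \<Lambda>0}"
      unfolding cleaved_E_def by blast
    define near where "near u \<longleftrightarrow> (\<forall>d\<in>\<Lambda>0. \<not> sep E d k0 u)" for u
    define s :: "'v set + 'v set set \<Rightarrow> bool" where
      "s = case_sum (\<lambda>K. \<exists>k\<in>K. near k) (\<lambda>\<Lambda>. \<Lambda> \<noteq> \<Lambda>0 \<and> (\<exists>u\<in>\<Union>\<Lambda>. near u))"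
    have near_eq: "near u \<longleftrightarrow> near w" if "\<And>d. d \<in> \<Lambda>0 \<Longrightarrow> \<not> sep E d u w" for u w
      unfolding near_def using that sep_iff_same sep_sym by metis
    have s_piece: "s (Inl (piece \<L> u)) \<longleftrightarrow> near u" if u: "u \<in> V" for u
    proof -
      have "near k \<longleftrightarrow> near u" if k: "k \<in> piece \<L> u" for k
        by (rule near_eq) (use k e(1) sep_sym in \<open>auto simp: piece_def\<close>)
      moreover have "u \<in> piece \<L> u" using u by (simp add: piece_def)
      ultimately have "(\<exists>k\<in>piece \<L> u. near k) \<longleftrightarrow> near u" by blast
      then show ?thesis by (simp add: s_def)
    qed
    have s_edge: "s (Inl (piece \<L> u)) \<noteq> s (Inr \<Lambda>) \<longleftrightarrow> piece \<L> u = piece \<L> k0 \<and> \<Lambda> = \<Lambda>0"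
      if u: "\<Lambda> \<in> \<L>" "u \<in> \<Union>\<Lambda>" for u \<Lambda>
    proof (cases "\<Lambda> = \<Lambda>0")
      case True
      have "near u \<longleftrightarrow> (\<forall>d\<in>\<Union>\<L>. \<not> sep E d k0 u)"
        unfolding near_def using convex[OF e(1) _ e(2)] u True e(1) by blast
      then show ?thesis
        using True s_piece[OF UV[OF u]] piece_eq_iff[OF UV[OF e(1,2)] UV[OF u]] by (auto simp: s_def)
    next
      case False
      have "near w \<longleftrightarrow> near u" if w: "w \<in> \<Union>\<Lambda>" for w
        by (rule near_eq) (use convex[OF u(1) e(1) w u(2)] False in blast)
      then have "(\<exists>u\<in>\<Union>\<Lambda>. near u) \<longleftrightarrow> near u" using u(2) by blast
      then have "s (Inr \<Lambda>) \<longleftrightarrow> near u" using False by (simp add: s_def)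
      then show ?thesis using s_piece[OF UV[OF u]] False by simp
    qed
    have "(s a \<noteq> s b) = ({a, b} = e)" if ab: "{a, b} \<in> cleaved_E \<L>" for a b
    proof -
      obtain u \<Lambda> where u: "\<Lambda> \<in> \<L>" "u \<in> \<Union>\<Lambda>" "{a, b} = {Inl (piece \<L> u), Inr \<Lambda>}"
        using ab by (rule cleaved_E_cases)
      have "(s a \<noteq> s b) = (s (Inl (piece \<L> u)) \<noteq> s (Inr \<Lambda>))"
        using u(3) by (auto simp: doubleton_eq_iff)
      also have "\<dots> = ({a, b} = e)" using s_edge[OF u(1,2)] u(3) e(3) by (auto simp: doubleton_eq_iff)
      finally show ?thesis .
    qed
    then show "\<exists>s :: 'v set + 'v set set \<Rightarrow> bool. \<forall>a b. {a, b} \<in> cleaved_E \<L> \<longrightarrow> (s a \<noteq> s b) = ({a, b} = e)"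
      by blast
  qed
qed

end

context G_tree
begin

lemma piece_act:
  assumes g: "g \<in> carrier G" and u: "u \<in> V" and E: "\<Union>\<L> \<subseteq> E"
    and inv: "\<forall>h\<in>carrier G. \<forall>\<Lambda>\<in>\<L>. image (\<phi> h) ` \<Lambda> \<in> \<L>"
  shows "\<phi> g ` piece \<L> u = piece \<L> (\<phi> g u)"
proof -
  have sub: "\<phi> h ` piece \<L> x \<subseteq> piece \<L> (\<phi> h x)" if h: "h \<in> carrier G" and x: "x \<in> V" for h x
  proof
    fix y assume "y \<in> \<phi> h ` piece \<L> x"
    then obtain w where w: "w \<in> V" "y = \<phi> h w" "\<And>d. d \<in> \<Union>\<L> \<Longrightarrow> \<not> sep E d x w"
      by (auto simp: piece_def)
    have "\<not> sep E d (\<phi> h x) (\<phi> h w)" if d: "d \<in> \<Union>\<L>" for d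
    proof
      assume s: "sep E d (\<phi> h x) (\<phi> h w)"
      obtain \<Lambda> where \<Lambda>: "\<Lambda> \<in> \<L>" "d \<in> \<Lambda>" using d by blast
      have "\<phi> (inv h) ` d \<in> image (\<phi> (inv h)) ` \<Lambda>" using \<Lambda>(2) by blast
      then have "\<phi> (inv h) ` d \<in> \<Union>\<L>" using inv inv_closed[OF h] \<Lambda>(1) by blast
      moreover have "sep E (\<phi> (inv h) ` d) x w"
        using sep_act[of "inv h" d "\<phi> h x" "\<phi> h w"] s h x w(1) d E by (auto simp: act_in act_inv)
      ultimately show False using w(3) by blast
    qed
    then show "y \<in> piece \<L> (\<phi> h x)" using w(1,2) act_in[OF h] unfolding piece_def by blast
  qed
  have "piece \<L> (\<phi> g u) = \<phi> g ` \<phi> (inv g) ` piece \<L> (\<phi> g u)"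
    by (rule act_img_inv(2)[OF g, symmetric]) (auto simp: piece_def)
  also have "\<dots> \<subseteq> \<phi> g ` piece \<L> u"
    using sub[of "inv g" "\<phi> g u"] g u act_in[OF g u] by (intro image_mono) (simp add: act_inv)
  finally show ?thesis using sub[OF g u] by blast
qed

definition cleaved_act :: "'v set set set \<Rightarrow> 'a \<Rightarrow> 'v set + 'v set set \<Rightarrow> 'v set + 'v set set" where
  "cleaved_act \<L> g = restrict (map_sum (image (\<phi> g)) (image (image (\<phi> g)))) (cleaved_V \<L>)"

lemma cleaved_G_tree:
  assumes lines: "lines \<L>" and inv_lines: "\<forall>h\<in>carrier G. \<forall>\<Lambda>\<in>\<L>. image (\<phi> h) ` \<Lambda> \<in> \<L>"
  shows "G_tree G (cleaved_V \<L>) (cleaved_act \<L>) (cleaved_E \<L>)"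
    and "\<And>g u. g \<in> carrier G \<Longrightarrow> u \<in> V \<Longrightarrow> cleaved_act \<L> g (Inl (piece \<L> u)) = Inl (piece \<L> (\<phi> g u))"
    and "\<And>g \<Lambda>. \<Lambda> \<in> \<L> \<Longrightarrow> cleaved_act \<L> g (Inr \<Lambda>) = Inr (image (\<phi> g) ` \<Lambda>)"
proof -
  let ?\<psi> = "cleaved_act \<L>"
  have \<L>: "\<Lambda> \<subseteq> E \<and> \<Lambda> \<noteq> {}" if "\<Lambda> \<in> \<L>" for \<Lambda> using lines that by (simp add: lines_def)
  have inv: "image (\<phi> h) ` \<Lambda> \<in> \<L>" if "h \<in> carrier G" "\<Lambda> \<in> \<L>" for h \<Lambda> using inv_lines that by blast
  have LE: "\<Union>\<L> \<subseteq> E" using \<L> by blast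
  have Inl: "?\<psi> g (Inl (piece \<L> u)) = Inl (piece \<L> (\<phi> g u))" if "g \<in> carrier G" "u \<in> V" for g u
    using that piece_act[OF that LE inv_lines] by (simp add: cleaved_act_def cleaved_V_def)
  have Inr: "?\<psi> g (Inr \<Lambda>) = Inr (image (\<phi> g) ` \<Lambda>)" if "\<Lambda> \<in> \<L>" for g \<Lambda>
    using that by (simp add: cleaved_act_def cleaved_V_def)
  have UV: "u \<in> V" if "\<Lambda> \<in> \<L>" "u \<in> \<Union>\<Lambda>" for u \<Lambda>
    using that \<L> edge_subset by blast
  have cases: "(\<exists>u\<in>V. x = Inl (piece \<L> u)) \<or> (\<exists>\<Lambda>\<in>\<L>. x = Inr \<Lambda>)" if "x \<in> cleaved_V \<L>" for x
    using that unfolding cleaved_V_def by blast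
  have VI: "Inl (piece \<L> u) \<in> cleaved_V \<L>" if "u \<in> V" for u using that by (simp add: cleaved_V_def)
  have VR: "Inr \<Lambda> \<in> cleaved_V \<L>" if "\<Lambda> \<in> \<L>" for \<Lambda> using that by (simp add: cleaved_V_def)
  have line_comp: "image (\<phi> (g \<otimes> h)) ` \<Lambda> = image (\<phi> g) ` image (\<phi> h) ` \<Lambda>"
    if "g \<in> carrier G" "h \<in> carrier G" "\<Lambda> \<in> \<L>" for g h \<Lambda>
    unfolding image_image[of "image (\<phi> g)"]
  proof (rule image_cong)
    fix d assume "d \<in> \<Lambda>"
    then have "d \<subseteq> V" using \<L>[OF that(3)] edge_subset by blast
    then show "\<phi> (g \<otimes> h) ` d = \<phi> g ` \<phi> h ` d" by (rule act_img_comp[OF that(1,2)])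
  qed simp
  have line_one: "image (\<phi> \<one>) ` \<Lambda> = \<Lambda>" if "\<Lambda> \<in> \<L>" for \<Lambda>
  proof -
    have "image (\<phi> \<one>) ` \<Lambda> = id ` \<Lambda>"
    proof (rule image_cong)
      fix d assume "d \<in> \<Lambda>"
      then have "d \<subseteq> V" using that \<L> edge_subset by blast
      then show "\<phi> \<one> ` d = id d" using act_img_one by simp
    qed simp
    then show ?thesis by simp
  qed
  interpret new: group_action G "cleaved_V \<L>" ?\<psi>
  proof (rule group_actionI[OF is_group])
    show "?\<psi> g \<in> extensional (cleaved_V \<L>)" for g by (simp add: cleaved_act_def)
    show "?\<psi> g x \<in> cleaved_V \<L>" if "g \<in> carrier G" "x \<in> cleaved_V \<L>" for g x
      using cases[OF that(2)] Inl[OF that(1)] Inr VI VR act_in[OF that(1)] inv[OF that(1)] by auto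
    show "?\<psi> \<one> x = x" if "x \<in> cleaved_V \<L>" for x
      using cases[OF that] Inl[OF one_closed] Inr line_one act_one by auto
    show "?\<psi> (g \<otimes> h) x = ?\<psi> g (?\<psi> h x)"
      if gh: "g \<in> carrier G" "h \<in> carrier G" and x: "x \<in> cleaved_V \<L>" for g h x
      using cases[OF x] gh by (auto simp: Inl Inr line_comp act_comp act_in inv)
  qed
  show "G_tree G (cleaved_V \<L>) ?\<psi> (cleaved_E \<L>)"
  proof unfold_locales
    show "simplicial_tree (cleaved_V \<L>) (cleaved_E \<L>)" by (rule cleaved_tree[OF lines])
    fix g e assume g: "g \<in> carrier G" and "e \<in> cleaved_E \<L>"
    then obtain u \<Lambda> where e: "\<Lambda> \<in> \<L>" "u \<in> \<Union>\<Lambda>" "e = {Inl (piece \<L> u), Inr \<Lambda>}"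
      unfolding cleaved_E_def by blast
    have img: "?\<psi> g ` e = {Inl (piece \<L> (\<phi> g u)), Inr (image (\<phi> g) ` \<Lambda>)}"
      using e UV[OF e(1,2)] Inl[OF g] Inr by simp
    have "\<phi> g u \<in> \<Union>(image (\<phi> g) ` \<Lambda>)" using e(2) by blast
    then show "?\<psi> g ` e \<in> cleaved_E \<L>"
      unfolding img cleaved_E_def using inv[OF g e(1)] by blast
    \<comment> \<open>The action preserves the two sides of the bipartition.\<close>
    show "?\<psi> g x = x" if "?\<psi> g ` e = e" "x \<in> e" for x
      using that e UV[OF e(1,2)] Inl[OF g] Inr unfolding img by (auto simp: doubleton_eq_iff)
  qed
  show "?\<psi> g (Inl (piece \<L> u)) = Inl (piece \<L> (\<phi> g u))" if "g \<in> carrier G" "u \<in> V" for g u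
    by (rule Inl[OF that])
  show "?\<psi> g (Inr \<Lambda>) = Inr (image (\<phi> g) ` \<Lambda>)" if "\<Lambda> \<in> \<L>" for g \<Lambda>
    by (rule Inr[OF that])
qed

lemma finite_transporter:
  assumes fin: "finite_edge_stabilizers G \<phi> E" and e: "e \<in> E"
  shows "finite {g \<in> carrier G. \<phi> g ` e = d}"
proof (cases "\<exists>h\<in>carrier G. \<phi> h ` e = d")
  case True
  then obtain h where h: "h \<in> carrier G" "\<phi> h ` e = d" by blast
  have "(\<lambda>g. inv h \<otimes> g) ` {g \<in> carrier G. \<phi> g ` e = d} \<subseteq> stabilizer G (\<lambda>g. image (\<phi> g)) e"
  proof clarify
    fix g assume g: "g \<in> carrier G" "d = \<phi> g ` e"
    have "\<phi> (inv h \<otimes> g) ` e = \<phi> (inv h) ` \<phi> h ` e"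
      using act_img_comp[OF inv_closed[OF h(1)] g(1) edge_subset[OF e]] g(2) h(2) by simp
    then show "inv h \<otimes> g \<in> stabilizer G (\<lambda>g. image (\<phi> g)) e"
      using g(1) h(1) act_img_inv(1)[OF h(1) edge_subset[OF e]] by (simp add: stabilizer_def)
  qed
  moreover have "inj_on (\<lambda>g. inv h \<otimes> g) {g \<in> carrier G. \<phi> g ` e = d}"
    using h by (auto simp: inj_on_def)
  moreover have "finite (stabilizer G (\<lambda>g. image (\<phi> g)) e)"
    using fin e unfolding finite_edge_stabilizers_def by blast
  ultimately show ?thesis by (meson inj_on_finite)
next
  case False
  then have "{g \<in> carrier G. \<phi> g ` e = d} = {}" by blast
  then show ?thesis by (metis finite.emptyI)
qed

text \<open>
  An edge \<open>\<tau>\<close> of the axis of \<open>C\<close> that lies on no other translate of the axis leads to a splitting of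
  \<open>G\<close> in which \<open>C\<close> is elliptic: the tree is cut open along the orbit of \<open>\<tau>\<close>, and for each translate
  \<open>g \<cdot> axis\<close> the pieces along it are joined to a new vertex. The stabilizers of the new edges are
  finite, because the subgroup of \<open>C\<close> that preserves a piece is finite: otherwise it would have finite
  index in \<open>C\<close>, and almost all of the orbit would lie on one side of \<open>\<tau>\<close>. The new vertex for the axis
  is fixed by \<open>C\<close>, hence by \<open>G\<close>, and this forces \<open>G = C\<close>.
\<close>

lemma private_axis_edge_imp_eq:
  assumes oe: "one_ended_rel G (insert C \<H>)" and \<H>: "\<And>H. H \<in> \<H> \<Longrightarrow> H \<subseteq> carrier G"
    and fin: "finite_edge_stabilizers G \<phi> E"
    and ell: "\<And>H. H \<in> \<H> \<Longrightarrow> has_global_fixed_point V \<phi> H"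
    and C: "subgroup C G" "two_ended (G\<lparr>carrier := C\<rparr>)" and v: "v \<in> V"
    and \<tau>: "\<tau> \<in> axis C v"
    and only_C: "\<And>g. g \<in> carrier G \<Longrightarrow> \<phi> g ` \<tau> \<in> axis C v \<Longrightarrow> g \<in> C"
  shows "C = carrier G"
proof -
  interpret C: subgroup C G by fact
  have infC: "infinite C" using C(2) by (simp add: two_ended_def)
  have \<tau>E: "\<tau> \<in> E" using \<tau> by (simp add: axis_def)
  note \<tau>V = edge_subset[OF \<tau>E]
  \<comment> \<open>The edges of the orbit of \<open>\<tau>\<close> that lie on the translate of the axis by \<open>g\<close>.\<close>
  define line where "line g = (\<lambda>c. \<phi> (g \<otimes> c) ` \<tau>) ` C" for g
  define \<L> where "\<L> = line ` carrier G"
  have line_shift: "line (g \<otimes> c) = line g" if "g \<in> carrier G" "c \<in> C" for g c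
  proof -
    have *: "line (h \<otimes> c) \<subseteq> line h" if "h \<in> carrier G" "c \<in> C" for h c
      using that by (auto simp: line_def m_assoc)
    have "line g = line ((g \<otimes> c) \<otimes> inv c)" using that by (simp add: m_assoc)
    then show ?thesis using *[of g c] *[of "g \<otimes> c" "inv c"] that by simp
  qed
  have line_E: "line g \<subseteq> E" if "g \<in> carrier G" for g
    using that simplicial[OF _ \<tau>E] by (auto simp: line_def)
  have in_line: "\<phi> g ` \<tau> \<in> line g" if "g \<in> carrier G" for g
  proof -
    have "\<phi> g ` \<tau> = \<phi> (g \<otimes> \<one>) ` \<tau>" using that by simp
    then show ?thesis unfolding line_def using C.one_closed by blast
  qed
  have line_axis: "\<phi> (inv g) ` d \<in> axis C v" if g: "g \<in> carrier G" and d: "d \<in> line g" for g d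
  proof -
    obtain c where c: "c \<in> C" "d = \<phi> (g \<otimes> c) ` \<tau>" using d by (auto simp: line_def)
    then have "\<phi> (inv g) ` d = \<phi> c ` \<tau>"
      using g \<tau>V act_img_inv(1)[OF g act_img_in[of c \<tau>]] by (simp add: act_img_comp)
    then show ?thesis using axis_invariant[OF C(1) v c(1) \<tau>] by simp
  qed
  have line_eq: "line h = line g"
    if g: "g \<in> carrier G" and h: "h \<in> carrier G" and d: "d \<in> line h" "\<phi> (inv g) ` d \<in> axis C v" for g h d
  proof -
    obtain c where c: "c \<in> C" "d = \<phi> (h \<otimes> c) ` \<tau>" using d by (auto simp: line_def)
    have hc: "h \<otimes> c \<in> carrier G" using h c by simp
    have "\<phi> (inv g \<otimes> (h \<otimes> c)) ` \<tau> \<in> axis C v"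
      using d(2) c(2) act_img_comp[OF inv_closed[OF g] hc \<tau>V] by simp
    then have b: "inv g \<otimes> (h \<otimes> c) \<in> C" using only_C g hc by simp
    have "g \<otimes> (inv g \<otimes> (h \<otimes> c)) = h \<otimes> c" using g hc by (simp flip: m_assoc)
    then have "line (h \<otimes> c) = line g" using line_shift[OF g b] by simp
    then show ?thesis using line_shift[OF h c(1)] by simp
  qed
  have line_act: "image (\<phi> h) ` line g = line (h \<otimes> g)" if gh: "h \<in> carrier G" "g \<in> carrier G" for g h
    unfolding line_def image_image[of "image (\<phi> h)"]
  proof (rule image_cong)
    fix c assume "c \<in> C"
    then have c: "c \<in> carrier G" by simp
    show "\<phi> h ` \<phi> (g \<otimes> c) ` \<tau> = \<phi> (h \<otimes> g \<otimes> c) ` \<tau>"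
      using act_img_comp[OF gh(1) m_closed[OF gh(2) c] \<tau>V] gh c by (simp add: m_assoc)
  qed simp
  have \<L>1: "\<Lambda> \<subseteq> E \<and> \<Lambda> \<noteq> {}" if "\<Lambda> \<in> \<L>" for \<Lambda>
    using that line_E in_line by (auto simp: \<L>_def)
  have \<L>2: "M = \<Lambda>" if \<Lambda>: "\<Lambda> \<in> \<L>" and M: "M \<in> \<L>" and u: "u \<in> \<Union>\<Lambda>" and w: "w \<in> \<Union>\<Lambda>"
    and d: "d \<in> M" "sep E d u w" for \<Lambda> M u w d
  proof -
    obtain g where g: "g \<in> carrier G" "\<Lambda> = line g" using \<Lambda> by (auto simp: \<L>_def)
    obtain h where h: "h \<in> carrier G" "M = line h" using M by (auto simp: \<L>_def)
    obtain d1 where d1: "d1 \<in> \<Lambda>" "u \<in> d1" using u by blast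
    obtain d2 where d2: "d2 \<in> \<Lambda>" "w \<in> d2" using w by blast
    have dE: "d \<in> E" "d1 \<in> E" "d2 \<in> E" using d d1 d2 \<L>1 \<Lambda> M by blast+
    have "sep E (\<phi> (inv g) ` d) (\<phi> (inv g) u) (\<phi> (inv g) w)"
      using sep_act[OF inv_closed[OF g(1)] dE(1), of u w] d(2) d1 d2 dE(2,3) edge_subset by blast
    moreover have "\<phi> (inv g) ` d1 \<in> axis C v" "\<phi> (inv g) ` d2 \<in> axis C v"
      using line_axis g d1 d2 by auto
    moreover have "\<phi> (inv g) u \<in> \<phi> (inv g) ` d1" "\<phi> (inv g) w \<in> \<phi> (inv g) ` d2"
      using d1 d2 by auto
    ultimately have "\<phi> (inv g) ` d \<in> axis C v" using axis_convex[OF C.subset v] by blast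
    then show ?thesis using line_eq[OF g(1) h(1)] d(1) g h by blast
  qed
  have lines: "lines \<L>"
    unfolding lines_def
  proof (intro conjI ballI impI)
    show "\<Lambda> \<subseteq> E" "\<Lambda> \<noteq> {}" if "\<Lambda> \<in> \<L>" for \<Lambda> using \<L>1[OF that] by simp_all
    show "M = \<Lambda>" if "\<Lambda> \<in> \<L>" "M \<in> \<L>" "u \<in> \<Union>\<Lambda>" "w \<in> \<Union>\<Lambda>" "d \<in> M" "sep E d u w" for \<Lambda> M u w d
      by (rule \<L>2[OF that])
  qed
  have \<L>3: "\<forall>h\<in>carrier G. \<forall>\<Lambda>\<in>\<L>. image (\<phi> h) ` \<Lambda> \<in> \<L>"
    using line_act by (auto simp: \<L>_def)
  have LE: "\<Union>\<L> \<subseteq> E" using \<L>1 by blast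
  let ?\<psi> = "cleaved_act \<L>"
  note cleaved = cleaved_G_tree[OF lines \<L>3]
  interpret new: G_tree G "cleaved_V \<L>" ?\<psi> "cleaved_E \<L>" by (rule cleaved(1))
  have one: "line \<one> \<in> \<L>" by (simp add: \<L>_def)
  have fix_line: "line g = line \<one> \<Longrightarrow> g \<in> C" if g: "g \<in> carrier G" for g
  proof -
    assume "line g = line \<one>"
    then have "\<phi> g ` \<tau> \<in> line \<one>" using in_line[OF g] by simp
    then obtain c where "c \<in> C" "\<phi> g ` \<tau> = \<phi> c ` \<tau>" by (auto simp: line_def)
    then show "g \<in> C" using only_C[OF g] axis_invariant[OF C(1) v _ \<tau>] by simp
  qed
  have C_fix: "?\<psi> c (Inr (line \<one>)) = Inr (line \<one>)" if "c \<in> C" for c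
    using that cleaved(3)[OF one] line_act[of c \<one>] line_shift[of \<one> c] by simp
  have vertex: "Inr (line \<one>) \<in> cleaved_V \<L>" using one by (simp add: cleaved_V_def)
  have "finite_edge_stabilizers G ?\<psi> (cleaved_E \<L>)"
    unfolding finite_edge_stabilizers_def
  proof
    fix \<epsilon> assume "\<epsilon> \<in> cleaved_E \<L>"
    then obtain u \<Lambda> where \<epsilon>: "\<Lambda> \<in> \<L>" "u \<in> \<Union>\<Lambda>" "\<epsilon> = {Inl (piece \<L> u), Inr \<Lambda>}"
      unfolding cleaved_E_def by blast
    obtain g where g: "g \<in> carrier G" "\<Lambda> = line g" using \<epsilon>(1) by (auto simp: \<L>_def)
    obtain c where c: "c \<in> C" "u \<in> \<phi> (g \<otimes> c) ` \<tau>" using \<epsilon>(2) g(2) by (auto simp: line_def)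
    \<comment> \<open>Up to translation by \<open>h\<close>, the edge joins the line of the axis to the piece of an endpoint of \<open>\<tau>\<close>.\<close>
    define h where "h = g \<otimes> c"
    have h: "h \<in> carrier G" "\<Lambda> = line h" using g c line_shift by (simp_all add: h_def)
    obtain x where x: "x \<in> \<tau>" "u = \<phi> h x" using c(2) by (auto simp: h_def)
    have xV: "x \<in> V" using x \<tau>V by blast
    have uV: "u \<in> V" using x(2) act_in[OF h(1) xV] by simp
    define D where "D = {b \<in> C. piece \<L> (\<phi> b x) = piece \<L> x}"
    have D_sub: "subgroup D G"
    proof (rule subgroupI)
      show "D \<subseteq> carrier G" by (auto simp: D_def)
      have "\<one> \<in> D" using act_one[OF xV] by (simp add: D_def)
      then show "D \<noteq> {}" by blast
      fix a assume a: "a \<in> D"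
      then have aC: "a \<in> C" and aG: "a \<in> carrier G" by (auto simp: D_def)
      have "\<phi> (inv a) ` piece \<L> (\<phi> a x) = \<phi> (inv a) ` piece \<L> x" using a by (simp add: D_def)
      then have "piece \<L> x = piece \<L> (\<phi> (inv a) x)"
        using piece_act[OF inv_closed[OF aG] _ LE \<L>3] act_in[OF aG xV] xV aG by (simp add: act_inv)
      then show "inv a \<in> D" using aC by (simp add: D_def)
      fix b assume b: "b \<in> D"
      then have bC: "b \<in> C" and bG: "b \<in> carrier G" by (auto simp: D_def)
      have "\<phi> a ` piece \<L> (\<phi> b x) = \<phi> a ` piece \<L> x" using b by (simp add: D_def)
      then have "piece \<L> (\<phi> a (\<phi> b x)) = piece \<L> x"
        using piece_act[OF aG _ LE \<L>3] act_in[OF bG xV] xV a by (simp add: D_def)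
      then show "a \<otimes> b \<in> D" using aC bC act_comp[OF aG bG xV] by (simp add: D_def)
    qed
    have "finite D"
    proof (rule ccontr)
      assume infD: "infinite D"
      have "subgroup D (G\<lparr>carrier := C\<rparr>)"
        by (rule subgroup_incl[OF D_sub C(1)]) (auto simp: D_def)
      then obtain F where F: "finite F" "F \<subseteq> C" "\<And>c. c \<in> C \<Longrightarrow> \<exists>d\<in>D. \<exists>y\<in>F. c = d \<otimes> y"
        using two_ended_infinite_subgroup[OF C(2) _ infD] by auto
      \<comment> \<open>Write \<open>c = d y\<close> with \<open>d \<in> D\<close> and \<open>y \<in> F\<close>. As \<open>d\<close> keeps \<open>x\<close> in its piece, \<open>\<tau>\<close> lies between \<open>d x\<close>
        and \<open>d (y v)\<close>, that is, \<open>d\<close> maps one of the finitely many edges between \<open>x\<close> and \<open>y v\<close> to \<open>\<tau>\<close>.\<close>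
      have "{c \<in> C. sep E \<tau> x (\<phi> c v)} \<subseteq>
        (\<Union>y\<in>F. \<Union>e\<in>{e. sep E e x (\<phi> y v)}. (\<lambda>d. d \<otimes> y) ` {d \<in> carrier G. \<phi> d ` e = \<tau>})"
      proof clarify
        fix c assume c: "c \<in> C" "sep E \<tau> x (\<phi> c v)"
        obtain d y where dy: "d \<in> D" "y \<in> F" "c = d \<otimes> y" using F(3)[OF c(1)] by blast
        have G: "d \<in> carrier G" "y \<in> carrier G" using dy F(2) by (auto simp: D_def)
        have "\<not> sep E \<tau> x (\<phi> d x)"
        proof -
          have "piece \<L> x = piece \<L> (\<phi> d x)" using dy(1) by (simp add: D_def)
          moreover have "\<tau> \<in> \<Union>\<L>" using one in_line[OF one_closed] act_img_one[OF \<tau>V] by auto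
          ultimately show ?thesis using piece_eq_iff[OF xV act_in[OF G(1) xV]] by blast
        qed
        then have s: "sep E \<tau> (\<phi> d x) (\<phi> d (\<phi> y v))"
          using c(2) dy(3) sep_iff_same act_comp[OF G v] by metis
        have yv: "\<phi> y v \<in> V" using act_in[OF G(2) v] .
        have "sep E (\<phi> (inv d) ` \<tau>) x (\<phi> y v)"
          using sep_act[OF inv_closed[OF G(1)] \<tau>E act_in[OF G(1) xV] act_in[OF G(1) yv]] s G(1) xV yv
          by (simp add: act_inv)
        moreover have "\<phi> d ` \<phi> (inv d) ` \<tau> = \<tau>" using act_img_inv(2)[OF G(1) \<tau>V] .
        ultimately show "c \<in> (\<Union>y\<in>F. \<Union>e\<in>{e. sep E e x (\<phi> y v)}. (\<lambda>d. d \<otimes> y) ` {d \<in> carrier G. \<phi> d ` e = \<tau>})"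
          using dy G by blast
      qed
      moreover have "finite (\<Union>y\<in>F. \<Union>e\<in>{e. sep E e x (\<phi> y v)}. (\<lambda>d. d \<otimes> y) ` {d \<in> carrier G. \<phi> d ` e = \<tau>})"
      proof (intro finite_UN_I finite_imageI)
        show "finite F" by (rule F)
        fix y assume "y \<in> F"
        then have yv: "\<phi> y v \<in> V" using F(2) act_in v by auto
        show "finite {e. sep E e x (\<phi> y v)}" by (rule finite_sep[OF xV yv])
        fix e assume "e \<in> {e. sep E e x (\<phi> y v)}"
        then have "e \<in> E" using sep_is_edge xV yv by simp
        then show "finite {d \<in> carrier G. \<phi> d ` e = \<tau>}" by (rule finite_transporter[OF fin])
      qed
      ultimately have "finite {c \<in> C. sep E \<tau> x (\<phi> c v)}" by (rule finite_subset)
      then show False using \<tau> x(1) by (simp add: axis_def)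
    qed
    moreover have "stabilizer G (\<lambda>k. image (?\<psi> k)) \<epsilon> \<subseteq> (\<lambda>b. h \<otimes> b \<otimes> inv h) ` D"
    proof
      fix k assume "k \<in> stabilizer G (\<lambda>k. image (?\<psi> k)) \<epsilon>"
      then have k: "k \<in> carrier G" and "?\<psi> k ` \<epsilon> = \<epsilon>" by (auto simp: stabilizer_def)
      then have "{Inl (piece \<L> (\<phi> k u)), Inr (image (\<phi> k) ` \<Lambda>)} = {Inl (piece \<L> u), Inr \<Lambda>}"
        using \<epsilon> cleaved(2)[OF k uV] cleaved(3)[OF \<epsilon>(1)] by simp
      then have fixed: "piece \<L> (\<phi> k u) = piece \<L> u" "image (\<phi> k) ` \<Lambda> = \<Lambda>"
        by (auto simp: doubleton_eq_iff)
      define b where "b = inv h \<otimes> (k \<otimes> h)"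
      have bG: "b \<in> carrier G" using h k by (simp add: b_def)
      have hb: "h \<otimes> b = k \<otimes> h" using h k by (simp add: b_def flip: m_assoc)
      have "line (k \<otimes> h) = line h" using fixed(2) line_act[OF k h(1)] h(2) by simp
      then have "image (\<phi> (inv h)) ` line (k \<otimes> h) = image (\<phi> (inv h)) ` line h" by simp
      then have "line b = line \<one>" using line_act[OF inv_closed[OF h(1)]] h k by (simp add: b_def)
      then have bC: "b \<in> C" by (rule fix_line[OF bG])
      have "\<phi> (inv h) ` piece \<L> (\<phi> k u) = \<phi> (inv h) ` piece \<L> u" using fixed(1) by simp
      then have "piece \<L> (\<phi> (inv h) (\<phi> k u)) = piece \<L> (\<phi> (inv h) u)"
        using piece_act[OF inv_closed[OF h(1)] _ LE \<L>3] act_in[OF k uV] uV by simp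
      moreover have "\<phi> (inv h) u = x" using x(2) act_inv(1)[OF h(1) xV] by simp
      moreover have "\<phi> (inv h) (\<phi> k u) = \<phi> b x"
        using x(2) act_comp h k xV act_in by (simp add: b_def)
      ultimately have "b \<in> D" using bC by (simp add: D_def)
      moreover have "k = h \<otimes> b \<otimes> inv h" using h k by (simp add: hb m_assoc)
      ultimately show "k \<in> (\<lambda>b. h \<otimes> b \<otimes> inv h) ` D" by blast
    qed
    ultimately show "finite (stabilizer G (\<lambda>k. image (?\<psi> k)) \<epsilon>)" by (meson finite_surj)
  qed
  moreover have "has_global_fixed_point (cleaved_V \<L>) ?\<psi> H" if H: "H \<in> insert C \<H>" for H
  proof (cases "H = C")
    case True
    then show ?thesis using C_fix vertex unfolding has_global_fixed_point_def by blast
  next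
    case False
    then have "H \<in> \<H>" using H by blast
    obtain w where w: "w \<in> V" "\<And>h. h \<in> H \<Longrightarrow> \<phi> h w = w"
      using ell[OF \<open>H \<in> \<H>\<close>] by (auto simp: has_global_fixed_point_def)
    have "Inl (piece \<L> w) \<in> cleaved_V \<L>" using w by (simp add: cleaved_V_def)
    moreover have "?\<psi> h (Inl (piece \<L> w)) = Inl (piece \<L> w)" if "h \<in> H" for h
      using cleaved(2)[of h w] w that \<H>[OF \<open>H \<in> \<H>\<close>] by auto
    ultimately show ?thesis unfolding has_global_fixed_point_def by blast
  qed
  moreover have "H \<subseteq> carrier G" if "H \<in> insert C \<H>" for H using that \<H> C.subset by blast
  ultimately have "?\<psi> g (Inr (line \<one>)) = Inr (line \<one>)" if "g \<in> carrier G" for g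
    using new.one_ended_fixes_vertex[OF oe _ _ _ C.subset infC vertex C_fix that] by blast
  then have "line g = line \<one>" if "g \<in> carrier G" for g
    using cleaved(3)[OF one] line_act[of g \<one>] that by simp
  then show ?thesis using fix_line C.subset by blast
qed

end


section \<open>Normal forms in amalgams\<close>

text \<open>
  A normal form is an alternating product of representatives of non-trivial left cosets of the
  amalgamated subgroups, followed by an element of the amalgamated subgroup (taken in \<open>G1\<close>).
\<close>

datatype ('a, 'b) normal_form =
  Tail 'a
| Left 'a "('a, 'b) normal_form"
| Right 'b "('a, 'b) normal_form"

fun is_Left :: "('a, 'b) normal_form \<Rightarrow> bool" where
  "is_Left (Left t x) = True"
| "is_Left _ = False"

fun is_Right :: "('a, 'b) normal_form \<Rightarrow> bool" where
  "is_Right (Right t x) = True"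
| "is_Right _ = False"

fun syllables :: "('a, 'b) normal_form \<Rightarrow> nat" where
  "syllables (Tail d) = 0"
| "syllables (Left t x) = Suc (syllables x)"
| "syllables (Right t x) = Suc (syllables x)"

lemma (in group) coset_representatives:
  assumes C: "subgroup C G"
  obtains r where
    "\<And>g. g \<in> carrier G \<Longrightarrow> r g \<in> carrier G" "\<And>g. g \<in> carrier G \<Longrightarrow> inv (r g) \<otimes> g \<in> C"
    "\<And>g c. g \<in> carrier G \<Longrightarrow> c \<in> C \<Longrightarrow> r (g \<otimes> c) = r g"
proof -
  interpret C: subgroup C G by fact
  define r where "r g = (SOME h. h \<in> g <# C)" for g
  have r: "r g \<in> g <# C" if "g \<in> carrier G" for g
  proof -
    have "g \<otimes> \<one> \<in> g <# C" using C.one_closed unfolding l_coset_def by blast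
    then show ?thesis unfolding r_def by (rule someI)
  qed
  show ?thesis
  proof
    fix g assume g: "g \<in> carrier G"
    obtain c where c: "c \<in> C" "r g = g \<otimes> c" using r[OF g] by (auto simp: l_coset_def)
    then show "r g \<in> carrier G" using g C.mem_carrier by simp
    have "inv (r g) \<otimes> g = inv c" using c g C.mem_carrier by (simp add: inv_mult_group m_assoc)
    then show "inv (r g) \<otimes> g \<in> C" using c by simp
    fix d assume d: "d \<in> C"
    have "(g \<otimes> d) <# C = g <# C"
    proof
      show "(g \<otimes> d) <# C \<subseteq> g <# C"
        using d g C.mem_carrier C.m_closed by (fastforce simp: l_coset_def m_assoc)
      show "g <# C \<subseteq> (g \<otimes> d) <# C"
      proof
        fix y assume "y \<in> g <# C"
        then obtain c where c: "c \<in> C" "y = g \<otimes> c" by (auto simp: l_coset_def)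
        have "y = (g \<otimes> d) \<otimes> (inv d \<otimes> c)"
          using c d g C.mem_carrier by (simp add: m_assoc flip: m_assoc[of d])
        moreover have "inv d \<otimes> c \<in> C" using c d by simp
        ultimately show "y \<in> (g \<otimes> d) <# C" unfolding l_coset_def by blast
      qed
    qed
    then show "r (g \<otimes> d) = r g" by (simp add: r_def)
  qed
qed

locale amalgam_normal_forms =
  G1: group G1 + G2: group G2 + C1: subgroup C1 G1 + C2: subgroup C2 G2
  for G1 :: "('a, 'm) monoid_scheme" (structure) and G2 :: "('b, 'n) monoid_scheme" (structure)
    and C1 :: "'a set" and C2 :: "'b set" +
  fixes f :: "'a \<Rightarrow> 'b" and f' :: "'b \<Rightarrow> 'a" and r1 :: "'a \<Rightarrow> 'a" and r2 :: "'b \<Rightarrow> 'b"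
  assumes f_closed: "c \<in> C1 \<Longrightarrow> f c \<in> C2" and f'_closed: "d \<in> C2 \<Longrightarrow> f' d \<in> C1"
    and f_f': "d \<in> C2 \<Longrightarrow> f (f' d) = d" and f'_f: "c \<in> C1 \<Longrightarrow> f' (f c) = c"
    and f_mult: "c \<in> C1 \<Longrightarrow> c' \<in> C1 \<Longrightarrow> f (c \<otimes>\<^bsub>G1\<^esub> c') = f c \<otimes>\<^bsub>G2\<^esub> f c'"
    and r1_closed: "g \<in> carrier G1 \<Longrightarrow> r1 g \<in> carrier G1"
    and r2_closed: "h \<in> carrier G2 \<Longrightarrow> r2 h \<in> carrier G2"
    and r1_rest: "g \<in> carrier G1 \<Longrightarrow> inv\<^bsub>G1\<^esub> (r1 g) \<otimes>\<^bsub>G1\<^esub> g \<in> C1"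
    and r2_rest: "h \<in> carrier G2 \<Longrightarrow> inv\<^bsub>G2\<^esub> (r2 h) \<otimes>\<^bsub>G2\<^esub> h \<in> C2"
    and r1_coset: "g \<in> carrier G1 \<Longrightarrow> c \<in> C1 \<Longrightarrow> r1 (g \<otimes>\<^bsub>G1\<^esub> c) = r1 g"
    and r2_coset: "h \<in> carrier G2 \<Longrightarrow> d \<in> C2 \<Longrightarrow> r2 (h \<otimes>\<^bsub>G2\<^esub> d) = r2 h"
begin

sublocale amalgam_data G1 G2 C1 f
  by unfold_locales (use C1.subset C2.subset f_closed in auto)

lemma f'_mult: "c \<in> C2 \<Longrightarrow> d \<in> C2 \<Longrightarrow> f' (c \<otimes>\<^bsub>G2\<^esub> d) = f' c \<otimes>\<^bsub>G1\<^esub> f' d"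
  using f_mult[of "f' c" "f' d"] f'_f[of "f' c \<otimes>\<^bsub>G1\<^esub> f' d"] by (simp add: f'_closed f_f')

lemma f_one: "f \<one>\<^bsub>G1\<^esub> = \<one>\<^bsub>G2\<^esub>"
  using f_mult[of "\<one>\<^bsub>G1\<^esub>" "\<one>\<^bsub>G1\<^esub>"] f_closed[OF C1.one_closed] C2.mem_carrier G2.l_cancel_one'
  by (metis C1.one_closed G1.l_one G1.one_closed)

text \<open>
  The factor in the amalgamated subgroup that is left when the representative is split off. For both
  groups it is taken in \<open>C1\<close>, as this is where it acts.
\<close>

definition k1 :: "'a \<Rightarrow> 'a" where "k1 g = inv\<^bsub>G1\<^esub> (r1 g) \<otimes>\<^bsub>G1\<^esub> g"
definition k2 :: "'b \<Rightarrow> 'a" where "k2 h = f' (inv\<^bsub>G2\<^esub> (r2 h) \<otimes>\<^bsub>G2\<^esub> h)"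

lemma k1: "g \<in> carrier G1 \<Longrightarrow> k1 g \<in> C1" "g \<in> carrier G1 \<Longrightarrow> r1 g \<otimes>\<^bsub>G1\<^esub> k1 g = g"
  by (auto simp: k1_def r1_rest r1_closed simp flip: G1.m_assoc)

lemma k2: "h \<in> carrier G2 \<Longrightarrow> k2 h \<in> C1" "h \<in> carrier G2 \<Longrightarrow> r2 h \<otimes>\<^bsub>G2\<^esub> f (k2 h) = h"
  by (auto simp: k2_def r2_rest r2_closed f'_closed f_f' simp flip: G2.m_assoc)

lemma k1_coset: "g \<in> carrier G1 \<Longrightarrow> c \<in> C1 \<Longrightarrow> k1 (g \<otimes>\<^bsub>G1\<^esub> c) = k1 g \<otimes>\<^bsub>G1\<^esub> c"
  by (simp add: k1_def r1_coset r1_closed C1.mem_carrier G1.m_assoc)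

lemma k2_coset: "h \<in> carrier G2 \<Longrightarrow> c \<in> C1 \<Longrightarrow> k2 (h \<otimes>\<^bsub>G2\<^esub> f c) = k2 h \<otimes>\<^bsub>G1\<^esub> c"
  using f'_mult[of "inv\<^bsub>G2\<^esub> (r2 h) \<otimes>\<^bsub>G2\<^esub> h" "f c"]
  by (simp add: k2_def r2_coset r2_closed r2_rest f_closed f'_f C2.mem_carrier G2.m_assoc)

lemma r1_idem: "g \<in> carrier G1 \<Longrightarrow> r1 (r1 g) = r1 g"
  using r1_coset[of "r1 g" "k1 g"] by (simp add: k1 r1_closed)

lemma r2_idem: "h \<in> carrier G2 \<Longrightarrow> r2 (r2 h) = r2 h"
  using r2_coset[of "r2 h" "f (k2 h)"] by (simp add: k2 r2_closed f_closed)

lemma mult_C1_iff: "c \<in> C1 \<Longrightarrow> g \<in> carrier G1 \<Longrightarrow> c \<otimes>\<^bsub>G1\<^esub> g \<in> C1 \<longleftrightarrow> g \<in> C1"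
  "c \<in> C1 \<Longrightarrow> g \<in> carrier G1 \<Longrightarrow> g \<otimes>\<^bsub>G1\<^esub> c \<in> C1 \<longleftrightarrow> g \<in> C1"
proof -
  assume c: "c \<in> C1" and g: "g \<in> carrier G1"
  have "g = inv\<^bsub>G1\<^esub> c \<otimes>\<^bsub>G1\<^esub> (c \<otimes>\<^bsub>G1\<^esub> g)" "g = (g \<otimes>\<^bsub>G1\<^esub> c) \<otimes>\<^bsub>G1\<^esub> inv\<^bsub>G1\<^esub> c"
    using c g C1.mem_carrier by (simp_all add: G1.m_assoc flip: G1.m_assoc[of "inv\<^bsub>G1\<^esub> c"])
  then show "c \<otimes>\<^bsub>G1\<^esub> g \<in> C1 \<longleftrightarrow> g \<in> C1" "g \<otimes>\<^bsub>G1\<^esub> c \<in> C1 \<longleftrightarrow> g \<in> C1"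
    using c C1.m_closed C1.m_inv_closed by metis+
qed

lemma mult_C2_iff: "c \<in> C2 \<Longrightarrow> g \<in> carrier G2 \<Longrightarrow> c \<otimes>\<^bsub>G2\<^esub> g \<in> C2 \<longleftrightarrow> g \<in> C2"
  "c \<in> C2 \<Longrightarrow> g \<in> carrier G2 \<Longrightarrow> g \<otimes>\<^bsub>G2\<^esub> c \<in> C2 \<longleftrightarrow> g \<in> C2"
proof -
  assume c: "c \<in> C2" and g: "g \<in> carrier G2"
  have "g = inv\<^bsub>G2\<^esub> c \<otimes>\<^bsub>G2\<^esub> (c \<otimes>\<^bsub>G2\<^esub> g)" "g = (g \<otimes>\<^bsub>G2\<^esub> c) \<otimes>\<^bsub>G2\<^esub> inv\<^bsub>G2\<^esub> c"
    using c g C2.mem_carrier by (simp_all add: G2.m_assoc flip: G2.m_assoc[of "inv\<^bsub>G2\<^esub> c"])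
  then show "c \<otimes>\<^bsub>G2\<^esub> g \<in> C2 \<longleftrightarrow> g \<in> C2" "g \<otimes>\<^bsub>G2\<^esub> c \<in> C2 \<longleftrightarrow> g \<in> C2"
    using c C2.m_closed C2.m_inv_closed by metis+
qed

lemma r1_C1_iff: "g \<in> carrier G1 \<Longrightarrow> r1 g \<in> C1 \<longleftrightarrow> g \<in> C1"
  using mult_C1_iff(2)[of "k1 g" "r1 g"] by (simp add: k1 r1_closed)

lemma r2_C2_iff: "h \<in> carrier G2 \<Longrightarrow> r2 h \<in> C2 \<longleftrightarrow> h \<in> C2"
  using mult_C2_iff(2)[of "f (k2 h)" "r2 h"] by (simp add: k2 r2_closed f_closed)

fun normal :: "('a, 'b) normal_form \<Rightarrow> bool" where
  "normal (Tail d) \<longleftrightarrow> d \<in> C1"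
| "normal (Left t x) \<longleftrightarrow> t \<in> carrier G1 \<and> t \<notin> C1 \<and> r1 t = t \<and> normal x \<and> \<not> is_Left x"
| "normal (Right t x) \<longleftrightarrow> t \<in> carrier G2 \<and> t \<notin> C2 \<and> r2 t = t \<and> normal x \<and> \<not> is_Right x"

text \<open>Multiplication by an element of the amalgamated subgroup, which is moved to the tail.\<close>

fun act0 :: "'a \<Rightarrow> ('a, 'b) normal_form \<Rightarrow> ('a, 'b) normal_form" where
  "act0 c (Tail d) = Tail (c \<otimes>\<^bsub>G1\<^esub> d)"
| "act0 c (Left t x) = Left (r1 (c \<otimes>\<^bsub>G1\<^esub> t)) (act0 (k1 (c \<otimes>\<^bsub>G1\<^esub> t)) x)"
| "act0 c (Right t x) = Right (r2 (f c \<otimes>\<^bsub>G2\<^esub> t)) (act0 (k2 (f c \<otimes>\<^bsub>G2\<^esub> t)) x)"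

text \<open>
  The product of a group element and a normal form that does not begin with a syllable from the same
  group.
\<close>

definition glue1 :: "'a \<Rightarrow> ('a, 'b) normal_form \<Rightarrow> ('a, 'b) normal_form" where
  "glue1 g x = (if g \<in> C1 then act0 g x else Left (r1 g) (act0 (k1 g) x))"

definition glue2 :: "'b \<Rightarrow> ('a, 'b) normal_form \<Rightarrow> ('a, 'b) normal_form" where
  "glue2 h x = (if h \<in> C2 then act0 (f' h) x else Right (r2 h) (act0 (k2 h) x))"

definition act1 :: "'a \<Rightarrow> ('a, 'b) normal_form \<Rightarrow> ('a, 'b) normal_form" where
  "act1 g x = (case x of Left t y \<Rightarrow> glue1 (g \<otimes>\<^bsub>G1\<^esub> t) y | _ \<Rightarrow> glue1 g x)"

definition act2 :: "'b \<Rightarrow> ('a, 'b) normal_form \<Rightarrow> ('a, 'b) normal_form" where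
  "act2 h x = (case x of Right t y \<Rightarrow> glue2 (h \<otimes>\<^bsub>G2\<^esub> t) y | _ \<Rightarrow> glue2 h x)"

lemma act1_simps: "act1 g (Left t y) = glue1 (g \<otimes>\<^bsub>G1\<^esub> t) y" "\<not> is_Left x \<Longrightarrow> act1 g x = glue1 g x"
  by (auto simp: act1_def split: normal_form.splits)

lemma act2_simps: "act2 h (Right t y) = glue2 (h \<otimes>\<^bsub>G2\<^esub> t) y" "\<not> is_Right x \<Longrightarrow> act2 h x = glue2 h x"
  by (auto simp: act2_def split: normal_form.splits)

lemma is_Left_act0 [simp]: "is_Left (act0 c x) = is_Left x"
  by (cases x) auto

lemma is_Right_act0 [simp]: "is_Right (act0 c x) = is_Right x"
  by (cases x) auto

lemma syllables_act0 [simp]: "syllables (act0 c x) = syllables x"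
  by (induction x arbitrary: c) auto

lemma normal_act0: "c \<in> C1 \<Longrightarrow> normal x \<Longrightarrow> normal (act0 c x)"
proof (induction x arbitrary: c)
  case (Left t x)
  then have "c \<otimes>\<^bsub>G1\<^esub> t \<in> carrier G1" "c \<otimes>\<^bsub>G1\<^esub> t \<notin> C1" using C1.mem_carrier mult_C1_iff(1) by auto
  then show ?case using Left by (auto simp: r1_closed r1_idem r1_C1_iff k1)
next
  case (Right t x)
  then have "f c \<otimes>\<^bsub>G2\<^esub> t \<in> carrier G2" "f c \<otimes>\<^bsub>G2\<^esub> t \<notin> C2"
    using C2.mem_carrier mult_C2_iff(1) f_closed by auto
  then show ?case using Right by (auto simp: r2_closed r2_idem r2_C2_iff k2)
qed auto

lemma act0_mult:
  "c \<in> C1 \<Longrightarrow> d \<in> C1 \<Longrightarrow> normal x \<Longrightarrow> act0 (c \<otimes>\<^bsub>G1\<^esub> d) x = act0 c (act0 d x)"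
proof (induction x arbitrary: c d)
  case (Tail e)
  then show ?case by (simp add: C1.mem_carrier G1.m_assoc)
next
  case (Left t x)
  define s where "s = d \<otimes>\<^bsub>G1\<^esub> t"
  have t: "t \<in> carrier G1" using Left by simp
  have s: "s \<in> carrier G1" using t Left.prems(2) by (simp add: s_def C1.mem_carrier)
  have cs: "c \<otimes>\<^bsub>G1\<^esub> d \<otimes>\<^bsub>G1\<^esub> t = (c \<otimes>\<^bsub>G1\<^esub> r1 s) \<otimes>\<^bsub>G1\<^esub> k1 s"
    using Left.prems t s by (simp add: G1.m_assoc C1.mem_carrier k1 r1_closed s_def[symmetric])
  have "c \<otimes>\<^bsub>G1\<^esub> r1 s \<in> carrier G1" using Left.prems s by (simp add: C1.mem_carrier r1_closed)
  then show ?case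
    using Left k1(1)[OF s]
    by (simp add: cs r1_coset k1_coset k1 s_def[symmetric])
next
  case (Right t x)
  define s where "s = f d \<otimes>\<^bsub>G2\<^esub> t"
  have t: "t \<in> carrier G2" using Right by simp
  have s: "s \<in> carrier G2" using t Right.prems(2) by (simp add: s_def f_closed C2.mem_carrier)
  have cs: "f c \<otimes>\<^bsub>G2\<^esub> f d \<otimes>\<^bsub>G2\<^esub> t = (f c \<otimes>\<^bsub>G2\<^esub> r2 s) \<otimes>\<^bsub>G2\<^esub> f (k2 s)"
    using Right.prems t s
    by (simp add: G2.m_assoc C2.mem_carrier f_closed k2 r2_closed s_def[symmetric])
  have "f c \<otimes>\<^bsub>G2\<^esub> r2 s \<in> carrier G2" using Right.prems s by (simp add: C2.mem_carrier f_closed r2_closed)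
  then show ?case
    using Right k2(1)[OF s]
    by (simp add: f_mult cs r2_coset k2_coset k2 f_closed s_def[symmetric])
qed

lemma act0_one: "normal x \<Longrightarrow> act0 \<one>\<^bsub>G1\<^esub> x = x"
proof (induction x)
  case (Left t x)
  then have "k1 t = \<one>\<^bsub>G1\<^esub>" by (simp add: k1_def)
  then show ?case using Left by simp
next
  case (Right t x)
  moreover have "f' \<one>\<^bsub>G2\<^esub> = \<one>\<^bsub>G1\<^esub>" using f'_f[OF C1.one_closed] f_one by simp
  ultimately have "k2 t = \<one>\<^bsub>G1\<^esub>" by (simp add: k2_def)
  then show ?case using Right by (simp add: f_one)
qed (auto simp: C1.mem_carrier)

lemma glue1_act0:
  assumes "g \<in> carrier G1" "c \<in> C1" "normal x"
  shows "glue1 g (act0 c x) = glue1 (g \<otimes>\<^bsub>G1\<^esub> c) x"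
  using assms by (simp add: glue1_def act0_mult mult_C1_iff r1_coset k1_coset k1)

lemma glue2_act0:
  assumes "g \<in> carrier G2" "c \<in> C1" "normal x"
  shows "glue2 g (act0 c x) = glue2 (g \<otimes>\<^bsub>G2\<^esub> f c) x"
  using assms
  by (simp add: glue2_def act0_mult mult_C2_iff r2_coset k2_coset k2 f_closed f'_closed f'_mult f'_f)

lemma act1_glue1:
  assumes "g \<in> carrier G1" "h \<in> carrier G1" "normal x" "\<not> is_Left x"
  shows "act1 h (glue1 g x) = glue1 (h \<otimes>\<^bsub>G1\<^esub> g) x"
proof (cases "g \<in> C1")
  case True
  then show ?thesis using assms by (simp add: glue1_def[of g] act1_simps glue1_act0)
next
  case False
  then show ?thesis
    using assms by (simp add: glue1_def[of g] act1_simps glue1_act0 r1_closed k1 G1.m_assoc)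
qed

lemma act2_glue2:
  assumes "g \<in> carrier G2" "h \<in> carrier G2" "normal x" "\<not> is_Right x"
  shows "act2 h (glue2 g x) = glue2 (h \<otimes>\<^bsub>G2\<^esub> g) x"
proof (cases "g \<in> C2")
  case True
  then show ?thesis using assms by (simp add: glue2_def[of g] act2_simps glue2_act0 f'_closed f_f')
next
  case False
  then show ?thesis
    using assms
    by (simp add: glue2_def[of g] act2_simps glue2_act0 r2_closed k2 G2.m_assoc f_closed C2.mem_carrier)
qed

lemma act1_mult:
  assumes "g \<in> carrier G1" "h \<in> carrier G1" "normal x"
  shows "act1 h (act1 g x) = act1 (h \<otimes>\<^bsub>G1\<^esub> g) x"
  using assms by (cases x) (auto simp: act1_simps act1_glue1 G1.m_assoc)

lemma act2_mult:
  assumes "g \<in> carrier G2" "h \<in> carrier G2" "normal x"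
  shows "act2 h (act2 g x) = act2 (h \<otimes>\<^bsub>G2\<^esub> g) x"
  using assms by (cases x) (auto simp: act2_simps act2_glue2 G2.m_assoc)

lemma act1_C1: "c \<in> C1 \<Longrightarrow> normal x \<Longrightarrow> act1 c x = act0 c x"
  by (cases x) (auto simp: act1_simps glue1_def mult_C1_iff)

lemma act2_C1: "c \<in> C1 \<Longrightarrow> normal x \<Longrightarrow> act2 (f c) x = act0 c x"
  by (cases x) (auto simp: act2_simps glue2_def mult_C2_iff f_closed f'_f)

lemma normal_glue1: "g \<in> carrier G1 \<Longrightarrow> normal x \<Longrightarrow> \<not> is_Left x \<Longrightarrow> normal (glue1 g x)"
  by (simp add: glue1_def normal_act0 k1 r1_closed r1_idem r1_C1_iff)

lemma normal_glue2: "g \<in> carrier G2 \<Longrightarrow> normal x \<Longrightarrow> \<not> is_Right x \<Longrightarrow> normal (glue2 g x)"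
  by (simp add: glue2_def normal_act0 k2 r2_closed r2_idem r2_C2_iff f'_closed)

lemma normal_act1: "g \<in> carrier G1 \<Longrightarrow> normal x \<Longrightarrow> normal (act1 g x)"
  by (cases x) (auto simp: act1_simps normal_glue1)

lemma normal_act2: "g \<in> carrier G2 \<Longrightarrow> normal x \<Longrightarrow> normal (act2 g x)"
  by (cases x) (auto simp: act2_simps normal_glue2)

text \<open>
  The letters act on normal forms compatibly with the defining relations of the amalgam, so the
  normal form of a word depends on its class only.
\<close>

definition act_word :: "('a + 'b) list \<Rightarrow> ('a, 'b) normal_form \<Rightarrow> ('a, 'b) normal_form" where
  "act_word w x = foldr (case_sum act1 act2) w x"

lemma act_word_simps:
  "act_word [] x = x" "act_word (Inl g # w) x = act1 g (act_word w x)"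
  "act_word (Inr h # w) x = act2 h (act_word w x)" "act_word (u @ w) x = act_word u (act_word w x)"
  by (simp_all add: act_word_def)

lemma normal_act_word: "w \<in> amalgam_words G1 G2 \<Longrightarrow> normal x \<Longrightarrow> normal (act_word w x)"
  by (induction w) (auto simp: amalgam_words_def act_word_simps normal_act1 normal_act2)

lemma act_word_rel:
  "(u, w) \<in> amalgam_rel G1 G2 C1 f \<Longrightarrow> normal x \<Longrightarrow> act_word u x = act_word w x"
proof (induction arbitrary: x rule: amalgam_rel.induct)
  case (append u u' w w')
  then show ?case using rel_words normal_act_word by (simp add: act_word_simps)
next
  case one_left
  then show ?case using act1_C1[OF C1.one_closed] by (simp add: act_word_simps act0_one)
next
  case one_right
  then show ?case using act2_C1[OF C1.one_closed] by (simp add: act_word_simps act0_one f_one)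
qed (simp_all add: act_word_simps act1_mult act2_mult act1_C1 act2_C1)

definition nf :: "('a + 'b) list set \<Rightarrow> ('a, 'b) normal_form" where
  "nf A = act_word (SOME w. w \<in> A) (Tail \<one>\<^bsub>G1\<^esub>)"

lemma nf_class:
  assumes "w \<in> amalgam_words G1 G2"
  shows "nf (amalgam_rel G1 G2 C1 f `` {w}) = act_word w (Tail \<one>\<^bsub>G1\<^esub>)"
proof -
  let ?A = "amalgam_rel G1 G2 C1 f `` {w}"
  have "w \<in> ?A" using assms by (auto intro: amalgam_rel.refl)
  then have "(SOME w. w \<in> ?A) \<in> ?A" by (rule someI)
  then show ?thesis using act_word_rel[of w "SOME w. w \<in> ?A" "Tail \<one>\<^bsub>G1\<^esub>"] by (simp add: nf_def)
qed

abbreviation "A \<equiv> amalgam G1 G2 C1 f"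
abbreviation "\<iota>1 \<equiv> amalgam_left G1 G2 C1 f"
abbreviation "\<iota>2 \<equiv> amalgam_right G1 G2 C1 f"

lemma normal_nf: "a \<in> carrier A \<Longrightarrow> normal (nf a)"
  by (auto elim!: amalgam_carrierE simp: nf_class normal_act_word)

lemma word_intros:
  "[] \<in> W" "g \<in> carrier G1 \<Longrightarrow> w \<in> W \<Longrightarrow> Inl g # w \<in> W" "h \<in> carrier G2 \<Longrightarrow> w \<in> W \<Longrightarrow> Inr h # w \<in> W"
  by (auto simp: amalgam_words_def)

lemma nf_left: "g \<in> carrier G1 \<Longrightarrow> a \<in> carrier A \<Longrightarrow> nf (\<iota>1 g \<otimes>\<^bsub>A\<^esub> a) = act1 g (nf a)"
  by (erule amalgam_carrierE)
     (auto simp: amalgam_left_def class_mult nf_class act_word_simps word_intros)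

lemma nf_right: "g \<in> carrier G2 \<Longrightarrow> a \<in> carrier A \<Longrightarrow> nf (\<iota>2 g \<otimes>\<^bsub>A\<^esub> a) = act2 g (nf a)"
  by (erule amalgam_carrierE)
     (auto simp: amalgam_right_def class_mult nf_class act_word_simps word_intros)

lemma inj_left: "inj_on \<iota>1 (carrier G1)"
proof (rule inj_on_inverseI)
  fix g assume g: "g \<in> carrier G1"
  have "nf (\<iota>1 g) = glue1 g (Tail \<one>\<^bsub>G1\<^esub>)"
    using g by (simp add: amalgam_left_def nf_class word_intros act_word_simps act1_simps)
  then show "(case nf (\<iota>1 g) of Tail c \<Rightarrow> c | Left t x \<Rightarrow> (case x of Tail c \<Rightarrow> t \<otimes>\<^bsub>G1\<^esub> c)) = g"
    using g k1[OF g] by (simp add: glue1_def C1.mem_carrier)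
qed

lemma inj_right: "inj_on \<iota>2 (carrier G2)"
proof (rule inj_on_inverseI)
  fix g assume g: "g \<in> carrier G2"
  have "nf (\<iota>2 g) = glue2 g (Tail \<one>\<^bsub>G1\<^esub>)"
    using g by (simp add: amalgam_right_def nf_class word_intros act_word_simps act2_simps)
  then show "(case nf (\<iota>2 g) of Tail c \<Rightarrow> f c | Right t x \<Rightarrow> (case x of Tail c \<Rightarrow> t \<otimes>\<^bsub>G2\<^esub> f c)) = g"
    using g k2[OF g] by (simp add: glue2_def C1.mem_carrier f'_closed f_f')
qed

lemma syllables_C1:
  assumes "c \<in> C1" "a \<in> carrier A" shows "syllables (nf (\<iota>1 c \<otimes>\<^bsub>A\<^esub> a)) = syllables (nf a)"
  using assms by (simp add: nf_left C1.mem_carrier act1_C1 normal_nf)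

lemma syllables_grow:
  assumes "a \<in> carrier A"
  shows "(\<forall>g\<in>carrier G1 - C1. syllables (nf (\<iota>1 g \<otimes>\<^bsub>A\<^esub> a)) = Suc (syllables (nf a))) \<or>
    (\<forall>g\<in>carrier G2 - C2. syllables (nf (\<iota>2 g \<otimes>\<^bsub>A\<^esub> a)) = Suc (syllables (nf a)))"
proof (cases "is_Left (nf a)")
  case True
  then have "\<not> is_Right (nf a)" by (cases "nf a") auto
  then show ?thesis using assms by (simp add: nf_right act2_simps glue2_def)
next
  case False
  then show ?thesis using assms by (simp add: nf_left act1_simps glue1_def)
qed

end

text \<open>
  The length counts the syllables of the normal form. Multiplication on the left by an element outside
  the amalgamated subgroup adds a syllable, unless it comes from the group of the first syllable; so
  for one of the two groups it always does. This carries the information that the Bass--Serre tree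
  of the amalgam is a tree.
\<close>

theorem amalgam_syllable_length:
  fixes G1 :: "('a, 'm) monoid_scheme" and G2 :: "('b, 'n) monoid_scheme"
  assumes "group G1" "group G2" "subgroup C1 G1" "subgroup C2 G2"
    and f: "f \<in> iso (G1\<lparr>carrier := C1\<rparr>) (G2\<lparr>carrier := C2\<rparr>)"
  defines "A \<equiv> amalgam G1 G2 C1 f"
    and "\<iota>1 \<equiv> amalgam_left G1 G2 C1 f" and "\<iota>2 \<equiv> amalgam_right G1 G2 C1 f"
  obtains len :: "('a + 'b) list set \<Rightarrow> nat" where
    "inj_on \<iota>1 (carrier G1)" "inj_on \<iota>2 (carrier G2)"
    "\<And>c a. c \<in> C1 \<Longrightarrow> a \<in> carrier A \<Longrightarrow> len (\<iota>1 c \<otimes>\<^bsub>A\<^esub> a) = len a"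
    "\<And>a. a \<in> carrier A \<Longrightarrow> (\<forall>g\<in>carrier G1 - C1. len a < len (\<iota>1 g \<otimes>\<^bsub>A\<^esub> a)) \<or>
      (\<forall>g\<in>carrier G2 - C2. len a < len (\<iota>2 g \<otimes>\<^bsub>A\<^esub> a))"
proof -
  interpret G1: group G1 by fact
  interpret G2: group G2 by fact
  obtain r1 where r1: "\<And>g. g \<in> carrier G1 \<Longrightarrow> r1 g \<in> carrier G1"
    "\<And>g. g \<in> carrier G1 \<Longrightarrow> inv\<^bsub>G1\<^esub> (r1 g) \<otimes>\<^bsub>G1\<^esub> g \<in> C1"
    "\<And>g c. g \<in> carrier G1 \<Longrightarrow> c \<in> C1 \<Longrightarrow> r1 (g \<otimes>\<^bsub>G1\<^esub> c) = r1 g"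
    using G1.coset_representatives[OF assms(3)] by blast
  obtain r2 where r2: "\<And>g. g \<in> carrier G2 \<Longrightarrow> r2 g \<in> carrier G2"
    "\<And>g. g \<in> carrier G2 \<Longrightarrow> inv\<^bsub>G2\<^esub> (r2 g) \<otimes>\<^bsub>G2\<^esub> g \<in> C2"
    "\<And>g c. g \<in> carrier G2 \<Longrightarrow> c \<in> C2 \<Longrightarrow> r2 (g \<otimes>\<^bsub>G2\<^esub> c) = r2 g"
    using G2.coset_representatives[OF assms(4)] by blast
  have bij: "bij_betw f C1 C2" and hom: "\<And>c d. c \<in> C1 \<Longrightarrow> d \<in> C1 \<Longrightarrow> f (c \<otimes>\<^bsub>G1\<^esub> d) = f c \<otimes>\<^bsub>G2\<^esub> f d"
    using f by (auto simp: iso_def hom_def)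
  let ?f' = "inv_into C1 f"
  interpret amalgam_normal_forms G1 G2 C1 C2 f ?f' r1 r2
    using bij bij_betw_inv_into[OF bij] bij_betw_inv_into_left[OF bij] bij_betw_inv_into_right[OF bij]
    by (intro amalgam_normal_forms.intro amalgam_normal_forms_axioms.intro assms(1-4) hom r1 r2)
       (auto dest: bij_betw_apply)
  show ?thesis
  proof (rule that[of "\<lambda>a. syllables (nf a)"])
    show "inj_on \<iota>1 (carrier G1)" "inj_on \<iota>2 (carrier G2)"
      unfolding \<iota>1_def \<iota>2_def by (fact inj_left, fact inj_right)
    show "syllables (nf (\<iota>1 c \<otimes>\<^bsub>A\<^esub> a)) = syllables (nf a)" if "c \<in> C1" "a \<in> carrier A" for c a
      using that unfolding A_def \<iota>1_def by (rule syllables_C1)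
    show "(\<forall>g\<in>carrier G1 - C1. syllables (nf a) < syllables (nf (\<iota>1 g \<otimes>\<^bsub>A\<^esub> a))) \<or>
      (\<forall>g\<in>carrier G2 - C2. syllables (nf a) < syllables (nf (\<iota>2 g \<otimes>\<^bsub>A\<^esub> a)))"
      if "a \<in> carrier A" for a
      using syllables_grow[OF that[unfolded A_def]] unfolding A_def \<iota>1_def \<iota>2_def
      by (metis lessI)
  qed
qed


section \<open>Amalgams over two ended subgroups\<close>

lemma (in G_tree) minimal_no_fixed_vertex:
  assumes min: "minimal_G_tree G V \<phi> E" and nontriv: "\<nexists>v. V = {v}" and v: "v \<in> V"
  shows "\<exists>g\<in>carrier G. \<phi> g v \<noteq> v"
proof (rule ccontr)
  assume "\<not> ?thesis"
  then have fixed: "\<phi> g v = v" if "g \<in> carrier G" for g using that by blast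
  have "simplicial_tree {v} ({} :: 'v set set)"
    by (rule simplicial_treeI) auto
  then have "invariant_subtree G V \<phi> E {v} {}"
    using v fixed by (simp add: invariant_subtree_def)
  then have "V = {v}" using min unfolding minimal_G_tree_def by blast
  then show False using nontriv by blast
qed

lemma (in amalgam_data) amalgam_fixes:
  assumes T: "G_tree (amalgam G1 G2 C f) V \<phi> E" and v: "v \<in> V"
    and left: "\<And>g. g \<in> carrier G1 \<Longrightarrow> \<phi> (amalgam_left G1 G2 C f g) v = v"
    and right: "\<And>g. g \<in> carrier G2 \<Longrightarrow> \<phi> (amalgam_right G1 G2 C f g) v = v"
    and a: "a \<in> carrier (amalgam G1 G2 C f)"
  shows "\<phi> a v = v"
proof -
  interpret T: G_tree "amalgam G1 G2 C f" V \<phi> E by fact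
  obtain w where w: "w \<in> W" "a = R `` {w}" using a by (rule amalgam_carrierE)
  have "\<phi> (R `` {w}) v = v"
    using w(1)
  proof (induction w)
    case Nil
    then show ?case using T.act_one[OF v] by (simp add: amalgam_def)
  next
    case (Cons s w)
    have w: "w \<in> W" and s: "[s] \<in> W" using Cons.prems by (auto simp: amalgam_words_def)
    have "\<phi> (R `` {[s]}) v = v"
    proof (cases s)
      case (Inl g)
      then show ?thesis using left[of g] s by (auto simp: amalgam_words_def amalgam_left_def)
    next
      case (Inr g)
      then show ?thesis using right[of g] s by (auto simp: amalgam_words_def amalgam_right_def)
    qed
    then show ?case
      using T.act_comp[OF class_carrier[OF s] class_carrier[OF w] v] Cons.IH[OF w] class_mult[OF s w]
      by simp
  qed
  then show ?thesis using w(2) by simp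
qed

theorem corollary1p1:
  fixes G1 :: "('a, 'm) monoid_scheme" and G2 :: "('b, 'n) monoid_scheme"
    and \<H>1 :: "'a set set" and \<H>2 :: "'b set set"
    and C1 :: "'a set" and C2 :: "'b set" and f :: "'a \<Rightarrow> 'b"
  assumes "group G1" and "group G2"
    and "\<And>H. H \<in> \<H>1 \<Longrightarrow> subgroup H G1"
    and "\<And>H. H \<in> \<H>2 \<Longrightarrow> subgroup H G2"
    and "subgroup C1 G1" and "subgroup C2 G2"
    and "C1 \<noteq> carrier G1" and "C2 \<noteq> carrier G2"
    and "two_ended (G1\<lparr>carrier := C1\<rparr>)" and "two_ended (G2\<lparr>carrier := C2\<rparr>)"
    and "f \<in> iso (G1\<lparr>carrier := C1\<rparr>) (G2\<lparr>carrier := C2\<rparr>)"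
    and "one_ended_rel G1 (\<H>1 \<union> {C1})"
    and "one_ended_rel G2 (\<H>2 \<union> {C2})"
  shows "one_ended_rel (amalgam G1 G2 C1 f)
           ((\<lambda>H. amalgam_left G1 G2 C1 f ` H) ` \<H>1 \<union> (\<lambda>H. amalgam_right G1 G2 C1 f ` H) ` \<H>2)"
  unfolding one_ended_rel_def
proof (intro allI impI, rule ccontr)
  let ?A = "amalgam G1 G2 C1 f"
  let ?\<iota>1 = "amalgam_left G1 G2 C1 f" and ?\<iota>2 = "amalgam_right G1 G2 C1 f"
  fix V :: "('a + 'b) list set list set" and \<phi> E
  assume min: "minimal_G_tree ?A V \<phi> E" and nontriv: "\<nexists>v. V = {v}"
    and fin: "finite_edge_stabilizers ?A \<phi> E"
    and "\<not> (\<exists>H\<in>(\<lambda>H. ?\<iota>1 ` H) ` \<H>1 \<union> (\<lambda>H. ?\<iota>2 ` H) ` \<H>2. \<not> has_global_fixed_point V \<phi> H)"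
  then have elliptic: "has_global_fixed_point V \<phi> H"
    if "H \<in> (\<lambda>H. ?\<iota>1 ` H) ` \<H>1 \<union> (\<lambda>H. ?\<iota>2 ` H) ` \<H>2" for H
    using that by blast
  interpret G1: group G1 by fact
  interpret G2: group G2 by fact
  interpret C1: subgroup C1 G1 by fact
  interpret C2: subgroup C2 G2 by fact
  have f: "bij_betw f C1 C2" using assms(11) by (simp add: iso_def)
  interpret amalgam_data G1 G2 C1 f
    by unfold_locales (use C1.subset C2.subset bij_betw_apply[OF f] in auto)
  interpret T: G_tree ?A V \<phi> E using min by (simp add: minimal_G_tree_def)
  obtain len :: "('a + 'b) list set \<Rightarrow> nat" where inj: "inj_on ?\<iota>1 (carrier G1)" "inj_on ?\<iota>2 (carrier G2)"
    and len_C1: "\<And>c a. c \<in> C1 \<Longrightarrow> a \<in> carrier ?A \<Longrightarrow> len (?\<iota>1 c \<otimes>\<^bsub>?A\<^esub> a) = len a"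
    and len_grows: "\<And>a. a \<in> carrier ?A \<Longrightarrow> (\<forall>g\<in>carrier G1 - C1. len a < len (?\<iota>1 g \<otimes>\<^bsub>?A\<^esub> a)) \<or>
      (\<forall>g\<in>carrier G2 - C2. len a < len (?\<iota>2 g \<otimes>\<^bsub>?A\<^esub> a))"
    by (rule amalgam_syllable_length[OF assms(1,2,5,6,11)]) blast
  let ?\<phi>1 = "\<lambda>g. \<phi> (?\<iota>1 g)" and ?\<phi>2 = "\<lambda>g. \<phi> (?\<iota>2 g)"
  interpret T1: G_tree G1 V ?\<phi>1 E
    by (rule G_tree_pullback[OF T.G_tree_axioms assms(1) amalgam_left_hom])
  interpret T2: G_tree G2 V ?\<phi>2 E
    by (rule G_tree_pullback[OF T.G_tree_axioms assms(2) amalgam_right_hom])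
  have fin1: "finite_edge_stabilizers G1 ?\<phi>1 E" and fin2: "finite_edge_stabilizers G2 ?\<phi>2 E"
    by (rule finite_edge_stabilizers_pullback[OF fin amalgam_left_hom inj(1)])
       (rule finite_edge_stabilizers_pullback[OF fin amalgam_right_hom inj(2)])
  have elliptic1: "has_global_fixed_point V ?\<phi>1 H" if "H \<in> \<H>1" for H
    using elliptic[of "?\<iota>1 ` H"] that by (auto simp: has_global_fixed_point_def)
  have elliptic2: "has_global_fixed_point V ?\<phi>2 H" if "H \<in> \<H>2" for H
    using elliptic[of "?\<iota>2 ` H"] that by (auto simp: has_global_fixed_point_def)
  have sub1: "H \<subseteq> carrier G1" if "H \<in> \<H>1" for H by (rule subgroup.subset[OF assms(3)[OF that]])
  have sub2: "H \<subseteq> carrier G2" if "H \<in> \<H>2" for H by (rule subgroup.subset[OF assms(4)[OF that]])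
  have oe1: "one_ended_rel G1 (insert C1 \<H>1)" and oe2: "one_ended_rel G2 (insert C2 \<H>2)"
    using assms(12,13) by simp_all
  have inf: "infinite C1" "infinite C2" using assms(9,10) by (simp_all add: two_ended_def)
  have glued: "?\<iota>2 (f c) = ?\<iota>1 c" if "c \<in> C1" for c using amalgam_left_right[OF that] by simp

  \<comment> \<open>A vertex fixed by the amalgamated subgroup is fixed by both factors, hence by the amalgam.\<close>
  have not_elliptic: "\<not> has_global_fixed_point V ?\<phi>1 C1"
  proof
    assume fixed: "has_global_fixed_point V ?\<phi>1 C1"
    then obtain v where v: "v \<in> V" "\<And>c. c \<in> C1 \<Longrightarrow> ?\<phi>1 c v = v"
      by (auto simp: has_global_fixed_point_def)
    have v2: "?\<phi>2 d v = v" if d: "d \<in> C2" for d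
    proof -
      obtain c where "c \<in> C1" "d = f c" using d f by (auto simp: bij_betw_def)
      then show ?thesis using v glued by simp
    qed
    have 1: "?\<phi>1 g v = v" if "g \<in> carrier G1" for g
      by (rule T1.one_ended_fixes_vertex[OF oe1 _ fin1 _ C1.subset inf(1) v that])
         (use sub1 C1.subset elliptic1 fixed in auto)
    have fixed2: "has_global_fixed_point V ?\<phi>2 C2" using v(1) v2 by (auto simp: has_global_fixed_point_def)
    have 2: "?\<phi>2 g v = v" if "g \<in> carrier G2" for g
      by (rule T2.one_ended_fixes_vertex[OF oe2 _ fin2 _ C2.subset inf(2) v(1) v2 that])
         (use sub2 C2.subset elliptic2 fixed2 in auto)
    have "\<phi> a v = v" if "a \<in> carrier ?A" for a
      by (rule amalgam_fixes[OF T.G_tree_axioms v(1) 1 2 that])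
    then show False using T.minimal_no_fixed_vertex[OF min nontriv v(1)] by blast
  qed

  obtain v where v: "v \<in> V" using T.tree by (auto simp: simplicial_tree_def)
  let ?L = "T1.axis C1 v"
  have axes: "T2.axis C2 v = ?L"
  proof -
    have "finite {d \<in> C2. sep E e x (?\<phi>2 d v)} = finite {c \<in> C1. sep E e x (?\<phi>1 c v)}" for e x
    proof -
      have "{d \<in> C2. sep E e x (?\<phi>2 d v)} = f ` {c \<in> C1. sep E e x (?\<phi>1 c v)}"
        using f glued by (auto simp: bij_betw_def)
      moreover have "inj_on f {c \<in> C1. sep E e x (?\<phi>1 c v)}"
        using f by (auto simp: bij_betw_def intro: inj_on_subset)
      ultimately show ?thesis by (simp add: finite_image_iff)
    qed
    then show ?thesis by (simp add: T1.axis_def T2.axis_def)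
  qed
  obtain \<tau> where \<tau>: "\<tau> \<in> ?L" using T1.axis_nonempty[OF assms(5,9) v not_elliptic] by blast
  have \<tau>E: "\<tau> \<in> E" using \<tau> by (simp add: T1.axis_def)
  note \<tau>V = T.edge_subset[OF \<tau>E]
  \<comment> \<open>The set \<open>Y\<close> is a union of right cosets of the amalgamated subgroup, finitely many because the axis
    consists of finitely many orbits of edges. The length is constant on each coset, so that it
    attains a maximum on \<open>Y\<close>.\<close>
  define Y where "Y = {a \<in> carrier ?A. \<phi> a ` \<tau> \<in> ?L}"
  obtain P where P: "finite P" "\<And>e. e \<in> ?L \<Longrightarrow> \<exists>c\<in>C1. \<exists>p\<in>P. e = ?\<phi>1 c ` p" "P \<subseteq> E"
    by (rule T1.axis_cofinite[OF assms(5,9) v]) blast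
  have left_in: "?\<iota>1 g \<in> carrier ?A" if "g \<in> carrier G1" for g
    using amalgam_left_hom that by (auto simp: hom_def)
  have right_in: "?\<iota>2 g \<in> carrier ?A" if "g \<in> carrier G2" for g
    using amalgam_right_hom that by (auto simp: hom_def)
  have "len ` Y \<subseteq> len ` (\<Union>p\<in>P. {a \<in> carrier ?A. \<phi> a ` \<tau> = p})"
  proof
    fix n assume "n \<in> len ` Y"
    then obtain a where a: "a \<in> carrier ?A" "\<phi> a ` \<tau> \<in> ?L" "n = len a" by (auto simp: Y_def)
    obtain c p where c: "c \<in> C1" "p \<in> P" "\<phi> a ` \<tau> = ?\<phi>1 c ` p" using P(2)[OF a(2)] by blast
    have cA: "?\<iota>1 c \<in> carrier ?A" using left_in c(1) by simp
    define b where "b = inv\<^bsub>?A\<^esub> (?\<iota>1 c) \<otimes>\<^bsub>?A\<^esub> a"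
    have bA: "b \<in> carrier ?A" using cA a(1) by (simp add: b_def)
    have "p \<subseteq> V" using c(2) P(3) T.edge_subset by blast
    then have "\<phi> b ` \<tau> = p"
      using T.act_img_comp[OF T.inv_closed[OF cA] a(1) \<tau>V] c(3) T.act_img_inv(1)[OF cA] by (simp add: b_def)
    moreover have "a = ?\<iota>1 c \<otimes>\<^bsub>?A\<^esub> b" using cA a(1) by (simp add: b_def flip: T.m_assoc)
    then have "n = len b" using len_C1[OF c(1) bA] a(3) by simp
    ultimately show "n \<in> len ` (\<Union>p\<in>P. {a \<in> carrier ?A. \<phi> a ` \<tau> = p})" using bA c(2) by blast
  qed
  then have "finite (len ` Y)"
    by (rule finite_subset) (use P(1) T.finite_transporter[OF fin \<tau>E] in blast)
  moreover have "\<one>\<^bsub>?A\<^esub> \<in> Y" using \<tau> T.act_img_one[OF \<tau>V] by (simp add: Y_def)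
  ultimately have "Max (len ` Y) \<in> len ` Y" "\<And>a. a \<in> Y \<Longrightarrow> len a \<le> Max (len ` Y)"
    by (auto intro: Max_in)
  then obtain b where b: "b \<in> Y" "\<And>a. a \<in> Y \<Longrightarrow> len a \<le> len b" by (metis imageE)
  have bA: "b \<in> carrier ?A" and bL: "\<phi> b ` \<tau> \<in> ?L" using b(1) by (auto simp: Y_def)
  have move: "a \<otimes>\<^bsub>?A\<^esub> b \<in> Y" if "a \<in> carrier ?A" "\<phi> a ` \<phi> b ` \<tau> \<in> ?L" for a
    using that bA T.act_img_comp[OF that(1) bA \<tau>V] by (simp add: Y_def)
  \<comment> \<open>At the maximum, one of the factors moves \<open>b \<tau>\<close> off the axis, except for its elements in the
    amalgamated subgroup.\<close>
  from len_grows[OF bA] show False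
  proof
    assume grow: "\<forall>g\<in>carrier G1 - C1. len b < len (?\<iota>1 g \<otimes>\<^bsub>?A\<^esub> b)"
    have "g \<in> C1" if "g \<in> carrier G1" "?\<phi>1 g ` \<phi> b ` \<tau> \<in> ?L" for g
      using grow b(2)[OF move[OF left_in[OF that(1)] that(2)]] that(1) by (meson DiffI leD)
    then have "C1 = carrier G1"
      using T1.private_axis_edge_imp_eq[OF oe1 sub1 fin1 elliptic1 assms(5,9) v bL] by blast
    then show False using assms(7) by blast
  next
    assume grow: "\<forall>g\<in>carrier G2 - C2. len b < len (?\<iota>2 g \<otimes>\<^bsub>?A\<^esub> b)"
    have "g \<in> C2" if "g \<in> carrier G2" "?\<phi>2 g ` \<phi> b ` \<tau> \<in> ?L" for g
      using grow b(2)[OF move[OF right_in[OF that(1)] that(2)]] that(1) by (meson DiffI leD)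
    then have "C2 = carrier G2"
      using T2.private_axis_edge_imp_eq[OF oe2 sub2 fin2 elliptic2 assms(6,10) v] bL
      unfolding axes by blast
    then show False using assms(8) by blast
  qed
qed

end
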